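(* Let $\mu$ be a rotation-invariant positive Borel measure on $\mathbb{C}^n$ ($n\ge1$) such that $m_d=\int_{\mathbb{C}^n}|z|^{2d}\,d\mu$ satisfies $0<m_d<\infty$ for all $d\in\mathbb{N}$, and let $p>0$. Then the canonical solution operator to $\bar\partial$ is in the Schatten class $\mathcal{S}_p$, as an operator from $A^2_{(0,1)}(d\mu)$ to $L^2(d\mu)$, if and only if $$\sum_{d=1}^{\infty}\binom{n+d-2}{n-1}\left(\frac{(2n+d-1)\,m_{d+1}}{(n+d)\,m_d}-\frac{m_d}{m_{d-1}}\right)^{\frac p2}<\infty .$$
   Context: $\mathbb{N}=\{0,1,2,\dots\}$; $|z|^2=\sum_j|z_j|^2$. Rotation-invariant means invariant under the unitary group $U(n)$; in particular the monomials are pairwise orthogonal in $L^2(d\mu)$. $A^2(d\mu)$ is the closure in $L^2(d\mu)$ of the linear span of the monomials $z^\alpha$, $\alpha\in\mathbb{N}^n$. $A^2_{(0,1)}(d\mu)$ is the Hilbert space of $(0,1)$-forms $\sum_{j=1}^n f_j\,d\bar z_j$ with $f_j\in A^2(d\mu)$, with norm squared $\sum_j\|f_j\|^2_{L^2(d\mu)}$. Canonical solution operator $S$: $S\omega$ is the solution $f\in L^2(d\mu)$ of $\bar\partial f=\omega$ that is orthogonal to $A^2(d\mu)$. Concretely, since $\bar\partial(\bar z_j z^\alpha)=z^\alpha d\bar z_j$, on the dense subspace of forms with polynomial coefficients (finite linear combinations of the $z^\alpha d\bar z_j$) $S$ is the linear map for which $S(z^\alpha d\bar z_j)$ is the unique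 element of $\bar z_j z^\alpha+A^2(d\mu)$ orthogonal to $A^2(d\mu)$. A compact operator $T\colon H_1\to H_2$ between Hilbert spaces belongs to the Schatten class $\mathcal{S}_p$ if its sequence of singular values (square roots of the eigenvalues of $T^*T$, with multiplicity) belongs to $\ell^p$. "$S\in\mathcal{S}_p$" means that the densely defined map $S$ extends to a (bounded) compact operator $A^2_{(0,1)}(d\mu)\to L^2(d\mu)$ belonging to $\mathcal{S}_p$. *)

theory Defs
  imports "HOL-Analysis.Analysis" "HOL-Library.Function_Algebras" "HOL-Library.Extended_Nat"
begin

section \<open>Operators between Hilbert spaces of functions\<close>

text \<open>
  A Hilbert space is given by a complex vector space of representatives together with a positive
  semidefinite inner product, which is linear in the first argument. Two representatives denote the
  same element of the Hilbert space if their difference has norm 0 (for L2 spaces: if they agree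
  almost everywhere), see \<open>heq\<close>.
\<close>

record 'v hspace =
  vecs :: "'v set"
  scl :: "complex \<Rightarrow> 'v \<Rightarrow> 'v"
  ip :: "'v \<Rightarrow> 'v \<Rightarrow> complex"

definition hnorm :: "'v hspace \<Rightarrow> 'v \<Rightarrow> real" where
  "hnorm H x = sqrt (Re (ip H x x))"

definition heq :: "'v::ab_group_add hspace \<Rightarrow> 'v \<Rightarrow> 'v \<Rightarrow> bool" where
  "heq H x y \<longleftrightarrow> hnorm H (x - y) = 0"

definition linear_op ::
  "'v::ab_group_add hspace \<Rightarrow> 'w::ab_group_add hspace \<Rightarrow> ('v \<Rightarrow> 'w) \<Rightarrow> bool" where
  "linear_op H K T \<longleftrightarrow>
     (\<forall>x\<in>vecs H. T x \<in> vecs K) \<and>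
     (\<forall>x\<in>vecs H. \<forall>y\<in>vecs H. heq K (T (x + y)) (T x + T y)) \<and>
     (\<forall>c. \<forall>x\<in>vecs H. heq K (T (scl H c x)) (scl K c (T x)))"

text \<open>Boundedness makes a linear operator well defined modulo vectors of norm 0.\<close>

definition bounded_op ::
  "'v::ab_group_add hspace \<Rightarrow> 'w::ab_group_add hspace \<Rightarrow> ('v \<Rightarrow> 'w) \<Rightarrow> bool" where
  "bounded_op H K T \<longleftrightarrow>
     linear_op H K T \<and> (\<exists>C. \<forall>x\<in>vecs H. hnorm K (T x) \<le> C * hnorm H x)"

definition compact_op ::
  "'v::ab_group_add hspace \<Rightarrow> 'w::ab_group_add hspace \<Rightarrow> ('v \<Rightarrow> 'w) \<Rightarrow> bool" where
  "compact_op H K T \<longleftrightarrow>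
     bounded_op H K T \<and>
     (\<forall>x :: nat \<Rightarrow> 'v.
        (\<forall>k. x k \<in> vecs H) \<and> (\<exists>B. \<forall>k. hnorm H (x k) \<le> B) \<longrightarrow>
        (\<exists>y\<in>vecs K. \<exists>r :: nat \<Rightarrow> nat. strict_mono r \<and>
           (\<lambda>k. hnorm K (T (x (r k)) - y)) \<longlonglongrightarrow> 0))"

definition is_adjoint :: "'v hspace \<Rightarrow> 'w hspace \<Rightarrow> ('v \<Rightarrow> 'w) \<Rightarrow> ('w \<Rightarrow> 'v) \<Rightarrow> bool" where
  "is_adjoint H K T A \<longleftrightarrow>
     (\<forall>y\<in>vecs K. A y \<in> vecs H) \<and>
     (\<forall>x\<in>vecs H. \<forall>y\<in>vecs K. ip K (T x) y = ip H x (A y))"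

definition eigenspace :: "'v::ab_group_add hspace \<Rightarrow> ('v \<Rightarrow> 'v) \<Rightarrow> real \<Rightarrow> 'v set" where
  "eigenspace H B l = {x \<in> vecs H. heq H (B x) (scl H (complex_of_real l) x)}"

definition hindependent :: "'v::ab_group_add hspace \<Rightarrow> 'v set \<Rightarrow> bool" where
  "hindependent H F \<longleftrightarrow>
     (\<forall>c :: 'v \<Rightarrow> complex. heq H (\<Sum>v\<in>F. scl H (c v) v) 0 \<longrightarrow> (\<forall>v\<in>F. c v = 0))"

text \<open>The dimension of the image of a set of representatives in the Hilbert space.\<close>

definition hdim :: "'v::ab_group_add hspace \<Rightarrow> 'v set \<Rightarrow> enat" where
  "hdim H E = (SUP F \<in> {F. finite F \<and> F \<subseteq> E \<and> hindependent H F}. enat (card F))"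

text \<open>
  The eigenvalues of an operator \<open>B\<close> of the form \<open>T\<^sup>*T\<close> are real, and \<open>l\<close> is an eigenvalue iff its
  eigenspace has positive dimension. So the pairs \<open>(l, i)\<close> in the following set enumerate the
  eigenvalues with multiplicity.
\<close>

definition eigen_index :: "'v::ab_group_add hspace \<Rightarrow> ('v \<Rightarrow> 'v) \<Rightarrow> (real \<times> nat) set" where
  "eigen_index H B = {(l, i). enat i < hdim H (eigenspace H B l)}"

definition schatten_class ::
  "real \<Rightarrow> 'v::ab_group_add hspace \<Rightarrow> 'w::ab_group_add hspace \<Rightarrow> ('v \<Rightarrow> 'w) set" where
  "schatten_class p H K =
     {T. compact_op H K T \<and>
         (\<exists>A. is_adjoint H K T A \<and>
              (\<lambda>(l, i). sqrt l powr p) summable_on eigen_index H (A \<circ> T))}"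


section \<open>The spaces and the canonical solution operator\<close>

definition unitary_matrix :: "complex ^ 'n ^ 'n \<Rightarrow> bool" where
  "unitary_matrix U \<longleftrightarrow>
     (\<chi> i j. cnj (U $ j $ i)) ** U = mat 1 \<and> U ** (\<chi> i j. cnj (U $ j $ i)) = mat 1"

definition rotation_invariant :: "(complex ^ 'n) measure \<Rightarrow> bool" where
  "rotation_invariant M \<longleftrightarrow> (\<forall>U. unitary_matrix U \<longrightarrow> distr M borel (\<lambda>z. U *v z) = M)"

definition moment :: "(complex ^ 'n) measure \<Rightarrow> nat \<Rightarrow> real" where
  "moment M d = (\<integral>z. norm z ^ (2 * d) \<partial>M)"

definition L2 :: "'a measure \<Rightarrow> ('a \<Rightarrow> complex) hspace" where
  "L2 M = \<lparr> vecs = {f \<in> borel_measurable M. integrable M (\<lambda>z. (cmod (f z))\<^sup>2)},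
            scl = (\<lambda>c f z. c * f z),
            ip = (\<lambda>f g. \<integral>z. f z * cnj (g z) \<partial>M) \<rparr>"

definition monomial :: "('n \<Rightarrow> nat) \<Rightarrow> complex ^ 'n \<Rightarrow> complex" where
  "monomial \<alpha> z = (\<Prod>j\<in>UNIV. (z $ j) ^ \<alpha> j)"

definition polynomials :: "(complex ^ 'n \<Rightarrow> complex) set" where
  "polynomials = module.span (\<lambda>c f z. c * f z) (range monomial)"

definition A2 :: "(complex ^ 'n) measure \<Rightarrow> (complex ^ 'n \<Rightarrow> complex) set" where
  "A2 M = {f \<in> vecs (L2 M). \<forall>e>0. \<exists>q\<in>polynomials. hnorm (L2 M) (f - q) < e}"

text \<open>A (0,1)-form is represented by the family of its coefficients.\<close>

definition A2_01 :: "(complex ^ 'n) measure \<Rightarrow> ('n \<Rightarrow> complex ^ 'n \<Rightarrow> complex) hspace" where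
  "A2_01 M = \<lparr> vecs = {\<omega>. \<forall>j. \<omega> j \<in> A2 M},
               scl = (\<lambda>c \<omega> j z. c * \<omega> j z),
               ip = (\<lambda>\<omega> \<eta>. \<Sum>j\<in>UNIV. ip (L2 M) (\<omega> j) (\<eta> j)) \<rparr>"

definition monomial_form :: "('n \<Rightarrow> nat) \<Rightarrow> 'n \<Rightarrow> 'n \<Rightarrow> complex ^ 'n \<Rightarrow> complex" where
  "monomial_form \<alpha> j = (\<lambda>k. if k = j then monomial \<alpha> else 0)"

text \<open>
  The form \<open>monomial_form \<alpha> j\<close> is dbar of the function mapping \<open>z\<close> to \<open>cnj (z $ j) * monomial \<alpha> z\<close>,
  so the solutions of the dbar-equation for it are the elements of this function plus \<open>A2 M\<close>.
  \<open>S\<close> restricts, on the forms with polynomial coefficients, to the canonical solution operator: it is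
  linear there, hence determined by its values on the monomial forms. Its values on other forms are
  not constrained.
\<close>

definition is_canonical_solution_op ::
  "(complex ^ 'n) measure \<Rightarrow> (('n \<Rightarrow> complex ^ 'n \<Rightarrow> complex) \<Rightarrow> complex ^ 'n \<Rightarrow> complex) \<Rightarrow> bool"
where
  "is_canonical_solution_op M S \<longleftrightarrow>
     linear_op ((A2_01 M)\<lparr>vecs := {\<omega>. \<forall>j. \<omega> j \<in> polynomials}\<rparr>) (L2 M) S \<and>
     (\<forall>\<alpha> j. S (monomial_form \<alpha> j) - (\<lambda>z. cnj (z $ j) * monomial \<alpha> z) \<in> A2 M \<and>
            (\<forall>g\<in>A2 M. ip (L2 M) (S (monomial_form \<alpha> j)) g = 0))"

end

theory Submission
  imports Defs
begin

text \<open>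
  Write $n$ for the dimension, $m_d$ for the moments and $c_\alpha$ for the squared norm of
  $z^\alpha$. Rotation invariance makes the monomials orthogonal and forces
  $c_\alpha = \kappa_{|\alpha|}\, \alpha!$ with $m_d = \kappa_d\, n (n+1) \cdots (n+d-1)$. So
  $a_d = \kappa_{d+1} / \kappa_d$ equals $m_{d+1} / ((n+d) m_d)$.

  The canonical solution of $z^\alpha d\bar z_j$ is
  $\bar z_j z^\alpha - (c_\alpha / c_{\alpha - e_j}) z^{\alpha - e_j}$, without the second term if
  $\alpha_j = 0$. The solutions for $(\alpha, j)$ and $(\beta, k)$ are orthogonal unless
  $\alpha + e_k = \beta + e_j$. Thus $S^* S$ decomposes into blocks. A form with $\alpha_j = 0$ is
  a block of its own, with eigenvalue $a_{|\alpha|}$. The other blocks belong to the multi-indices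
  $\gamma$ and consist of the $n$ forms $z^{\gamma + e_j} d\bar z_j$, $j = 1, \ldots, n$. With
  $d = |\gamma| + 1$ and normalized forms, the Gram matrix of the solutions is
  $a_d I + (a_d - a_{d-1}) v v^T$ where $v_j = (\gamma_j + 1)^{1/2}$ and $|v|^2 = n + d - 1$. An
  orthogonal matrix that maps a coordinate vector to $v / |v|$ diagonalizes it. The eigenvalues are
  $a_d$, $n - 1$ times, and $b_d = a_d + (a_d - a_{d-1}) (n + d - 1)$, once. In terms of the
  moments, $b_d = m_{d+1} / m_d - m_d / m_{d-1}$.

  There are $N_d = \binom{n+d-2}{n-1}$ multi-indices $\gamma$ with $|\gamma| = d - 1$, and the base
  of the power in the series is the trace $(n-1) a_d + b_d$ of such a block. Its power is comparable
  to the sum of the powers of the eigenvalues, since all of them are nonnegative. The forms with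
  $\alpha_j = 0$ and $|\alpha| = d \ge 1$ do not affect convergence. For $n = 1$ there are none of
  them, and for $n \ge 2$ every nonzero multi-index has a positive component, so that the sum of
  $a_{|\alpha|}^{p/2}$ over all $\alpha \ne 0$ is at most the sum over $k$ of the sums over the
  $\alpha$ with $\alpha_k \ge 1$; each of the latter sums is $\sum_d N_d\, a_d^{p/2}$. This
  comparison is \<open>summable_on_split_eigenvalue_iff\<close>.

  What remains is the abstract fact that an operator mapping a complete orthonormal system $u_k$ to
  an orthogonal system $w_k$ is in $\mathcal{S}_p$ iff the numbers $|w_k|^p$ are summable, and that
  summability suffices for such an operator to exist. These are
  \<open>schatten_class_imp_summable\<close> and \<open>summable_imp_schatten_class\<close>. The existence needs the
  completeness of the two spaces, hence a Riesz-Fischer theorem.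
\<close>

section \<open>Hilbert spaces of representatives\<close>

lemma mult_cnj_eq_norm_sq: "z * cnj z = (complex_of_real (cmod z))\<^sup>2"
  by (metis complex_norm_square of_real_power)

text \<open>
  Only vectors of norm 0 are identified, not assumed to be 0. Equality in the Hilbert space is
  therefore expressed by pairing with all vectors, see \<open>heq_iff_ip\<close> below.
\<close>

locale semi_inner =
  fixes H :: "'v::ab_group_add hspace"
  assumes zero_mem [simp]: "0 \<in> vecs H"
    and add_mem [simp]: "x \<in> vecs H \<Longrightarrow> y \<in> vecs H \<Longrightarrow> x + y \<in> vecs H"
    and scl_mem [simp]: "x \<in> vecs H \<Longrightarrow> scl H c x \<in> vecs H"
    and scl_minus_one: "scl H (-1) x = - x"
    and ip_add_left: "x \<in> vecs H \<Longrightarrow> y \<in> vecs H \<Longrightarrow> v \<in> vecs H \<Longrightarrow> ip H (x + y) v = ip H x v + ip H y v"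
    and ip_scl_left [simp]: "x \<in> vecs H \<Longrightarrow> v \<in> vecs H \<Longrightarrow> ip H (scl H c x) v = c * ip H x v"
    and ip_cnj: "x \<in> vecs H \<Longrightarrow> y \<in> vecs H \<Longrightarrow> cnj (ip H x y) = ip H y x"
    and ip_ge_0: "x \<in> vecs H \<Longrightarrow> 0 \<le> Re (ip H x x)"
begin

lemma uminus_mem [simp]: "x \<in> vecs H \<Longrightarrow> - x \<in> vecs H"
  using scl_mem[of x "-1"] by (simp add: scl_minus_one)

lemma diff_mem [simp]: "x \<in> vecs H \<Longrightarrow> y \<in> vecs H \<Longrightarrow> x - y \<in> vecs H"
  using add_mem[of x "- y"] by simp

lemma ip_diff_left:
  assumes "x \<in> vecs H" "y \<in> vecs H" "v \<in> vecs H"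
  shows "ip H (x - y) v = ip H x v - ip H y v"
proof -
  have "ip H (- y) v = - ip H y v"
    using ip_scl_left[of y v "-1"] assms by (simp add: scl_minus_one)
  then show ?thesis
    using ip_add_left[of x "- y" v] assms by simp
qed

lemma ip_zero_left [simp]: "v \<in> vecs H \<Longrightarrow> ip H 0 v = 0"
  using ip_diff_left[of 0 0 v] by simp

lemma ip_add_right:
  assumes "x \<in> vecs H" "y \<in> vecs H" "v \<in> vecs H"
  shows "ip H v (x + y) = ip H v x + ip H v y"
  using ip_add_left[of x y v] assms by (metis add_mem complex_cnj_add ip_cnj)

lemma ip_diff_right:
  assumes "x \<in> vecs H" "y \<in> vecs H" "v \<in> vecs H"
  shows "ip H v (x - y) = ip H v x - ip H v y"
  using ip_diff_left[of x y v] assms by (metis diff_mem complex_cnj_diff ip_cnj)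

lemma ip_scl_right [simp]:
  assumes "x \<in> vecs H" "v \<in> vecs H"
  shows "ip H v (scl H c x) = cnj c * ip H v x"
  using ip_scl_left[of x v c] assms by (metis scl_mem complex_cnj_mult ip_cnj)

lemma sum_mem [simp]: "(\<And>i. i \<in> F \<Longrightarrow> f i \<in> vecs H) \<Longrightarrow> sum f F \<in> vecs H"
  by (induction F rule: infinite_finite_induct) auto

lemma ip_sum_left:
  "(\<And>i. i \<in> F \<Longrightarrow> f i \<in> vecs H) \<Longrightarrow> v \<in> vecs H \<Longrightarrow> ip H (sum f F) v = (\<Sum>i\<in>F. ip H (f i) v)"
  by (induction F rule: infinite_finite_induct) (auto simp: ip_add_left)

lemma ip_sum_right:
  assumes "\<And>i. i \<in> F \<Longrightarrow> f i \<in> vecs H" "v \<in> vecs H"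
  shows "ip H v (sum f F) = (\<Sum>i\<in>F. ip H v (f i))"
proof -
  have "ip H v (sum f F) = cnj (ip H (sum f F) v)"
    using assms by (simp add: ip_cnj)
  also have "\<dots> = (\<Sum>i\<in>F. cnj (ip H (f i) v))"
    using assms by (simp add: ip_sum_left cnj_sum)
  also have "\<dots> = (\<Sum>i\<in>F. ip H v (f i))"
    using assms by (intro sum.cong) (auto simp: ip_cnj)
  finally show ?thesis .
qed

lemma hnorm_nonneg [simp]: "x \<in> vecs H \<Longrightarrow> 0 \<le> hnorm H x"
  by (simp add: hnorm_def ip_ge_0)

lemma hnorm_sq: "x \<in> vecs H \<Longrightarrow> (hnorm H x)\<^sup>2 = Re (ip H x x)"
  by (simp add: hnorm_def ip_ge_0)

lemma ip_self: "x \<in> vecs H \<Longrightarrow> ip H x x = complex_of_real ((hnorm H x)\<^sup>2)"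
  using ip_cnj[of x x] by (simp add: hnorm_sq complex_eq_iff)

lemma hnorm_diff_scl_sq:
  assumes "x \<in> vecs H" "y \<in> vecs H"
  shows "(hnorm H (x - scl H t y))\<^sup>2 = (hnorm H x)\<^sup>2 - 2 * Re (cnj t * ip H x y) + (cmod t)\<^sup>2 * (hnorm H y)\<^sup>2"
proof -
  have "ip H (x - scl H t y) (x - scl H t y)
      = ip H x x - cnj t * ip H x y - cnj (cnj t * ip H x y) + t * cnj t * ip H y y"
    using assms by (simp add: ip_diff_left ip_diff_right ip_cnj algebra_simps)
  then have "(hnorm H (x - scl H t y))\<^sup>2
      = Re (ip H x x - cnj t * ip H x y - cnj (cnj t * ip H x y) + t * cnj t * ip H y y)"
    using assms by (simp add: hnorm_sq)
  then show ?thesis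
    using assms by (simp add: ip_self mult_cnj_eq_norm_sq)
qed

lemma Cauchy_Schwarz:
  assumes "x \<in> vecs H" "y \<in> vecs H"
  shows "cmod (ip H x y) \<le> hnorm H x * hnorm H y"
proof (cases "hnorm H y = 0")
  case True
  have "ip H x y = 0"
  proof (rule ccontr)
    assume z: "ip H x y \<noteq> 0"
    define s where "s = ((hnorm H x)\<^sup>2 + 1) / (2 * (cmod (ip H x y))\<^sup>2)"
    have "0 \<le> (hnorm H (x - scl H (complex_of_real s * ip H x y) y))\<^sup>2"
      by simp
    also have "\<dots> = (hnorm H x)\<^sup>2 - 2 * s * (cmod (ip H x y))\<^sup>2"
    proof -
      have "cnj (complex_of_real s * ip H x y) * ip H x y = complex_of_real (s * (cmod (ip H x y))\<^sup>2)"
        by (simp add: mult_cnj_eq_norm_sq mult_ac)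
      then show ?thesis
        using True by (simp only: hnorm_diff_scl_sq[OF assms]) simp
    qed
    also have "\<dots> = -1"
      using z by (simp add: s_def field_simps)
    finally show False by simp
  qed
  then show ?thesis using assms by simp
next
  case False
  define t where "t = ip H x y / complex_of_real ((hnorm H y)\<^sup>2)"
  have pos: "(hnorm H y)\<^sup>2 > 0" using False by simp
  have "0 \<le> (hnorm H (x - scl H t y))\<^sup>2"
    by simp
  also have "\<dots> = (hnorm H x)\<^sup>2 - 2 * Re (cnj t * ip H x y) + (cmod t)\<^sup>2 * (hnorm H y)\<^sup>2"
    using assms by (rule hnorm_diff_scl_sq)
  also have "Re (cnj t * ip H x y) = (cmod (ip H x y))\<^sup>2 / (hnorm H y)\<^sup>2"
  proof -
    have "cnj t * ip H x y = complex_of_real ((cmod (ip H x y))\<^sup>2 / (hnorm H y)\<^sup>2)"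
      by (simp add: t_def mult_cnj_eq_norm_sq mult_ac)
    then show ?thesis by simp
  qed
  also have "(cmod t)\<^sup>2 * (hnorm H y)\<^sup>2 = (cmod (ip H x y))\<^sup>2 / (hnorm H y)\<^sup>2"
  proof -
    have "cmod t = cmod (ip H x y) / (hnorm H y)\<^sup>2"
      by (simp add: t_def norm_divide norm_power)
    then show ?thesis
      using False by (simp add: power_divide power2_eq_square)
  qed
  finally have "(cmod (ip H x y))\<^sup>2 / (hnorm H y)\<^sup>2 \<le> (hnorm H x)\<^sup>2"
    by simp
  then have "(cmod (ip H x y))\<^sup>2 \<le> (hnorm H x * hnorm H y)\<^sup>2"
    using pos by (simp add: divide_le_eq power_mult_distrib)
  then show ?thesis
    by (rule power2_le_imp_le) (use assms in simp)
qed

lemma hnorm_triangle: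
  assumes "x \<in> vecs H" "y \<in> vecs H"
  shows "hnorm H (x + y) \<le> hnorm H x + hnorm H y"
proof -
  have "ip H (x + y) (x + y) = ip H x x + ip H x y + cnj (ip H x y) + ip H y y"
    using assms by (simp add: ip_add_left ip_add_right ip_cnj)
  then have "(hnorm H (x + y))\<^sup>2 = (hnorm H x)\<^sup>2 + 2 * Re (ip H x y) + (hnorm H y)\<^sup>2"
    using assms by (simp add: hnorm_sq)
  also have "\<dots> \<le> (hnorm H x)\<^sup>2 + 2 * (hnorm H x * hnorm H y) + (hnorm H y)\<^sup>2"
    using Cauchy_Schwarz[OF assms] complex_Re_le_cmod[of "ip H x y"] by simp
  also have "\<dots> = (hnorm H x + hnorm H y)\<^sup>2"
    by (simp add: power2_eq_square algebra_simps)
  finally show ?thesis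
    by (rule power2_le_imp_le) (use assms in simp)
qed

lemma hnorm_scl: "x \<in> vecs H \<Longrightarrow> hnorm H (scl H c x) = cmod c * hnorm H x"
proof -
  assume x: "x \<in> vecs H"
  have "ip H (scl H c x) (scl H c x) = c * cnj c * ip H x x"
    using x by simp
  then have "(hnorm H (scl H c x))\<^sup>2 = Re (c * cnj c * ip H x x)"
    using x by (simp only: hnorm_sq scl_mem)
  also have "\<dots> = (cmod c * hnorm H x)\<^sup>2"
    using x by (simp only: ip_self mult_cnj_eq_norm_sq of_real_power[symmetric] of_real_mult[symmetric] Re_complex_of_real power_mult_distrib)
  finally have "(hnorm H (scl H c x))\<^sup>2 = (cmod c * hnorm H x)\<^sup>2" .
  then show ?thesis
    by (rule power2_eq_imp_eq) (use x in simp_all)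
qed

lemma hnorm_minus: "x \<in> vecs H \<Longrightarrow> hnorm H (- x) = hnorm H x"
  using hnorm_scl[of x "-1"] by (simp add: scl_minus_one)

lemma hnorm_diff_commute: "x \<in> vecs H \<Longrightarrow> y \<in> vecs H \<Longrightarrow> hnorm H (x - y) = hnorm H (y - x)"
  using hnorm_minus[of "x - y"] by simp

lemma hnorm_triangle_diff:
  assumes "x \<in> vecs H" "y \<in> vecs H" "v \<in> vecs H"
  shows "hnorm H (x - v) \<le> hnorm H (x - y) + hnorm H (y - v)"
  using hnorm_triangle[of "x - y" "y - v"] assms by simp

lemma ip_null: "x \<in> vecs H \<Longrightarrow> y \<in> vecs H \<Longrightarrow> hnorm H x = 0 \<Longrightarrow> ip H x y = 0"
  using Cauchy_Schwarz[of x y] by simp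

lemma heq_iff_ip:
  assumes "x \<in> vecs H" "y \<in> vecs H"
  shows "heq H x y \<longleftrightarrow> (\<forall>v\<in>vecs H. ip H x v = ip H y v)"
proof
  assume "heq H x y"
  then have "ip H (x - y) v = 0" if "v \<in> vecs H" for v
    using assms that by (simp add: heq_def ip_null)
  then show "\<forall>v\<in>vecs H. ip H x v = ip H y v"
    using assms by (simp add: ip_diff_left)
next
  assume "\<forall>v\<in>vecs H. ip H x v = ip H y v"
  then have "ip H (x - y) (x - y) = 0"
    using assms by (simp add: ip_diff_left)
  then show "heq H x y"
    using assms by (simp add: heq_def hnorm_def)
qed

lemma heq_ip_right:
  assumes "x \<in> vecs H" "y \<in> vecs H" "v \<in> vecs H" "heq H x y"
  shows "ip H v x = ip H v y"
  using assms by (metis heq_iff_ip ip_cnj)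

lemma ip_sum_orthogonal:
  assumes w: "\<And>k. w k \<in> vecs H"
    and orth: "\<And>i j. ip H (w i) (w j) = (if i = j then complex_of_real (l i) else 0)"
    and "finite F"
  shows "ip H (\<Sum>k\<in>F. scl H (c k) (w k)) (\<Sum>k\<in>F. scl H (c k) (w k)) = complex_of_real (\<Sum>k\<in>F. (cmod (c k))\<^sup>2 * l k)"
proof -
  have "ip H (\<Sum>k\<in>F. scl H (c k) (w k)) (\<Sum>k\<in>F. scl H (c k) (w k))
      = (\<Sum>i\<in>F. c i * ip H (w i) (\<Sum>k\<in>F. scl H (c k) (w k)))"
    using w by (subst ip_sum_left) auto
  also have "\<dots> = (\<Sum>i\<in>F. \<Sum>j\<in>F. c i * (cnj (c j) * ip H (w i) (w j)))"
    using w by (simp add: ip_sum_right sum_distrib_left)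
  also have "\<dots> = (\<Sum>i\<in>F. c i * (cnj (c i) * complex_of_real (l i)))"
    using \<open>finite F\<close> by (intro sum.cong) (auto simp: orth if_distrib cong: if_cong)
  also have "\<dots> = complex_of_real (\<Sum>k\<in>F. (cmod (c k))\<^sup>2 * l k)"
    by (simp add: mult.assoc[symmetric] mult_cnj_eq_norm_sq)
  finally show ?thesis .
qed

text \<open>
  The vectors \<open>w k\<close> need not be normalized and may be null, so the inequality is not reduced to
  the orthonormal case. Instead, for \<open>S\<close> the left-hand side and \<open>v\<close> the sum of the vectors
  \<open>ip H y (w k) w k\<close>, the Cauchy-Schwarz inequality for \<open>S = ip H y v\<close> gives
  \<open>S\<^sup>2 \<le> \<parallel>y\<parallel>\<^sup>2 B S\<close>.
\<close>

lemma Bessel: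
  assumes w: "\<And>k. w k \<in> vecs H"
    and orth: "\<And>i j. ip H (w i) (w j) = (if i = j then complex_of_real (l i) else 0)"
    and bound: "\<And>k. l k \<le> B"
    and "finite F" and y: "y \<in> vecs H"
  shows "(\<Sum>k\<in>F. (cmod (ip H y (w k)))\<^sup>2) \<le> B * (hnorm H y)\<^sup>2"
proof -
  define S where "S = (\<Sum>k\<in>F. (cmod (ip H y (w k)))\<^sup>2)"
  define v where "v = (\<Sum>k\<in>F. scl H (ip H y (w k)) (w k))"
  have v: "v \<in> vecs H" using w by (simp add: v_def)
  have "ip H y v = (\<Sum>k\<in>F. cnj (ip H y (w k)) * ip H y (w k))"
    using w y by (simp add: v_def ip_sum_right)
  also have "\<dots> = complex_of_real S"
    by (simp add: S_def mult_cnj_eq_norm_sq mult.commute)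
  finally have ipv: "ip H y v = complex_of_real S" .
  have S0: "0 \<le> S" by (simp add: S_def sum_nonneg)
  have "ip H v v = complex_of_real (\<Sum>k\<in>F. (cmod (ip H y (w k)))\<^sup>2 * l k)"
    unfolding v_def by (rule ip_sum_orthogonal[OF w orth \<open>finite F\<close>])
  then have "(hnorm H v)\<^sup>2 = (\<Sum>k\<in>F. (cmod (ip H y (w k)))\<^sup>2 * l k)"
    using v by (simp add: hnorm_sq)
  also have "\<dots> \<le> (\<Sum>k\<in>F. (cmod (ip H y (w k)))\<^sup>2 * B)"
    using bound by (intro sum_mono mult_left_mono) auto
  finally have nv: "(hnorm H v)\<^sup>2 \<le> S * B" by (simp add: S_def sum_distrib_right)
  have "S \<le> hnorm H y * hnorm H v"
    using Cauchy_Schwarz[OF y v] S0 by (simp add: ipv)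
  then have "S\<^sup>2 \<le> (hnorm H y)\<^sup>2 * (hnorm H v)\<^sup>2"
    using S0 by (metis power_mono power_mult_distrib)
  also have "\<dots> \<le> (hnorm H y)\<^sup>2 * (S * B)"
    using nv by (intro mult_left_mono) auto
  finally have "S * S \<le> S * (B * (hnorm H y)\<^sup>2)"
    by (simp add: power2_eq_square mult_ac)
  moreover have "0 \<le> B"
    using bound[of undefined] ip_ge_0[OF w, of undefined] orth[of undefined undefined] by simp
  ultimately show ?thesis
    using S0 unfolding S_def[symmetric] by (cases "S = 0") (auto simp: mult_le_cancel_left)
qed

end

locale semi_hilbert = semi_inner +
  assumes complete:
    "(\<And>k. X k \<in> vecs H) \<Longrightarrow> (\<And>e. 0 < e \<Longrightarrow> \<exists>N. \<forall>m\<ge>N. \<forall>n\<ge>N. hnorm H (X m - X n) < e)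
      \<Longrightarrow> \<exists>x\<in>vecs H. (\<lambda>k. hnorm H (X k - x)) \<longlonglongrightarrow> 0"
begin

text \<open>
  The partial sums are Cauchy by Pythagoras. Their limit is characterized by its inner products,
  since these determine it up to a vector of norm 0.
\<close>

lemma orthogonal_series:
  assumes w: "\<And>k. w k \<in> vecs H"
    and orth: "\<And>i j. ip H (w i) (w j) = (if i = j then complex_of_real (l i) else 0)"
    and sm: "summable (\<lambda>k. (cmod (c k))\<^sup>2 * l k)"
  shows "\<exists>x\<in>vecs H. \<forall>v\<in>vecs H. (\<lambda>k. c k * ip H (w k) v) sums ip H x v"
proof -
  define X where "X N = (\<Sum>k<N. scl H (c k) (w k))" for N
  have X: "X N \<in> vecs H" for N using w by (simp add: X_def)
  have lpos: "0 \<le> l k" for k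
    using ip_ge_0[OF w, of k] orth[of k k] by simp
  have dist: "(hnorm H (X m - X n))\<^sup>2 = (\<Sum>k\<in>{n..<m}. (cmod (c k))\<^sup>2 * l k)" if "n \<le> m" for m n
  proof -
    have "X m - X n = (\<Sum>k\<in>{n..<m}. scl H (c k) (w k))"
      unfolding X_def using that
      by (metis sum_diff_nat_ivl lessThan_atLeast0 zero_le)
    then have "ip H (X m - X n) (X m - X n) = complex_of_real (\<Sum>k\<in>{n..<m}. (cmod (c k))\<^sup>2 * l k)"
      using ip_sum_orthogonal[OF w orth, of "{n..<m}" c] by simp
    then show ?thesis using X by (simp add: hnorm_sq)
  qed
  have "\<exists>x\<in>vecs H. (\<lambda>k. hnorm H (X k - x)) \<longlonglongrightarrow> 0"
  proof (rule complete[OF X])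
    fix e :: real assume "0 < e"
    then obtain N where N: "\<And>m n. N \<le> m \<Longrightarrow> norm (\<Sum>k\<in>{m..<n}. (cmod (c k))\<^sup>2 * l k) < e\<^sup>2"
      using sm unfolding summable_Cauchy by (meson zero_less_power)
    have *: "hnorm H (X m - X n) < e" if "N \<le> n" "n \<le> m" for m n
    proof -
      have "(hnorm H (X m - X n))\<^sup>2 < e\<^sup>2"
        using N[OF that(1), of m] that lpos by (simp add: dist abs_if sum_nonneg split: if_splits)
      then show ?thesis by (rule power2_less_imp_less) (use \<open>0 < e\<close> in simp)
    qed
    have "hnorm H (X m - X n) < e" if "N \<le> n" "N \<le> m" for m n
      using *[of n m] *[of m n] that hnorm_diff_commute[OF X X, of m n] by (cases "n \<le> m") auto
    then show "\<exists>N. \<forall>m\<ge>N. \<forall>n\<ge>N. hnorm H (X m - X n) < e" by blast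
  qed
  then obtain x where x: "x \<in> vecs H" and lim: "(\<lambda>k. hnorm H (X k - x)) \<longlonglongrightarrow> 0" by blast
  have "(\<lambda>k. c k * ip H (w k) v) sums ip H x v" if v: "v \<in> vecs H" for v
  proof -
    have "(\<lambda>N. ip H (X N) v - ip H x v) \<longlonglongrightarrow> 0"
    proof (rule Lim_null_comparison)
      show "\<forall>\<^sub>F N in sequentially. norm (ip H (X N) v - ip H x v) \<le> hnorm H (X N - x) * hnorm H v"
        using Cauchy_Schwarz[of "X _ - x" v] X x v by (simp add: ip_diff_left)
      show "(\<lambda>N. hnorm H (X N - x) * hnorm H v) \<longlonglongrightarrow> 0"
        using tendsto_mult_right[OF lim, of "hnorm H v"] by simp
    qed
    then have "(\<lambda>N. ip H (X N) v) \<longlonglongrightarrow> ip H x v"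
      by (simp add: LIM_zero_iff)
    then show ?thesis
      using w v by (simp add: sums_def X_def ip_sum_left)
  qed
  with x show ?thesis by blast
qed

end

section \<open>Schatten classes and orthogonal images of a complete orthonormal system\<close>

text \<open>
  Gaussian elimination: unless the coefficients of equation \<open>k\<close> vanish altogether, one unknown is
  eliminated together with that equation.
\<close>

lemma homogeneous_system_nontrivial:
  fixes a :: "'a \<Rightarrow> 'b \<Rightarrow> complex"
  assumes "finite J" "finite F" "card J < card F"
  shows "\<exists>c. (\<exists>v\<in>F. c v \<noteq> 0) \<and> (\<forall>k\<in>J. (\<Sum>v\<in>F. c v * a v k) = 0)"
  using assms
proof (induction J arbitrary: F a rule: finite_induct)
  case empty
  then obtain v where "v \<in> F" by fastforce
  then show ?case by (intro exI[of _ "\<lambda>_. 1"]) auto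
next
  case (insert k J)
  show ?case
  proof (cases "\<forall>v\<in>F. a v k = 0")
    case True
    obtain c where "\<exists>v\<in>F. c v \<noteq> 0" "\<forall>i\<in>J. (\<Sum>v\<in>F. c v * a v i) = 0"
      using insert.IH[of F a] insert.prems insert.hyps by auto
    then show ?thesis using True by (intro exI[of _ c]) auto
  next
    case False
    then obtain v0 where v0: "v0 \<in> F" "a v0 k \<noteq> 0" by blast
    define a' where "a' v i = a v i - a v k / a v0 k * a v0 i" for v i
    have "card J < card (F - {v0})"
      using insert.prems insert.hyps v0 by (simp add: card_Diff_singleton)
    then obtain c where nz: "\<exists>v\<in>F - {v0}. c v \<noteq> 0"
      and c: "\<And>i. i \<in> J \<Longrightarrow> (\<Sum>v\<in>F - {v0}. c v * a' v i) = 0"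
      using insert.IH[of "F - {v0}" a'] insert.prems by auto
    define d where "d v = (if v = v0 then - (\<Sum>v\<in>F - {v0}. c v * a v k) / a v0 k else c v)" for v
    have split: "(\<Sum>v\<in>F. d v * a v i) = d v0 * a v0 i + (\<Sum>v\<in>F - {v0}. c v * a v i)" for i
    proof -
      have "(\<Sum>v\<in>F. d v * a v i) = d v0 * a v0 i + (\<Sum>v\<in>F - {v0}. d v * a v i)"
        using insert.prems v0 by (simp add: sum.remove)
      also have "(\<Sum>v\<in>F - {v0}. d v * a v i) = (\<Sum>v\<in>F - {v0}. c v * a v i)"
        by (intro sum.cong) (auto simp: d_def)
      finally show ?thesis .
    qed
    have "(\<Sum>v\<in>F. d v * a v k) = 0"
      using v0 by (simp add: split) (simp add: d_def)
    moreover have "(\<Sum>v\<in>F. d v * a v i) = 0" if "i \<in> J" for i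
    proof -
      have "(\<Sum>v\<in>F - {v0}. c v * a' v i)
          = (\<Sum>v\<in>F - {v0}. c v * a v i) - (\<Sum>v\<in>F - {v0}. c v * a v k) / a v0 k * a v0 i"
        by (simp add: a'_def right_diff_distrib sum_subtractf sum_distrib_right sum_divide_distrib mult.assoc)
      then show ?thesis
        using c[OF that] by (simp add: split) (simp add: d_def)
    qed
    moreover have "\<exists>v\<in>F. d v \<noteq> 0"
      using nz by (auto simp: d_def)
    ultimately show ?thesis by blast
  qed
qed

text \<open>
  Pairing each term of a sequence with the number of equal earlier terms turns the sequence into an
  enumeration with multiplicity, in the form in which \<open>eigen_index\<close> lists eigenvalues. Every rank
  below the multiplicity occurs, because the number of earlier terms equal to \<open>a\<close> grows in steps
  of at most 1.
\<close>

lemma bij_betw_value_rank: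
  fixes l :: "nat \<Rightarrow> 'a"
  shows "bij_betw (\<lambda>k. (l k, card {j. j < k \<and> l j = l k})) UNIV
    {(a, i). finite {k. l k = a} \<longrightarrow> i < card {k. l k = a}}"
proof (rule bij_betw_imageI)
  have less: "card {j. j < k \<and> l j = a} < card {j. j < k' \<and> l j = a}" if "k < k'" "l k = a" for k k' a
    using that by (intro psubset_card_mono) (auto intro: finite_subset[of _ "{..<k'}"])
  show "inj (\<lambda>k. (l k, card {j. j < k \<and> l j = l k}))"
  proof (rule injI)
    fix k k' assume "(l k, card {j. j < k \<and> l j = l k}) = (l k', card {j. j < k' \<and> l j = l k'})"
    then show "k = k'"
      using less[of k k' "l k"] less[of k' k "l k"] by (cases k k' rule: linorder_cases) auto
  qed
  show "range (\<lambda>k. (l k, card {j. j < k \<and> l j = l k}))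
      = {(a, i). finite {k. l k = a} \<longrightarrow> i < card {k. l k = a}}" (is "?L = ?R")
  proof
    show "?L \<subseteq> ?R"
    proof clarsimp
      fix k assume "finite {j. l j = l k}"
      then show "card {j. j < k \<and> l j = l k} < card {j. l j = l k}"
        by (intro psubset_card_mono) auto
    qed
    show "?R \<subseteq> ?L"
    proof clarsimp
      fix a i assume i: "finite {k. l k = a} \<longrightarrow> i < card {k. l k = a}"
      define r where "r k = card {j. j < k \<and> l j = a}" for k
      have r_Suc: "r (Suc k) = (if l k = a then Suc (r k) else r k)" for k
      proof -
        have "{j. j < Suc k \<and> l j = a} = (if l k = a then insert k {j. j < k \<and> l j = a} else {j. j < k \<and> l j = a})"
          by (auto simp: less_Suc_eq)
        then show ?thesis by (simp add: r_def)
      qed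
      have "\<exists>k. i < r k"
      proof (cases "finite {k. l k = a}")
        case True
        then obtain n where "{k. l k = a} \<subseteq> {..<n}"
          using finite_nat_iff_bounded by blast
        then have "{j. j < n \<and> l j = a} = {k. l k = a}" by auto
        then have "r n = card {k. l k = a}" by (simp only: r_def)
        then show ?thesis using i True by (intro exI[of _ n]) simp
      next
        case False
        then obtain S where S: "S \<subseteq> {k. l k = a}" "finite S" "card S = Suc i"
          using infinite_arbitrarily_large by blast
        then obtain n where n: "S \<subseteq> {..<n}"
          using finite_nat_iff_bounded by blast
        have "card S \<le> r n"
          unfolding r_def using S n by (intro card_mono) auto
        then show ?thesis using S by (intro exI[of _ n]) simp
      qed
      then obtain k where k: "i < r k" "\<And>k'. i < r k' \<Longrightarrow> k \<le> k'"
        using exists_least_iff[of "\<lambda>k. i < r k"] by (meson not_le)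
      moreover have "r 0 = 0" by (simp add: r_def)
      ultimately obtain m where m: "k = Suc m" by (cases k) auto
      have "r m \<le> i" using k(2)[of m] m by (metis Suc_n_not_le_n not_le)
      with k(1) m have "l m = a" "r m = i" by (auto simp: r_Suc split: if_splits)
      then show "(a, i) \<in> range (\<lambda>k. (l k, card {j. j < k \<and> l j = l k}))"
        by (intro image_eqI[of _ _ m]) (auto simp: r_def)
    qed
  qed
qed

text \<open>
  The norms of the \<open>w k\<close> are going to be the singular values of the operator mapping \<open>u k\<close> to
  \<open>w k\<close>, with \<open>u k\<close> as eigenvectors of its modulus.
\<close>

locale diagonal_system = H: semi_hilbert H + K: semi_hilbert K
  for H :: "'v::ab_group_add hspace" and K :: "'w::ab_group_add hspace" +
  fixes u :: "nat \<Rightarrow> 'v" and w :: "nat \<Rightarrow> 'w" and l :: "nat \<Rightarrow> real"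
  assumes u_mem [simp]: "u k \<in> vecs H"
    and w_mem [simp]: "w k \<in> vecs K"
    and ip_u: "ip H (u i) (u j) = (if i = j then complex_of_real 1 else 0)"
    and ip_w: "ip K (w i) (w j) = (if i = j then complex_of_real (l i) else 0)"
    and total: "x \<in> vecs H \<Longrightarrow> (\<And>k. ip H x (u k) = 0) \<Longrightarrow> hnorm H x = 0"
begin

lemma l_nonneg: "0 \<le> l k"
  using K.ip_ge_0[OF w_mem, of k] ip_w[of k k] by simp

context
  fixes T A
  assumes T_mem: "\<And>x. x \<in> vecs H \<Longrightarrow> T x \<in> vecs K"
    and T_u: "\<And>k. heq K (T (u k)) (w k)"
    and adj: "is_adjoint H K T A"
begin

lemma A_mem: "y \<in> vecs K \<Longrightarrow> A y \<in> vecs H"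
  using adj by (simp add: is_adjoint_def)

lemma ip_adj: "x \<in> vecs H \<Longrightarrow> y \<in> vecs K \<Longrightarrow> ip H x (A y) = ip K (T x) y"
  using adj by (simp add: is_adjoint_def)

text \<open>
  The vector \<open>A (T (u k)) - l k u k\<close> is orthogonal to every \<open>u j\<close>, because the images \<open>w j\<close> are
  orthogonal; totality makes it null.
\<close>

lemma ip_A_T_u:
  assumes x: "x \<in> vecs H"
  shows "ip H x (A (T (u k))) = complex_of_real (l k) * ip H x (u k)"
proof -
  define h where "h = A (T (u k)) - scl H (complex_of_real (l k)) (u k)"
  have h: "h \<in> vecs H" by (simp add: h_def A_mem T_mem)
  have "ip H (u j) h = 0" for j
  proof -
    have "ip H (u j) (A (T (u k))) = ip K (T (u j)) (T (u k))"
      by (simp add: ip_adj T_mem)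
    also have "\<dots> = ip K (T (u j)) (w k)"
      by (intro K.heq_ip_right) (auto simp: T_mem T_u)
    also have "\<dots> = ip K (w j) (w k)"
      using T_u[of j] by (subst (asm) K.heq_iff_ip) (auto simp: T_mem)
    finally show ?thesis
      by (simp add: h_def H.ip_diff_right A_mem T_mem ip_w ip_u)
  qed
  then have "ip H h (u j) = 0" for j
    using H.ip_cnj[OF u_mem h] by (metis complex_cnj_zero)
  then have "hnorm H h = 0"
    using h by (intro total)
  then have "ip H h x = 0"
    using h x by (simp add: H.ip_null)
  then have "ip H x h = 0"
    using H.ip_cnj[OF h x] by simp
  then show ?thesis
    using x by (simp add: h_def H.ip_diff_right A_mem T_mem)
qed

lemma u_in_eigenspace: "u k \<in> eigenspace H (A \<circ> T) (l k)"
proof -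
  have "ip H (A (T (u k))) v = ip H (scl H (complex_of_real (l k)) (u k)) v" if v: "v \<in> vecs H" for v
  proof -
    have "ip H (A (T (u k))) v = cnj (ip H v (A (T (u k))))"
      using v by (simp add: H.ip_cnj A_mem T_mem)
    also have "\<dots> = complex_of_real (l k) * cnj (ip H v (u k))"
      using v by (simp add: ip_A_T_u)
    finally show ?thesis using v by (simp add: H.ip_cnj)
  qed
  then show ?thesis
    by (simp add: eigenspace_def H.heq_iff_ip A_mem T_mem)
qed

text \<open>
  Eigenvectors of a symmetric operator for different eigenvalues are orthogonal.
\<close>

lemma eigenspace_orthogonal:
  assumes "x \<in> eigenspace H (A \<circ> T) a" "l k \<noteq> a"
  shows "ip H x (u k) = 0"
proof -
  have x: "x \<in> vecs H" and eq: "heq H (A (T x)) (scl H (complex_of_real a) x)"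
    using assms by (auto simp: eigenspace_def)
  have "complex_of_real a * ip H x (u k) = ip H (A (T x)) (u k)"
    using eq x by (subst (asm) H.heq_iff_ip) (auto simp: A_mem T_mem)
  also have "\<dots> = cnj (ip K (T (u k)) (T x))"
    using x by (metis A_mem H.ip_cnj T_mem ip_adj u_mem)
  also have "\<dots> = ip H x (A (T (u k)))"
    using x by (simp add: K.ip_cnj ip_adj T_mem)
  also have "\<dots> = complex_of_real (l k) * ip H x (u k)"
    using x by (rule ip_A_T_u)
  finally show ?thesis using assms(2) by auto
qed

lemma inj_u: "inj u"
proof (rule injI)
  fix i j assume "u i = u j"
  then show "i = j" using ip_u[of i j] ip_u[of i i] by (auto split: if_splits)
qed

lemma hindependent_image_u:
  assumes "finite F"
  shows "hindependent H (u ` F)"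
  unfolding hindependent_def
proof (intro allI impI)
  fix c assume "heq H (\<Sum>v\<in>u ` F. scl H (c v) v) 0"
  then have 0: "ip H (\<Sum>v\<in>u ` F. scl H (c v) v) x = 0" if "x \<in> vecs H" for x
    using that by (subst (asm) H.heq_iff_ip) (auto intro!: H.sum_mem)
  have "c (u k) = 0" if "k \<in> F" for k
  proof -
    have "0 = ip H (\<Sum>v\<in>u ` F. scl H (c v) v) (u k)" by (simp add: 0)
    also have "(\<Sum>v\<in>u ` F. scl H (c v) v) = (\<Sum>i\<in>F. scl H (c (u i)) (u i))"
      using inj_u by (subst sum.reindex) (auto intro: inj_on_subset)
    also have "ip H \<dots> (u k) = c (u k)"
      using assms that by (simp add: H.ip_sum_left ip_u if_distrib cong: if_cong)
    finally show ?thesis by simp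
  qed
  then show "\<forall>v\<in>u ` F. c v = 0" by blast
qed

text \<open>
  More eigenvectors than indices \<open>k\<close> with \<open>l k = a\<close> have a nontrivial linear combination that is
  orthogonal to these \<open>u k\<close>. It is orthogonal to all other \<open>u k\<close> as well, hence null.
\<close>

lemma card_hindependent_le:
  assumes fin: "finite {k. l k = a}" and F: "finite F" "F \<subseteq> eigenspace H (A \<circ> T) a" "hindependent H F"
  shows "card F \<le> card {k. l k = a}"
proof (rule ccontr)
  assume "\<not> card F \<le> card {k. l k = a}"
  then obtain c where c: "\<exists>v\<in>F. c v \<noteq> 0" "\<And>k. l k = a \<Longrightarrow> (\<Sum>v\<in>F. c v * ip H v (u k)) = 0"
    using homogeneous_system_nontrivial[OF fin F(1), of "\<lambda>v k. ip H v (u k)"] by auto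
  have F_mem: "v \<in> vecs H" if "v \<in> F" for v
    using F(2) that by (auto simp: eigenspace_def)
  have "hnorm H (\<Sum>v\<in>F. scl H (c v) v) = 0"
  proof (rule total)
    show "ip H (\<Sum>v\<in>F. scl H (c v) v) (u k) = 0" for k
    proof -
      have "ip H (\<Sum>v\<in>F. scl H (c v) v) (u k) = (\<Sum>v\<in>F. c v * ip H v (u k))"
        using F_mem by (simp add: H.ip_sum_left)
      also have "\<dots> = 0"
      proof (cases "l k = a")
        case False
        then show ?thesis using F(2) by (intro sum.neutral) (auto simp: eigenspace_orthogonal)
      qed (rule c(2))
      finally show ?thesis .
    qed
  qed (use F_mem in simp)
  then have "heq H (\<Sum>v\<in>F. scl H (c v) v) 0" by (simp add: heq_def)
  with F(3) c(1) show False by (auto simp: hindependent_def)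
qed

lemma hdim_eigenspace:
  "hdim H (eigenspace H (A \<circ> T) a) = (if finite {k. l k = a} then enat (card {k. l k = a}) else \<infinity>)"
proof -
  have ge: "enat (card F) \<le> hdim H (eigenspace H (A \<circ> T) a)" if "finite F" "F \<subseteq> {k. l k = a}" for F
  proof -
    have "u ` F \<subseteq> eigenspace H (A \<circ> T) a"
      using that(2) u_in_eigenspace by auto
    then have "enat (card (u ` F)) \<le> hdim H (eigenspace H (A \<circ> T) a)"
      unfolding hdim_def using that(1) hindependent_image_u by (intro SUP_upper) auto
    then show ?thesis
      using inj_u by (metis card_image inj_on_subset subset_UNIV)
  qed
  show ?thesis
  proof (cases "finite {k. l k = a}")
    case True
    have "hdim H (eigenspace H (A \<circ> T) a) \<le> enat (card {k. l k = a})"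
      unfolding hdim_def using card_hindependent_le[OF True] by (intro SUP_least) auto
    with ge[OF True] True show ?thesis by simp
  next
    case False
    have unbounded: "enat n \<le> hdim H (eigenspace H (A \<circ> T) a)" for n
      using infinite_arbitrarily_large[OF False, of n] ge by metis
    show ?thesis
    proof (cases "hdim H (eigenspace H (A \<circ> T) a)")
      case (enat n)
      then show ?thesis using unbounded[of "Suc n"] by simp
    qed (use False in simp)
  qed
qed

text \<open>
  The eigenspace for \<open>a\<close> has dimension equal to the number of \<open>k\<close> with \<open>l k = a\<close>, so by
  \<open>bij_betw_value_rank\<close> the eigenvalues with multiplicity are exactly the numbers \<open>l k\<close>.
\<close>

lemma summable_on_eigen_index_iff:
  "(\<lambda>(a, i). sqrt a powr p) summable_on eigen_index H (A \<circ> T) \<longleftrightarrow> (\<lambda>k. l k powr (p / 2)) summable_on UNIV"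
proof -
  have "eigen_index H (A \<circ> T) = {(a, i). finite {k. l k = a} \<longrightarrow> i < card {k. l k = a}}"
    by (auto simp: eigen_index_def hdim_eigenspace split: if_splits)
  then have "(\<lambda>(a, i). sqrt a powr p) summable_on eigen_index H (A \<circ> T)
      \<longleftrightarrow> (\<lambda>k. sqrt (l k) powr p) summable_on UNIV"
    using summable_on_reindex_bij_betw[OF bij_betw_value_rank[of l], of "\<lambda>(a, i). sqrt a powr p"] by simp
  also have "(\<lambda>k. sqrt (l k) powr p) = (\<lambda>k. l k powr (p / 2))"
    using l_nonneg by (simp add: powr_half_sqrt[symmetric] powr_powr)
  finally show ?thesis .
qed

end

theorem schatten_class_imp_summable:
  assumes "T \<in> schatten_class p H K" "\<And>k. heq K (T (u k)) (w k)"
  shows "(\<lambda>k. l k powr (p / 2)) summable_on UNIV"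
  using assms summable_on_eigen_index_iff[of T]
  by (auto simp: schatten_class_def compact_op_def bounded_op_def linear_op_def)

context
  assumes l_tendsto_0: "l \<longlonglongrightarrow> 0"
begin

lemma l_bounded: "\<exists>B. \<forall>k. l k \<le> B"
proof -
  from convergent_imp_Bseq[of l] l_tendsto_0 obtain B where "\<And>k. norm (l k) \<le> B"
    by (auto simp: convergent_def Bseq_def)
  then show ?thesis by (metis abs_le_D1 real_norm_def)
qed

lemma summable_Fourier:
  assumes x: "x \<in> vecs H"
  shows "summable (\<lambda>k. (cmod (ip H x (u k)))\<^sup>2 * l k)"
proof -
  obtain B where B: "\<And>k. l k \<le> B" using l_bounded by blast
  have "summable (\<lambda>k. (cmod (ip H x (u k)))\<^sup>2)"
    using H.Bessel[OF u_mem ip_u, where B = 1 and y = x] x by (intro summableI_nonneg_bounded) auto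
  then have "summable (\<lambda>k. (cmod (ip H x (u k)))\<^sup>2 * B)"
    by (rule summable_mult2)
  then show ?thesis
    by (rule summable_comparison_test') (use B l_nonneg in \<open>auto intro!: mult_left_mono\<close>)
qed

text \<open>
  This is the sum of the orthogonal series with terms \<open>ip H x (u k) w k\<close>, prescribed through its
  inner products, which leaves a choice among vectors at distance 0.
\<close>

definition diag_op :: "'v \<Rightarrow> 'w" where
  "diag_op x = (SOME y. y \<in> vecs K \<and> (\<forall>v\<in>vecs K. (\<lambda>k. ip H x (u k) * ip K (w k) v) sums ip K y v))"

lemma diag_op:
  assumes "x \<in> vecs H"
  shows "diag_op x \<in> vecs K"
    and "v \<in> vecs K \<Longrightarrow> (\<lambda>k. ip H x (u k) * ip K (w k) v) sums ip K (diag_op x) v"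
proof -
  have "\<exists>y. y \<in> vecs K \<and> (\<forall>v\<in>vecs K. (\<lambda>k. ip H x (u k) * ip K (w k) v) sums ip K y v)"
    using K.orthogonal_series[OF w_mem ip_w summable_Fourier[OF assms]] by blast
  from someI_ex[OF this] show "diag_op x \<in> vecs K"
    and "v \<in> vecs K \<Longrightarrow> (\<lambda>k. ip H x (u k) * ip K (w k) v) sums ip K (diag_op x) v"
    unfolding diag_op_def by auto
qed

lemma linear_diag_op: "linear_op H K diag_op"
  unfolding linear_op_def
proof (intro conjI ballI allI)
  show "diag_op x \<in> vecs K" if "x \<in> vecs H" for x using that by (rule diag_op)
next
  fix x y assume x: "x \<in> vecs H" and y: "y \<in> vecs H"
  have "ip K (diag_op (x + y)) v = ip K (diag_op x + diag_op y) v" if v: "v \<in> vecs K" for v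
  proof -
    have "(\<lambda>k. ip H x (u k) * ip K (w k) v + ip H y (u k) * ip K (w k) v)
        sums (ip K (diag_op x) v + ip K (diag_op y) v)"
      by (intro sums_add diag_op x y v)
    also have "(\<lambda>k. ip H x (u k) * ip K (w k) v + ip H y (u k) * ip K (w k) v)
        = (\<lambda>k. ip H (x + y) (u k) * ip K (w k) v)"
      using x y by (simp add: H.ip_add_left distrib_right)
    finally show ?thesis
      using diag_op(2)[OF H.add_mem[OF x y] v] x y v
      by (simp add: K.ip_add_left diag_op(1)) (metis sums_unique2)
  qed
  then show "heq K (diag_op (x + y)) (diag_op x + diag_op y)"
    using x y by (simp add: K.heq_iff_ip diag_op(1))
next
  fix c x assume x: "x \<in> vecs H"
  have "ip K (diag_op (scl H c x)) v = ip K (scl K c (diag_op x)) v" if v: "v \<in> vecs K" for v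
  proof -
    have "(\<lambda>k. c * (ip H x (u k) * ip K (w k) v)) sums (c * ip K (diag_op x) v)"
      by (intro sums_mult diag_op x v)
    also have "(\<lambda>k. c * (ip H x (u k) * ip K (w k) v)) = (\<lambda>k. ip H (scl H c x) (u k) * ip K (w k) v)"
      using x by (simp add: mult.assoc)
    finally show ?thesis
      using diag_op(2)[OF H.scl_mem[OF x] v] x v by (simp add: diag_op(1)) (metis sums_unique2)
  qed
  then show "heq K (diag_op (scl H c x)) (scl K c (diag_op x))"
    using x by (simp add: K.heq_iff_ip diag_op(1))
qed

lemma ip_diag_op_w:
  assumes x: "x \<in> vecs H"
  shows "ip K (diag_op x) (w k) = ip H x (u k) * complex_of_real (l k)"
proof -
  have "(\<lambda>i. ip H x (u i) * ip K (w i) (w k)) sums (ip H x (u k) * ip K (w k) (w k))"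
    using sums_finite[of "{k}" "\<lambda>i. ip H x (u i) * ip K (w i) (w k)"] by (auto simp: ip_w)
  then show ?thesis
    using diag_op(2)[OF x w_mem, of k] by (metis ip_w sums_unique2)
qed

lemma hnorm_diag_op:
  assumes x: "x \<in> vecs H"
  shows "(\<lambda>k. (cmod (ip H x (u k)))\<^sup>2 * l k) sums (hnorm K (diag_op x))\<^sup>2"
proof -
  have "ip H x (u k) * ip K (w k) (diag_op x) = complex_of_real ((cmod (ip H x (u k)))\<^sup>2 * l k)" for k
  proof -
    have "ip K (w k) (diag_op x) = cnj (ip H x (u k)) * complex_of_real (l k)"
      using K.ip_cnj[OF diag_op(1)[OF x] w_mem, of k] by (simp add: ip_diag_op_w[OF x])
    then show ?thesis by (simp add: mult.assoc[symmetric] mult_cnj_eq_norm_sq)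
  qed
  then have "(\<lambda>k. complex_of_real ((cmod (ip H x (u k)))\<^sup>2 * l k)) sums complex_of_real ((hnorm K (diag_op x))\<^sup>2)"
    using diag_op(2)[OF x diag_op(1)[OF x]] by (simp only: K.ip_self[OF diag_op(1)[OF x]])
  then show ?thesis by (simp only: sums_of_real_iff)
qed

lemma bounded_diag_op: "bounded_op H K diag_op"
proof -
  obtain B where B: "\<And>k. l k \<le> B" using l_bounded by blast
  have B0: "0 \<le> B" using B[of 0] l_nonneg[of 0] by simp
  have "hnorm K (diag_op x) \<le> sqrt B * hnorm H x" if x: "x \<in> vecs H" for x
  proof -
    have "(hnorm K (diag_op x))\<^sup>2 \<le> B * (hnorm H x)\<^sup>2"
    proof (rule LIMSEQ_le_const2)
      show "(\<lambda>n. \<Sum>k<n. (cmod (ip H x (u k)))\<^sup>2 * l k) \<longlonglongrightarrow> (hnorm K (diag_op x))\<^sup>2"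
        using hnorm_diag_op[OF x] by (simp add: sums_def)
      have "(\<Sum>k<n. (cmod (ip H x (u k)))\<^sup>2 * l k) \<le> B * (hnorm H x)\<^sup>2" for n
      proof -
        have "(\<Sum>k<n. (cmod (ip H x (u k)))\<^sup>2 * l k) \<le> (\<Sum>k<n. (cmod (ip H x (u k)))\<^sup>2 * B)"
          using B by (intro sum_mono mult_left_mono) auto
        also have "\<dots> = B * (\<Sum>k<n. (cmod (ip H x (u k)))\<^sup>2)"
          by (simp add: sum_distrib_left mult.commute)
        also have "\<dots> \<le> B * (1 * (hnorm H x)\<^sup>2)"
          using x B0 by (intro mult_left_mono H.Bessel[OF u_mem ip_u]) auto
        finally show ?thesis by simp
      qed
      then show "\<exists>N. \<forall>n\<ge>N. (\<Sum>k<n. (cmod (ip H x (u k)))\<^sup>2 * l k) \<le> B * (hnorm H x)\<^sup>2" by blast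
    qed
    also have "\<dots> = (sqrt B * hnorm H x)\<^sup>2"
      using B0 by (simp add: power_mult_distrib)
    finally show ?thesis
      by (rule power2_le_imp_le) (use x B0 in simp)
  qed
  with linear_diag_op show ?thesis by (auto simp: bounded_op_def)
qed

lemma diag_op_diff:
  assumes x: "x \<in> vecs H" and y: "y \<in> vecs H"
  shows "hnorm K (diag_op x - diag_op y) = hnorm K (diag_op (x - y))"
proof -
  have "ip K (diag_op x - diag_op y) v = ip K (diag_op (x - y)) v" if v: "v \<in> vecs K" for v
  proof -
    have "(\<lambda>k. ip H x (u k) * ip K (w k) v - ip H y (u k) * ip K (w k) v)
        sums (ip K (diag_op x) v - ip K (diag_op y) v)"
      by (intro sums_diff diag_op x y v)
    also have "(\<lambda>k. ip H x (u k) * ip K (w k) v - ip H y (u k) * ip K (w k) v)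
        = (\<lambda>k. ip H (x - y) (u k) * ip K (w k) v)"
      using x y by (simp add: H.ip_diff_left left_diff_distrib)
    finally show ?thesis
      using diag_op(2)[OF H.diff_mem[OF x y] v] x y v
      by (simp add: K.ip_diff_left diag_op(1)) (metis sums_unique2)
  qed
  then have "ip K (diag_op x - diag_op y) (diag_op x - diag_op y) = ip K (diag_op (x - y)) (diag_op (x - y))"
    using x y by (metis H.diff_mem K.diff_mem K.ip_cnj diag_op(1))
  then show ?thesis by (simp add: hnorm_def)
qed

text \<open>
  The Fourier coefficients of a bounded sequence lie in a product of discs, which is compact and
  metrizable. So a subsequence converges coefficientwise. Along it the images are Cauchy: finitely many
  coefficients converge, and the others contribute little since \<open>l\<close> tends to 0.
\<close>

lemma compact_diag_op: "compact_op H K diag_op"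
  unfolding compact_op_def
proof (intro conjI allI impI)
  show "bounded_op H K diag_op" by (rule bounded_diag_op)
next
  fix x :: "nat \<Rightarrow> 'v"
  assume "(\<forall>k. x k \<in> vecs H) \<and> (\<exists>B. \<forall>k. hnorm H (x k) \<le> B)"
  then obtain B where x: "\<And>k. x k \<in> vecs H" and B: "\<And>k. hnorm H (x k) \<le> B" by blast
  have B0: "0 \<le> B" using B[of 0] H.hnorm_nonneg[OF x, of 0] by linarith
  define \<phi> where "\<phi> k = (\<lambda>i. ip H (x k) (u i))" for k
  have cu: "hnorm H (u i) = 1" for i
    by (simp add: hnorm_def ip_u)
  have "\<phi> k \<in> PiE UNIV (\<lambda>_. cball 0 B)" for k
  proof (rule PiE_I)
    fix i
    have "cmod (ip H (x k) (u i)) \<le> hnorm H (x k) * hnorm H (u i)"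
      using x by (intro H.Cauchy_Schwarz) auto
    then show "\<phi> k i \<in> cball 0 B" using B[of k] by (simp add: \<phi>_def cu)
  qed auto
  moreover have "compact (PiE UNIV (\<lambda>_::nat. cball (0::complex) B))"
  proof -
    have "compactin (product_topology (\<lambda>_::nat. euclidean) UNIV) (PiE UNIV (\<lambda>_. cball (0::complex) B))"
      by (simp add: compactin_PiE)
    then show ?thesis by (simp add: euclidean_product_topology)
  qed
  ultimately obtain \<psi> r where r: "strict_mono r" and lim: "(\<phi> \<circ> r) \<longlonglongrightarrow> \<psi>"
    unfolding compact_def by metis
  have limi: "(\<lambda>k. ip H (x (r k)) (u i)) \<longlonglongrightarrow> \<psi> i" for i
    using continuous_on_tendsto_compose[OF continuous_on_product_coordinates[of i] lim]
    by (simp add: \<phi>_def o_def)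
  have "\<exists>y\<in>vecs K. (\<lambda>k. hnorm K (diag_op (x (r k)) - y)) \<longlonglongrightarrow> 0"
  proof (rule K.complete)
    show "diag_op (x (r k)) \<in> vecs K" for k using x by (rule diag_op)
  next
    fix e :: real assume e: "0 < e"
    \<comment> \<open>Differences of members of the sequence have norm at most \<open>2 B\<close>; adding 1 avoids a division by 0.\<close>
    define C where "C = 4 * B\<^sup>2 + 1"
    have C: "0 < C" by (simp add: C_def add_nonneg_pos)
    define \<delta> where "\<delta> = e\<^sup>2 / (2 * C)"
    have \<delta>: "0 < \<delta>" using e C by (simp add: \<delta>_def)
    obtain N where N: "\<And>k. N \<le> k \<Longrightarrow> l k < \<delta>"
      using order_tendstoD(2)[OF l_tendsto_0 \<delta>] by (auto simp: eventually_sequentially)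
    \<comment> \<open>The contribution of the first \<open>N\<close> coefficients to the squared distance of two images.\<close>
    define S where "S m n = (\<Sum>i<N. (cmod (ip H (x (r m)) (u i) - ip H (x (r n)) (u i)))\<^sup>2 * l i)" for m n
    have "\<exists>M. \<forall>m\<ge>M. \<forall>n\<ge>M. S m n < e\<^sup>2 / 2"
    proof -
      define R where "R m = (\<Sum>i<N. 2 * (cmod (ip H (x (r m)) (u i) - \<psi> i))\<^sup>2 * l i)" for m
      have "R \<longlonglongrightarrow> (\<Sum>i<N. 2 * (cmod (\<psi> i - \<psi> i))\<^sup>2 * l i)"
        unfolding R_def by (intro tendsto_intros limi)
      then have "R \<longlonglongrightarrow> 0" by simp
      from order_tendstoD(2)[OF this, of "e\<^sup>2 / 4"] e obtain M where M: "\<And>m. M \<le> m \<Longrightarrow> R m < e\<^sup>2 / 4"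
        by (auto simp: eventually_sequentially)
      have S_le: "S m n \<le> R m + R n" for m n
        unfolding S_def R_def sum.distrib[symmetric]
      proof (intro sum_mono)
        fix i
        let ?a = "ip H (x (r m)) (u i) - \<psi> i" and ?b = "ip H (x (r n)) (u i) - \<psi> i"
        have "(cmod (?a - ?b))\<^sup>2 \<le> (cmod ?a + cmod ?b)\<^sup>2"
          by (intro power_mono norm_triangle_ineq4) auto
        also have "\<dots> \<le> 2 * (cmod ?a)\<^sup>2 + 2 * (cmod ?b)\<^sup>2"
          using sum_squares_bound[of "cmod ?a" "cmod ?b"] by (simp add: power2_sum)
        finally have "(cmod (?a - ?b))\<^sup>2 * l i \<le> (2 * (cmod ?a)\<^sup>2 + 2 * (cmod ?b)\<^sup>2) * l i"
          by (intro mult_right_mono l_nonneg)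
        then show "(cmod (ip H (x (r m)) (u i) - ip H (x (r n)) (u i)))\<^sup>2 * l i
            \<le> 2 * (cmod ?a)\<^sup>2 * l i + 2 * (cmod ?b)\<^sup>2 * l i"
          by (simp add: distrib_right)
      qed
      have "S m n < e\<^sup>2 / 2" if "M \<le> m" "M \<le> n" for m n
        using M[OF that(1)] M[OF that(2)] S_le[of m n] by simp
      then show ?thesis by blast
    qed
    then obtain M where M: "\<And>m n. M \<le> m \<Longrightarrow> M \<le> n \<Longrightarrow> S m n < e\<^sup>2 / 2" by blast
    have "hnorm K (diag_op (x (r m)) - diag_op (x (r n))) < e" if "M \<le> m" "M \<le> n" for m n
    proof -
      define y where "y = x (r m) - x (r n)"
      have y: "y \<in> vecs H" using x by (simp add: y_def)
      have ny: "(hnorm H y)\<^sup>2 \<le> 4 * B\<^sup>2"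
      proof -
        have "hnorm H y \<le> hnorm H (x (r m)) + hnorm H (- x (r n))"
          unfolding y_def diff_conv_add_uminus using x by (intro H.hnorm_triangle) auto
        also have "\<dots> \<le> 2 * B"
          using B[of "r m"] B[of "r n"] x by (simp add: H.hnorm_minus)
        finally have "(hnorm H y)\<^sup>2 \<le> (2 * B)\<^sup>2"
          using y by (intro power_mono) auto
        then show ?thesis by (simp add: power_mult_distrib)
      qed
      have "(hnorm K (diag_op y))\<^sup>2 \<le> S m n + \<delta> * (4 * B\<^sup>2)"
      proof (rule LIMSEQ_le_const2)
        show "(\<lambda>n. \<Sum>k<n. (cmod (ip H y (u k)))\<^sup>2 * l k) \<longlonglongrightarrow> (hnorm K (diag_op y))\<^sup>2"
          using hnorm_diag_op[OF y] by (simp add: sums_def)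
        have "(\<Sum>k<j. (cmod (ip H y (u k)))\<^sup>2 * l k) \<le> S m n + \<delta> * (4 * B\<^sup>2)" if "N \<le> j" for j
        proof -
          have "(\<Sum>k<j. (cmod (ip H y (u k)))\<^sup>2 * l k)
              = (\<Sum>k<N. (cmod (ip H y (u k)))\<^sup>2 * l k) + (\<Sum>k\<in>{N..<j}. (cmod (ip H y (u k)))\<^sup>2 * l k)"
            using that by (simp add: lessThan_atLeast0 sum.atLeastLessThan_concat)
          also have "(\<Sum>k<N. (cmod (ip H y (u k)))\<^sup>2 * l k) = S m n"
            using x by (simp add: S_def y_def H.ip_diff_left)
          also have "(\<Sum>k\<in>{N..<j}. (cmod (ip H y (u k)))\<^sup>2 * l k) \<le> (\<Sum>k\<in>{N..<j}. (cmod (ip H y (u k)))\<^sup>2 * \<delta>)"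
            using N by (intro sum_mono mult_left_mono) (auto intro: less_imp_le)
          also have "\<dots> = \<delta> * (\<Sum>k\<in>{N..<j}. (cmod (ip H y (u k)))\<^sup>2)"
            by (simp add: sum_distrib_left mult.commute)
          also have "\<dots> \<le> \<delta> * (1 * (hnorm H y)\<^sup>2)"
            using y \<delta> by (intro mult_left_mono H.Bessel[OF u_mem ip_u]) auto
          also have "\<dots> \<le> \<delta> * (4 * B\<^sup>2)"
            using ny \<delta> by (intro mult_left_mono) auto
          finally show ?thesis by simp
        qed
        then show "\<exists>N. \<forall>j\<ge>N. (\<Sum>k<j. (cmod (ip H y (u k)))\<^sup>2 * l k)
            \<le> S m n + \<delta> * (4 * B\<^sup>2)"
          by (intro exI[of _ N]) simp
      qed
      also have "\<dots> < e\<^sup>2"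
      proof -
        have "\<delta> * (4 * B\<^sup>2) \<le> \<delta> * C"
          using \<delta> by (simp add: C_def)
        also have "\<dots> = e\<^sup>2 / 2"
          using C by (simp add: \<delta>_def)
        finally show ?thesis using M[OF that] by simp
      qed
      finally have "hnorm K (diag_op y) < e"
        by (rule power2_less_imp_less) (use e in simp)
      then show ?thesis
        using x by (simp add: diag_op_diff y_def)
    qed
    then show "\<exists>M. \<forall>m\<ge>M. \<forall>n\<ge>M. hnorm K (diag_op (x (r m)) - diag_op (x (r n))) < e" by blast
  qed
  then show "\<exists>y\<in>vecs K. \<exists>r. strict_mono r \<and> (\<lambda>k. hnorm K (diag_op (x (r k)) - y)) \<longlonglongrightarrow> 0"
    using r by blast
qed

text \<open>
  The adjoint maps \<open>y\<close> to the sum of the series with terms \<open>ip K y (w k) u k\<close>, which converges by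
  Bessel's inequality for the bounded orthogonal system of the \<open>w k\<close>.
\<close>

lemma adjoint_diag_op: "\<exists>A. is_adjoint H K diag_op A"
proof -
  obtain B where B: "\<And>k. l k \<le> B" using l_bounded by blast
  have "\<exists>z\<in>vecs H. \<forall>v\<in>vecs H. (\<lambda>k. ip K y (w k) * ip H (u k) v) sums ip H z v" if y: "y \<in> vecs K" for y
  proof (rule H.orthogonal_series[OF u_mem ip_u])
    show "summable (\<lambda>k. (cmod (ip K y (w k)))\<^sup>2 * 1)"
      using K.Bessel[OF w_mem ip_w B _ y] by (intro summableI_nonneg_bounded) auto
  qed
  then obtain A where A: "\<And>y. y \<in> vecs K \<Longrightarrow> A y \<in> vecs H"
    and A_sums: "\<And>y v. y \<in> vecs K \<Longrightarrow> v \<in> vecs H \<Longrightarrow> (\<lambda>k. ip K y (w k) * ip H (u k) v) sums ip H (A y) v"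
    by metis
  have "ip K (diag_op x) y = ip H x (A y)" if x: "x \<in> vecs H" and y: "y \<in> vecs K" for x y
  proof -
    have "(\<lambda>k. cnj (ip K y (w k) * ip H (u k) x)) sums cnj (ip H (A y) x)"
      using A_sums[OF y x] by (simp only: sums_cnj)
    then have "(\<lambda>k. ip H x (u k) * ip K (w k) y) sums ip H x (A y)"
      using x y by (simp add: H.ip_cnj K.ip_cnj A mult.commute)
    then show ?thesis
      using diag_op(2)[OF x y] by (metis sums_unique2)
  qed
  then show ?thesis using A by (auto simp: is_adjoint_def)
qed

lemma diag_op_u: "heq K (diag_op (u k)) (w k)"
proof -
  have "ip K (diag_op (u k)) v = ip K (w k) v" if v: "v \<in> vecs K" for v
  proof -
    have "(\<lambda>i. ip H (u k) (u i) * ip K (w i) v) sums (ip H (u k) (u k) * ip K (w k) v)"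
      using sums_finite[of "{k}" "\<lambda>i. ip H (u k) (u i) * ip K (w i) v"] by (auto simp: ip_u)
    then show ?thesis
      using diag_op(2)[OF u_mem v, of k] by (simp add: ip_u) (metis sums_unique2)
  qed
  then show ?thesis by (simp add: K.heq_iff_ip diag_op(1))
qed

end

theorem summable_imp_schatten_class:
  assumes sm: "(\<lambda>k. l k powr (p / 2)) summable_on UNIV" and "0 < p"
  shows "\<exists>T\<in>schatten_class p H K. \<forall>k. heq K (T (u k)) (w k)"
proof -
  have l0: "l \<longlonglongrightarrow> 0"
  proof -
    have "(\<lambda>k. l k powr (p / 2)) \<longlonglongrightarrow> 0"
      using sm by (intro summable_LIMSEQ_zero summable_on_imp_summable)
    then have "(\<lambda>k. (l k powr (p / 2)) powr (2 / p)) \<longlonglongrightarrow> 0 powr (2 / p)"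
      using \<open>0 < p\<close> by (intro tendsto_powr') auto
    then show ?thesis
      using \<open>0 < p\<close> l_nonneg by (simp add: powr_powr)
  qed
  obtain A where A: "is_adjoint H K diag_op A"
    using adjoint_diag_op[OF l0] by blast
  have "(\<lambda>(a, i). sqrt a powr p) summable_on eigen_index H (A \<circ> diag_op)"
    using summable_on_eigen_index_iff[OF diag_op(1)[OF l0] diag_op_u[OF l0] A] sm by simp
  then have "diag_op \<in> schatten_class p H K"
    using A compact_diag_op[OF l0] by (auto simp: schatten_class_def)
  then show ?thesis using diag_op_u[OF l0] by blast
qed

end

section \<open>Completeness of the spaces of functions and forms\<close>

lemma borel_measurable_cnj [measurable]:
  "f \<in> borel_measurable M \<Longrightarrow> (\<lambda>z. cnj (f z)) \<in> borel_measurable M"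
  by (rule borel_measurable_continuous_on[OF continuous_on_cnj[OF continuous_on_id]])

lemma L2_simps [simp]:
  "scl (L2 M) c f = (\<lambda>z. c * f z)"
  "ip (L2 M) f g = (\<integral>z. f z * cnj (g z) \<partial>M)"
  by (simp_all add: L2_def)

lemma mem_L2: "f \<in> vecs (L2 M) \<longleftrightarrow> f \<in> borel_measurable M \<and> integrable M (\<lambda>z. (cmod (f z))\<^sup>2)"
  by (simp add: L2_def)

lemma integrable_L2_product:
  assumes "f \<in> vecs (L2 M)" "g \<in> vecs (L2 M)"
  shows "integrable M (\<lambda>z. f z * cnj (g z))"
proof (rule Bochner_Integration.integrable_bound)
  show "integrable M (\<lambda>z. (cmod (f z))\<^sup>2 + (cmod (g z))\<^sup>2)"
    using assms by (simp add: mem_L2)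
  have [measurable]: "f \<in> borel_measurable M" "g \<in> borel_measurable M"
    using assms by (simp_all add: mem_L2)
  show "(\<lambda>z. f z * cnj (g z)) \<in> borel_measurable M"
    by measurable
  have "cmod (f z) * cmod (g z) \<le> (cmod (f z))\<^sup>2 + (cmod (g z))\<^sup>2" for z
    using sum_squares_bound[of "cmod (f z)" "cmod (g z)"] mult_nonneg_nonneg[OF norm_ge_zero norm_ge_zero, of "f z" "g z"]
    by linarith
  then show "AE z in M. norm (f z * cnj (g z)) \<le> norm ((cmod (f z))\<^sup>2 + (cmod (g z))\<^sup>2)"
    by (simp add: norm_mult)
qed

lemma hnorm_L2_sq: "(hnorm (L2 M) f)\<^sup>2 = (\<integral>z. (cmod (f z))\<^sup>2 \<partial>M)"
proof -
  have "ip (L2 M) f f = complex_of_real (\<integral>z. (cmod (f z))\<^sup>2 \<partial>M)"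
    by (simp add: mult_cnj_eq_norm_sq flip: of_real_power)
  then show ?thesis by (simp add: hnorm_def del: L2_simps)
qed

lemma semi_inner_L2: "semi_inner (L2 M)"
proof
  show "x + y \<in> vecs (L2 M)" if "x \<in> vecs (L2 M)" "y \<in> vecs (L2 M)" for x y
  proof -
    have "(cmod (x z + y z))\<^sup>2 \<le> 2 * (cmod (x z))\<^sup>2 + 2 * (cmod (y z))\<^sup>2" for z
    proof -
      have "(cmod (x z + y z))\<^sup>2 \<le> (cmod (x z) + cmod (y z))\<^sup>2"
        by (intro power_mono norm_triangle_ineq) simp
      also have "\<dots> \<le> 2 * (cmod (x z))\<^sup>2 + 2 * (cmod (y z))\<^sup>2"
        using sum_squares_bound[of "cmod (x z)" "cmod (y z)"] by (simp add: power2_sum)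
      finally show ?thesis .
    qed
    then have le: "AE z in M. norm ((cmod (x z + y z))\<^sup>2) \<le> norm (2 * (cmod (x z))\<^sup>2 + 2 * (cmod (y z))\<^sup>2)"
      by simp
    have [measurable]: "x \<in> borel_measurable M" "y \<in> borel_measurable M"
      using that by (simp_all add: mem_L2)
    have "integrable M (\<lambda>z. 2 * (cmod (x z))\<^sup>2 + 2 * (cmod (y z))\<^sup>2)"
      using that by (simp add: mem_L2)
    then have "integrable M (\<lambda>z. (cmod (x z + y z))\<^sup>2)"
      by (rule Bochner_Integration.integrable_bound[OF _ _ le]) measurable
    then show ?thesis by (simp add: mem_L2 plus_fun_def)
  qed
  show "scl (L2 M) c x \<in> vecs (L2 M)" if "x \<in> vecs (L2 M)" for c x
  proof -
    have [measurable]: "x \<in> borel_measurable M"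
      using that by (simp add: mem_L2)
    show ?thesis using that by (simp add: mem_L2 norm_mult power_mult_distrib)
  qed
  show "scl (L2 M) (- 1) x = - x" for x
    by (simp add: fun_eq_iff)
  show "ip (L2 M) (x + y) v = ip (L2 M) x v + ip (L2 M) y v"
    if "x \<in> vecs (L2 M)" "y \<in> vecs (L2 M)" "v \<in> vecs (L2 M)" for x y v
    using integrable_L2_product[OF that(1,3)] integrable_L2_product[OF that(2,3)]
    by (simp add: distrib_right)
  show "ip (L2 M) (scl (L2 M) c x) v = c * ip (L2 M) x v" for c x v
    by (simp add: mult.assoc)
  show "cnj (ip (L2 M) x y) = ip (L2 M) y x" for x y
    using Bochner_Integration.integral_cnj[of M "\<lambda>z. x z * cnj (y z)"] by (simp add: mult.commute)
  show "0 \<le> Re (ip (L2 M) x x)" for x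
    by (simp add: mult_cnj_eq_norm_sq flip: of_real_power)
qed (simp add: mem_L2 zero_fun_def)

text \<open>
  On a finite measure space, Cauchy sequences in \<open>L2\<close> are Cauchy in the mean, so they have
  subsequences that converge almost everywhere.
\<close>

lemma L1_le_L2:
  assumes "finite_measure M" "f \<in> vecs (L2 M)"
  shows "integrable M f" and "(\<integral>z. cmod (f z) \<partial>M) \<le> hnorm (L2 M) f * hnorm (L2 M) (\<lambda>_. 1)"
proof -
  interpret L: semi_inner "L2 M" by (rule semi_inner_L2)
  interpret finite_measure M by fact
  have one: "(\<lambda>_. 1) \<in> vecs (L2 M)" by (simp add: mem_L2)
  show "integrable M f"
    using integrable_L2_product[OF assms(2) one] by simp
  define g where "g z = complex_of_real (cmod (f z))" for z
  have [measurable]: "f \<in> borel_measurable M" using assms by (simp add: mem_L2)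
  have "g \<in> borel_measurable M" unfolding g_def by measurable
  with assms have g: "g \<in> vecs (L2 M)" by (simp add: mem_L2 g_def)
  have "cmod (ip (L2 M) g (\<lambda>_. 1)) \<le> hnorm (L2 M) g * hnorm (L2 M) (\<lambda>_. 1)"
    by (rule L.Cauchy_Schwarz[OF g one])
  moreover have "hnorm (L2 M) g = hnorm (L2 M) f"
    by (simp add: hnorm_def g_def mult_cnj_eq_norm_sq flip: power2_eq_square of_real_mult)
  ultimately show "(\<integral>z. cmod (f z) \<partial>M) \<le> hnorm (L2 M) f * hnorm (L2 M) (\<lambda>_. 1)"
    by (simp add: g_def)
qed

text \<open>
  Riesz-Fischer: the pointwise limit of an almost everywhere convergent subsequence is a limit in norm
  by Fatou's lemma.
\<close>

theorem semi_hilbert_L2: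
  assumes "finite_measure M"
  shows "semi_hilbert (L2 M)"
proof -
  interpret L: semi_inner "L2 M" by (rule semi_inner_L2)
  interpret finite_measure M by fact
  show ?thesis
  proof
    fix X :: "nat \<Rightarrow> 'a \<Rightarrow> complex"
    assume X: "\<And>k. X k \<in> vecs (L2 M)"
      and Cauchy: "\<And>e. 0 < e \<Longrightarrow> \<exists>N. \<forall>m\<ge>N. \<forall>n\<ge>N. hnorm (L2 M) (X m - X n) < e"
    have [measurable]: "X k \<in> borel_measurable M" for k using X by (simp add: mem_L2)
    define c where "c = hnorm (L2 M) (\<lambda>_. 1) + 1"
    have c: "0 < c" by (simp add: c_def hnorm_def add_nonneg_pos)
    have "\<exists>N. \<forall>i\<ge>N. \<forall>j\<ge>N. (\<integral>z. norm (X i z - X j z) \<partial>M) < e" if "0 < e" for e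
    proof -
      obtain N where N: "\<And>m n. N \<le> m \<Longrightarrow> N \<le> n \<Longrightarrow> hnorm (L2 M) (X m - X n) < e / c"
        using Cauchy[of "e / c"] divide_pos_pos[OF \<open>0 < e\<close> c] by blast
      have "(\<integral>z. norm (X i z - X j z) \<partial>M) < e" if "N \<le> i" "N \<le> j" for i j
      proof -
        have "(\<integral>z. norm ((X i - X j) z) \<partial>M) \<le> hnorm (L2 M) (X i - X j) * hnorm (L2 M) (\<lambda>_. 1)"
          by (intro L1_le_L2 L.diff_mem X assms)
        also have "\<dots> \<le> hnorm (L2 M) (X i - X j) * c"
          using X by (intro mult_left_mono) (auto simp: c_def)
        also have "\<dots> < e / c * c"
          using N[OF that] c by (intro mult_strict_right_mono) auto
        finally show ?thesis using c by simp
      qed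
      then show ?thesis by blast
    qed
    then obtain r where r: "strict_mono r" and AE_Cauchy: "AE z in M. Cauchy (\<lambda>i. X (r i) z)"
      using cauchy_L1_AE_cauchy_subseq[of M X] L1_le_L2(1)[OF assms X] by blast
    define f where "f z = lim (\<lambda>i. X (r i) z)" for z
    have f_meas [measurable]: "f \<in> borel_measurable M"
      unfolding f_def by measurable
    have AE_lim: "AE z in M. (\<lambda>i. X (r i) z) \<longlonglongrightarrow> f z"
      using AE_Cauchy by eventually_elim (simp add: f_def Cauchy_convergent_iff convergent_LIMSEQ_iff)
    have near: "\<exists>N. \<forall>m\<ge>N. X m - f \<in> vecs (L2 M) \<and> hnorm (L2 M) (X m - f) \<le> e" if e: "0 < e" for e
    proof -
      obtain N where N: "\<And>m n. N \<le> m \<Longrightarrow> N \<le> n \<Longrightarrow> hnorm (L2 M) (X m - X n) < e"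
        using Cauchy[OF e] by blast
      have "X m - f \<in> vecs (L2 M) \<and> hnorm (L2 M) (X m - f) \<le> e" if m: "N \<le> m" for m
      proof -
        have "(\<integral>\<^sup>+z. ennreal ((cmod (X m z - f z))\<^sup>2) \<partial>M)
            = (\<integral>\<^sup>+z. liminf (\<lambda>i. ennreal ((cmod (X m z - X (r i) z))\<^sup>2)) \<partial>M)"
        proof (rule nn_integral_cong_AE)
          show "AE z in M. ennreal ((cmod (X m z - f z))\<^sup>2) = liminf (\<lambda>i. ennreal ((cmod (X m z - X (r i) z))\<^sup>2))"
            using AE_lim
          proof eventually_elim
            case (elim z)
            then have "(\<lambda>i. ennreal ((cmod (X m z - X (r i) z))\<^sup>2)) \<longlonglongrightarrow> ennreal ((cmod (X m z - f z))\<^sup>2)"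
              by (intro tendsto_intros)
            then show ?case by (metis lim_imp_Liminf trivial_limit_sequentially)
          qed
        qed
        also have "\<dots> \<le> liminf (\<lambda>i. \<integral>\<^sup>+z. ennreal ((cmod (X m z - X (r i) z))\<^sup>2) \<partial>M)"
          by (intro nn_integral_liminf) measurable
        also have "\<dots> \<le> ennreal (e\<^sup>2)"
        proof (rule Liminf_le)
          show "\<forall>\<^sub>F i in sequentially. (\<integral>\<^sup>+z. ennreal ((cmod (X m z - X (r i) z))\<^sup>2) \<partial>M) \<le> ennreal (e\<^sup>2)"
          proof (rule eventually_sequentiallyI)
            fix i assume "N \<le> i"
            then have "N \<le> r i" using seq_suble[OF r, of i] by simp
            have d: "X m - X (r i) \<in> vecs (L2 M)" by (intro L.diff_mem X)
            have "(\<integral>z. (cmod (X m z - X (r i) z))\<^sup>2 \<partial>M) = (hnorm (L2 M) (X m - X (r i)))\<^sup>2"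
              by (simp add: hnorm_L2_sq)
            also have "\<dots> \<le> e\<^sup>2"
              using N[OF m \<open>N \<le> r i\<close>] d by (intro power_mono) auto
            finally show "(\<integral>\<^sup>+z. ennreal ((cmod (X m z - X (r i) z))\<^sup>2) \<partial>M) \<le> ennreal (e\<^sup>2)"
              using d by (subst nn_integral_eq_integral) (auto simp: mem_L2 intro!: ennreal_leI)
          qed
        qed simp
        finally have le: "(\<integral>\<^sup>+z. ennreal ((cmod (X m z - f z))\<^sup>2) \<partial>M) \<le> ennreal (e\<^sup>2)" .
        then have int: "integrable M (\<lambda>z. (cmod (X m z - f z))\<^sup>2)"
          by (intro integrableI_bounded) (auto simp: le_less_trans)
        then have mem: "X m - f \<in> vecs (L2 M)"
          by (simp add: mem_L2 fun_diff_def)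
        have "(hnorm (L2 M) (X m - f))\<^sup>2 \<le> e\<^sup>2"
          using le int by (simp add: hnorm_L2_sq nn_integral_eq_integral)
        then have "hnorm (L2 M) (X m - f) \<le> e"
          by (rule power2_le_imp_le) (use e in simp)
        with mem show ?thesis by blast
      qed
      then show ?thesis by blast
    qed
    obtain m where "X m - f \<in> vecs (L2 M)" using near[of 1] by auto
    then have f: "f \<in> vecs (L2 M)"
      using L.diff_mem[OF X[of m], of "X m - f"] by simp
    have "(\<lambda>k. hnorm (L2 M) (X k - f)) \<longlonglongrightarrow> 0"
    proof (rule LIMSEQ_I)
      fix e :: real assume "0 < e"
      then obtain N where "\<And>m. N \<le> m \<Longrightarrow> hnorm (L2 M) (X m - f) \<le> e / 2"
        using near[of "e / 2"] by auto
      then have "norm (hnorm (L2 M) (X m - f) - 0) < e" if "N \<le> m" for m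
        using that \<open>0 < e\<close> L.hnorm_nonneg[OF L.diff_mem[OF X f], of m] by (fastforce intro: le_less_trans)
      then show "\<exists>N. \<forall>m\<ge>N. norm (hnorm (L2 M) (X m - f) - 0) < e" by blast
    qed
    with f show "\<exists>x\<in>vecs (L2 M). (\<lambda>k. hnorm (L2 M) (X k - x)) \<longlonglongrightarrow> 0" by blast
  qed
qed

lemma module_complex_fun: "module (\<lambda>(c::complex) (f::'a \<Rightarrow> complex) z. c * f z)"
  by unfold_locales (simp_all add: fun_eq_iff algebra_simps)

lemma polynomials_add: "p \<in> polynomials \<Longrightarrow> q \<in> polynomials \<Longrightarrow> p + q \<in> polynomials"
  unfolding polynomials_def by (rule module.span_add[OF module_complex_fun])

lemma polynomials_scale: "q \<in> polynomials \<Longrightarrow> (\<lambda>z. c * q z) \<in> polynomials"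
  unfolding polynomials_def by (rule module.span_scale[OF module_complex_fun])

lemma zero_polynomials: "0 \<in> polynomials"
  unfolding polynomials_def by (rule module.span_zero[OF module_complex_fun])

lemma monomial_polynomials: "monomial \<alpha> \<in> polynomials"
  unfolding polynomials_def by (intro module.span_base[OF module_complex_fun]) simp

lemma polynomials_subspaceI:
  assumes "0 \<in> V" "\<And>p q. p \<in> V \<Longrightarrow> q \<in> V \<Longrightarrow> p + q \<in> V" "\<And>c q. q \<in> V \<Longrightarrow> (\<lambda>z. c * q z) \<in> V"
    and "\<And>\<alpha>. monomial \<alpha> \<in> V"
  shows "polynomials \<subseteq> V"
  unfolding polynomials_def
  by (intro module.span_minimal[OF module_complex_fun])
    (use assms in \<open>auto simp: module.subspace_def[OF module_complex_fun]\<close>)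

locale monomials_L2 = finite_measure M for M :: "(complex ^ 'n) measure" +
  assumes monomial_L2 [simp]: "monomial \<alpha> \<in> vecs (L2 M)"
begin

sublocale L: semi_hilbert "L2 M"
  by (rule semi_hilbert_L2) unfold_locales

lemma polynomials_L2: "polynomials \<subseteq> vecs (L2 M)"
  using L.scl_mem by (intro polynomials_subspaceI) auto

lemma A2_L2: "f \<in> A2 M \<Longrightarrow> f \<in> vecs (L2 M)"
  by (simp add: A2_def)

lemma A2_approx: "f \<in> A2 M \<Longrightarrow> 0 < e \<Longrightarrow> \<exists>q\<in>polynomials. hnorm (L2 M) (f - q) < e"
  by (simp add: A2_def)

lemma polynomials_A2: "polynomials \<subseteq> A2 M"
proof
  fix q :: "complex ^ 'n \<Rightarrow> complex" assume q: "q \<in> polynomials"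
  have "hnorm (L2 M) (q - q) = 0" by (simp add: hnorm_def)
  then show "q \<in> A2 M"
    using q polynomials_L2 unfolding A2_def by force
qed

lemma monomial_A2 [simp]: "monomial \<alpha> \<in> A2 M"
  using monomial_polynomials polynomials_A2 by blast

lemma A2_closed:
  assumes f: "f \<in> vecs (L2 M)" and approx: "\<And>e. 0 < e \<Longrightarrow> \<exists>g\<in>A2 M. hnorm (L2 M) (f - g) < e"
  shows "f \<in> A2 M"
  unfolding A2_def
proof (intro CollectI conjI allI impI)
  fix e :: real assume e: "0 < e"
  obtain g where g: "g \<in> A2 M" "hnorm (L2 M) (f - g) < e / 2"
    using approx[of "e / 2"] e by auto
  obtain q where q: "q \<in> polynomials" "hnorm (L2 M) (g - q) < e / 2"
    using A2_approx[OF g(1), of "e / 2"] e by auto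
  have "hnorm (L2 M) (f - q) \<le> hnorm (L2 M) (f - g) + hnorm (L2 M) (g - q)"
    using f g q polynomials_L2 by (intro L.hnorm_triangle_diff) (auto simp: A2_L2)
  then have "hnorm (L2 M) (f - q) < e" using g q by simp
  then show "\<exists>q\<in>polynomials. hnorm (L2 M) (f - q) < e" using q by blast
qed (rule f)

lemma A2_add:
  assumes f: "f \<in> A2 M" and g: "g \<in> A2 M"
  shows "f + g \<in> A2 M"
  unfolding A2_def
proof (intro CollectI conjI allI impI)
  fix e :: real assume "0 < e"
  then have e: "0 < e / 2" by simp
  obtain p where p: "p \<in> polynomials" "hnorm (L2 M) (f - p) < e / 2"
    using A2_approx[OF f e] by blast
  obtain q where q: "q \<in> polynomials" "hnorm (L2 M) (g - q) < e / 2"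
    using A2_approx[OF g e] by blast
  have eq: "f + g - (p + q) = (f - p) + (g - q)" by simp
  have "hnorm (L2 M) (f + g - (p + q)) \<le> hnorm (L2 M) (f - p) + hnorm (L2 M) (g - q)"
    unfolding eq using f g p q polynomials_L2
    by (intro L.hnorm_triangle L.diff_mem) (auto simp: A2_L2)
  then have "hnorm (L2 M) (f + g - (p + q)) < e" using p q by simp
  then show "\<exists>q\<in>polynomials. hnorm (L2 M) (f + g - q) < e"
    using p q polynomials_add by blast
qed (use f g in \<open>simp add: A2_L2\<close>)

lemma A2_scale:
  assumes f: "f \<in> A2 M"
  shows "(\<lambda>z. c * f z) \<in> A2 M"
  unfolding A2_def
proof (intro CollectI conjI allI impI)
  fix e :: real assume e: "0 < e"
  then have "0 < e / (cmod c + 1)" by (simp add: add_nonneg_pos)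
  then obtain q where q: "q \<in> polynomials" "hnorm (L2 M) (f - q) < e / (cmod c + 1)"
    using A2_approx[OF f] by blast
  have "(\<lambda>z. c * f z) - (\<lambda>z. c * q z) = scl (L2 M) c (f - q)"
    by (simp add: fun_eq_iff right_diff_distrib)
  then have "hnorm (L2 M) ((\<lambda>z. c * f z) - (\<lambda>z. c * q z)) = cmod c * hnorm (L2 M) (f - q)"
    using L.hnorm_scl[OF L.diff_mem[of f q], of c] A2_L2[OF f] q(1) polynomials_L2 by (simp add: subset_iff)
  also have "\<dots> \<le> cmod c * (e / (cmod c + 1))"
    using q by (intro mult_left_mono) auto
  also have "\<dots> < e"
    using e norm_ge_zero[of c] by (simp add: divide_less_eq add_nonneg_pos distrib_left mult.commute del: norm_ge_zero)
  finally show "\<exists>q\<in>polynomials. hnorm (L2 M) ((\<lambda>z. c * f z) - q) < e"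
    using q polynomials_scale by blast
qed (use f L.scl_mem in \<open>auto dest: A2_L2\<close>)

lemma A2_diff: "f \<in> A2 M \<Longrightarrow> g \<in> A2 M \<Longrightarrow> f - g \<in> A2 M"
  using A2_add[of f "\<lambda>z. - 1 * g z"] A2_scale[of g "- 1"] by (simp add: fun_eq_iff plus_fun_def fun_diff_def)

text \<open>
  Being a closure, \<open>A2 M\<close> contains all representatives of its elements.
\<close>

lemma A2_heq:
  assumes "f \<in> A2 M" "g \<in> vecs (L2 M)" "heq (L2 M) g f"
  shows "g \<in> A2 M"
  using assms by (intro A2_closed) (auto simp: heq_def intro!: bexI[of _ f])

text \<open>
  Polynomials are dense in \<open>A2 M\<close>, and they are spanned by the monomials.
\<close>

lemma orthogonal_A2:
  assumes x: "x \<in> vecs (L2 M)" and orth: "\<And>\<alpha>. ip (L2 M) x (monomial \<alpha>) = 0" and g: "g \<in> A2 M"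
  shows "ip (L2 M) x g = 0"
proof -
  have poly: "ip (L2 M) x q = 0" if "q \<in> polynomials" for q
  proof -
    have "polynomials \<subseteq> {q \<in> vecs (L2 M). ip (L2 M) x q = 0}"
    proof (rule polynomials_subspaceI)
      show "(\<lambda>z. c * q z) \<in> {q \<in> vecs (L2 M). ip (L2 M) x q = 0}"
        if "q \<in> {q \<in> vecs (L2 M). ip (L2 M) x q = 0}" for c q
        using that L.scl_mem[of q c] L.ip_scl_right[of q x c] x by (simp del: L2_simps(2))
    qed (use x orth L.ip_add_right L.ip_diff_right[of 0 0 x] in \<open>auto simp del: L2_simps\<close>)
    with that show ?thesis by blast
  qed
  have bound: "cmod (ip (L2 M) x g) \<le> e" if e: "0 < e" for e
  proof -
    define d where "d = e / (hnorm (L2 M) x + 1)"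
    have pos: "0 < hnorm (L2 M) x + 1" using x by (simp add: add_nonneg_pos)
    then have "0 < d" using e by (simp add: d_def)
    then obtain q where q: "q \<in> polynomials" "hnorm (L2 M) (g - q) < d"
      using A2_approx[OF g] by blast
    have qv: "q \<in> vecs (L2 M)" "g \<in> vecs (L2 M)" using q polynomials_L2 g by (auto simp: A2_L2)
    have "ip (L2 M) x g = ip (L2 M) x (g - q)"
      using qv x poly[OF q(1)] by (simp add: L.ip_diff_right del: L2_simps)
    also have "cmod \<dots> \<le> hnorm (L2 M) x * hnorm (L2 M) (g - q)"
      using qv x by (intro L.Cauchy_Schwarz) auto
    also have "\<dots> \<le> (hnorm (L2 M) x + 1) * d"
      using q(2) x qv by (intro mult_mono) auto
    also have "\<dots> = e" using pos by (simp add: d_def)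
    finally show ?thesis .
  qed
  have "cmod (ip (L2 M) x g) \<le> 0"
    by (rule field_le_epsilon) (use bound in simp)
  then show ?thesis by simp
qed

lemma A2_01_simps [simp]:
  "vecs (A2_01 M) = {\<omega>. \<forall>j. \<omega> j \<in> A2 M}"
  "scl (A2_01 M) c \<omega> = (\<lambda>j z. c * \<omega> j z)"
  "ip (A2_01 M) \<omega> \<eta> = (\<Sum>j\<in>UNIV. ip (L2 M) (\<omega> j) (\<eta> j))"
  by (simp_all add: A2_01_def)

lemma semi_inner_A2_01: "semi_inner (A2_01 M)"
proof
  show "ip (A2_01 M) (x + y) v = ip (A2_01 M) x v + ip (A2_01 M) y v"
    if "x \<in> vecs (A2_01 M)" "y \<in> vecs (A2_01 M)" "v \<in> vecs (A2_01 M)" for x y v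
    using that by (simp add: L.ip_add_left A2_L2 sum.distrib del: L2_simps)
  show "ip (A2_01 M) (scl (A2_01 M) c x) v = c * ip (A2_01 M) x v" for c x v
    by (simp add: sum_distrib_left mult.assoc)
  show "cnj (ip (A2_01 M) x y) = ip (A2_01 M) y x"
    if "x \<in> vecs (A2_01 M)" "y \<in> vecs (A2_01 M)" for x y
    using that by (simp add: L.ip_cnj A2_L2 del: L2_simps)
  show "0 \<le> Re (ip (A2_01 M) x x)" if "x \<in> vecs (A2_01 M)" for x
    using that by (simp add: A2_L2 L.ip_ge_0 sum_nonneg del: L2_simps)
  show "scl (A2_01 M) (- 1) x = - x" for x by (simp add: fun_eq_iff)
qed (use zero_polynomials polynomials_A2 in \<open>auto simp: A2_add A2_scale\<close>)

sublocale F: semi_inner "A2_01 M"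
  by (rule semi_inner_A2_01)

lemma hnorm_A2_01_sq:
  assumes "\<And>j. \<omega> j \<in> A2 M"
  shows "(hnorm (A2_01 M) \<omega>)\<^sup>2 = (\<Sum>j\<in>UNIV. (hnorm (L2 M) (\<omega> j))\<^sup>2)"
  using assms by (simp add: F.hnorm_sq L.hnorm_sq A2_L2 del: L2_simps)

lemma hnorm_component_le:
  assumes "\<And>j. \<omega> j \<in> A2 M"
  shows "hnorm (L2 M) (\<omega> j) \<le> hnorm (A2_01 M) \<omega>"
proof -
  have "(hnorm (L2 M) (\<omega> j))\<^sup>2 \<le> (\<Sum>j\<in>UNIV. (hnorm (L2 M) (\<omega> j))\<^sup>2)"
    by (intro member_le_sum) auto
  then have "(hnorm (L2 M) (\<omega> j))\<^sup>2 \<le> (hnorm (A2_01 M) \<omega>)\<^sup>2"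
    using assms by (simp add: hnorm_A2_01_sq)
  then show ?thesis
    by (rule power2_le_imp_le) (use assms in simp)
qed

lemma semi_hilbert_A2_01: "semi_hilbert (A2_01 M)"
proof
  fix X :: "nat \<Rightarrow> 'n \<Rightarrow> complex ^ 'n \<Rightarrow> complex"
  assume X: "\<And>k. X k \<in> vecs (A2_01 M)"
    and Cauchy: "\<And>e. 0 < e \<Longrightarrow> \<exists>N. \<forall>m\<ge>N. \<forall>n\<ge>N. hnorm (A2_01 M) (X m - X n) < e"
  have Xj: "X k j \<in> A2 M" for k j using X[of k] by simp
  have "\<exists>x\<in>vecs (L2 M). (\<lambda>k. hnorm (L2 M) (X k j - x)) \<longlonglongrightarrow> 0" for j
  proof (rule L.complete)
    show "X k j \<in> vecs (L2 M)" for k using Xj by (rule A2_L2)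
    fix e :: real assume "0 < e"
    then obtain N where N: "\<And>m n. N \<le> m \<Longrightarrow> N \<le> n \<Longrightarrow> hnorm (A2_01 M) (X m - X n) < e"
      using Cauchy by blast
    have "hnorm (L2 M) (X m j - X n j) < e" if "N \<le> m" "N \<le> n" for m n
      using hnorm_component_le[of "X m - X n" j] N[OF that] Xj by (auto simp: A2_diff)
    then show "\<exists>N. \<forall>m\<ge>N. \<forall>n\<ge>N. hnorm (L2 M) (X m j - X n j) < e" by blast
  qed
  then have "\<forall>j. \<exists>x. x \<in> vecs (L2 M) \<and> (\<lambda>k. hnorm (L2 M) (X k j - x)) \<longlonglongrightarrow> 0" by blast
  from choice[OF this] obtain x where x: "\<And>j. x j \<in> vecs (L2 M)"
    and lim: "\<And>j. (\<lambda>k. hnorm (L2 M) (X k j - x j)) \<longlonglongrightarrow> 0"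
    by blast
  have xA: "x j \<in> A2 M" for j
  proof (rule A2_closed[OF x])
    fix e :: real assume "0 < e"
    then obtain k where "hnorm (L2 M) (X k j - x j) < e"
      using order_tendstoD(2)[OF lim[of j], of e] by (auto simp: eventually_sequentially)
    then show "\<exists>g\<in>A2 M. hnorm (L2 M) (x j - g) < e"
      using L.hnorm_diff_commute[OF x A2_L2[OF Xj], of j k j] by (intro bexI[OF _ Xj[of k j]]) simp
  qed
  have "hnorm (A2_01 M) (X k - x) = sqrt (\<Sum>j\<in>UNIV. (hnorm (L2 M) (X k j - x j))\<^sup>2)" for k
  proof -
    have "X k - x \<in> vecs (A2_01 M)"
      using Xj xA by (simp add: A2_diff)
    then have "0 \<le> hnorm (A2_01 M) (X k - x)"
      by (rule F.hnorm_nonneg)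
    moreover have "(hnorm (A2_01 M) (X k - x))\<^sup>2 = (\<Sum>j\<in>UNIV. (hnorm (L2 M) (X k j - x j))\<^sup>2)"
      using hnorm_A2_01_sq[of "X k - x"] Xj xA by (simp add: A2_diff)
    ultimately show ?thesis by (metis real_sqrt_unique)
  qed
  moreover have "(\<lambda>k. sqrt (\<Sum>j\<in>UNIV. (hnorm (L2 M) (X k j - x j))\<^sup>2)) \<longlonglongrightarrow> sqrt (\<Sum>j\<in>(UNIV::'n set). 0\<^sup>2)"
    by (intro tendsto_intros lim)
  ultimately have "(\<lambda>k. hnorm (A2_01 M) (X k - x)) \<longlonglongrightarrow> 0" by (simp only: power_zero_numeral sum.neutral_const real_sqrt_zero)
  then show "\<exists>x\<in>vecs (A2_01 M). (\<lambda>k. hnorm (A2_01 M) (X k - x)) \<longlonglongrightarrow> 0"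
    using xA by (intro bexI[of _ x]) auto
qed

sublocale F: semi_hilbert "A2_01 M"
  by (rule semi_hilbert_A2_01)

end

section \<open>Norms of monomials for a rotation-invariant measure\<close>

definition mfact :: "('n::finite \<Rightarrow> nat) \<Rightarrow> real" where
  "mfact \<alpha> = (\<Prod>j\<in>UNIV. fact (\<alpha> j))"

abbreviation up :: "('n \<Rightarrow> nat) \<Rightarrow> 'n \<Rightarrow> 'n \<Rightarrow> nat" where
  "up \<alpha> j \<equiv> \<alpha>(j := Suc (\<alpha> j))"

lemma sum_apply: "(\<Sum>i\<in>F. f i) z = (\<Sum>i\<in>F. f i z)"
  by (induction F rule: infinite_finite_induct) auto

lemma prod_split_pair:
  fixes f :: "'n::finite \<Rightarrow> 'a::comm_monoid_mult"
  assumes "j \<noteq> k"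
  shows "(\<Prod>l\<in>UNIV. f l) = f j * f k * (\<Prod>l\<in>UNIV - {j, k}. f l)"
proof -
  have "(\<Prod>l\<in>UNIV. f l) = f j * (\<Prod>l\<in>UNIV - {j}. f l)"
    by (simp add: prod.remove)
  also have "(\<Prod>l\<in>UNIV - {j}. f l) = f k * (\<Prod>l\<in>UNIV - {j} - {k}. f l)"
    using assms by (intro prod.remove) auto
  also have "UNIV - {j} - {k} = UNIV - {j, k}" by auto
  finally show ?thesis by (simp add: mult.assoc)
qed

lemma mfact_pos: "0 < mfact \<alpha>"
  by (simp add: mfact_def prod_pos)

lemma mfact_up: "mfact (up \<alpha> j) = (real (\<alpha> j) + 1) * mfact \<alpha>"
proof -
  have "mfact (up \<alpha> j) = fact (Suc (\<alpha> j)) * (\<Prod>l\<in>UNIV - {j}. fact (\<alpha> l))"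
    unfolding mfact_def by (subst prod.remove[of _ j]) auto
  moreover have "mfact \<alpha> = fact (\<alpha> j) * (\<Prod>l\<in>UNIV - {j}. fact (\<alpha> l))"
    unfolding mfact_def by (subst prod.remove[of _ j]) auto
  ultimately show ?thesis by simp
qed

lemma sum_up: "sum (up \<alpha> j) UNIV = Suc (sum \<alpha> (UNIV :: 'n::finite set))"
proof -
  have "sum (up \<alpha> j) UNIV = Suc (\<alpha> j) + sum \<alpha> (UNIV - {j})"
    by (subst sum.remove[of _ j]) auto
  moreover have "sum \<alpha> UNIV = \<alpha> j + sum \<alpha> (UNIV - {j})"
    by (subst sum.remove[of _ j]) auto
  ultimately show ?thesis by simp
qed

lemma monomial_up: "monomial (up \<alpha> j) z = z $ j * monomial \<alpha> z"
proof -
  have "monomial (up \<alpha> j) z = (z $ j) ^ Suc (\<alpha> j) * (\<Prod>l\<in>UNIV - {j}. (z $ l) ^ \<alpha> l)"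
    unfolding monomial_def by (subst prod.remove[of _ j]) auto
  moreover have "monomial \<alpha> z = (z $ j) ^ \<alpha> j * (\<Prod>l\<in>UNIV - {j}. (z $ l) ^ \<alpha> l)"
    unfolding monomial_def by (subst prod.remove[of _ j]) auto
  ultimately show ?thesis by simp
qed

lemma cmod_monomial_le: "cmod (monomial \<alpha> z) \<le> norm z ^ sum \<alpha> UNIV"
proof -
  have "cmod (monomial \<alpha> z) = (\<Prod>j\<in>UNIV. cmod (z $ j) ^ \<alpha> j)"
    by (simp add: monomial_def norm_power flip: prod_norm)
  also have "\<dots> \<le> (\<Prod>j\<in>UNIV. norm z ^ \<alpha> j)"
    by (intro prod_mono conjI power_mono Finite_Cartesian_Product.norm_nth_le) auto
  finally show ?thesis by (simp add: power_sum)
qed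

lemma monomial_continuous: "continuous_on UNIV (monomial \<alpha>)"
  unfolding monomial_def by (intro continuous_intros)

lemma norm_vec_sq: "(norm (z :: complex ^ 'n))\<^sup>2 = (\<Sum>j\<in>UNIV. (cmod (z $ j))\<^sup>2)"
  by (simp add: norm_vec_def L2_set_def sum_nonneg)

lemma unitary_matrixI:
  fixes U :: "complex ^ 'n ^ 'n"
  assumes "\<And>a b. (\<Sum>l\<in>UNIV. U $ a $ l * cnj (U $ b $ l)) = (if a = b then 1 else 0)"
  shows "unitary_matrix U"
proof -
  have "U ** (\<chi> i j. cnj (U $ j $ i)) = mat 1"
    using assms by (simp add: matrix_matrix_mult_def mat_def vec_eq_iff)
  then show ?thesis
    by (simp add: unitary_matrix_def matrix_left_right_inverse)
qed

text \<open>
  These unitary matrices separate distinct monomials.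
\<close>

definition phase_matrix :: "complex \<Rightarrow> 'n \<Rightarrow> complex ^ 'n ^ 'n" where
  "phase_matrix \<omega> k = (\<chi> a b. if a = b then if a = k then \<omega> else 1 else 0)"

lemma phase_matrix_mult: "(phase_matrix \<omega> k *v z) $ a = (if a = k then \<omega> else 1) * z $ a"
proof -
  have "(phase_matrix \<omega> k *v z) $ a = (\<Sum>b\<in>UNIV. if b = a then (if a = k then \<omega> else 1) * z $ b else 0)"
    unfolding phase_matrix_def matrix_vector_mult_def vec_lambda_beta by (rule sum.cong) auto
  then show ?thesis by simp
qed

lemma unitary_phase_matrix:
  assumes "cmod \<omega> = 1"
  shows "unitary_matrix (phase_matrix \<omega> k)"
proof (rule unitary_matrixI)
  fix a b
  have "(\<Sum>l\<in>UNIV. phase_matrix \<omega> k $ a $ l * cnj (phase_matrix \<omega> k $ b $ l))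
      = (\<Sum>l\<in>UNIV. if l = a then if a = b then 1 else 0 else 0)"
    using assms by (intro sum.cong) (auto simp: phase_matrix_def mult_cnj_eq_norm_sq)
  then show "(\<Sum>l\<in>UNIV. phase_matrix \<omega> k $ a $ l * cnj (phase_matrix \<omega> k $ b $ l)) = (if a = b then 1 else 0)"
    by simp
qed

lemma monomial_phase: "monomial \<alpha> (phase_matrix \<omega> k *v z) = \<omega> ^ \<alpha> k * monomial \<alpha> z"
proof -
  have "monomial \<alpha> (phase_matrix \<omega> k *v z) = (\<Prod>a\<in>UNIV. (if a = k then \<omega> ^ \<alpha> a else 1) * (z $ a) ^ \<alpha> a)"
    unfolding monomial_def phase_matrix_mult by (intro prod.cong) (auto simp: power_mult_distrib)
  then show ?thesis by (simp add: prod.distrib monomial_def)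
qed

text \<open>
  The rotation of the plane of the coordinates \<open>j\<close> and \<open>k\<close> by the angle with tangent \<open>s\<close>.
\<close>

definition plane_rotation :: "real \<Rightarrow> 'n \<Rightarrow> 'n \<Rightarrow> complex ^ 'n ^ 'n" where
  "plane_rotation s j k = (\<chi> a b.
     if a = j then (if b = j then 1 else if b = k then complex_of_real s else 0) / complex_of_real (sqrt (1 + s\<^sup>2))
     else if a = k then (if b = k then 1 else if b = j then - complex_of_real s else 0) / complex_of_real (sqrt (1 + s\<^sup>2))
     else if a = b then 1 else 0)"

lemma sum_support_pair:
  fixes f :: "'n::finite \<Rightarrow> 'a::comm_monoid_add"
  assumes "j \<noteq> k" "\<And>l. l \<noteq> j \<Longrightarrow> l \<noteq> k \<Longrightarrow> f l = 0"
  shows "(\<Sum>l\<in>UNIV. f l) = f j + f k"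
proof -
  have "(\<Sum>l\<in>UNIV. f l) = (\<Sum>l\<in>{j, k}. f l)"
    using assms by (intro sum.mono_neutral_right) auto
  then show ?thesis using assms by simp
qed

lemma plane_rotation_mult:
  assumes "j \<noteq> k"
  shows "(plane_rotation s j k *v z) $ j = (z $ j + complex_of_real s * z $ k) / complex_of_real (sqrt (1 + s\<^sup>2))"
    and "a \<noteq> j \<Longrightarrow> a \<noteq> k \<Longrightarrow> (plane_rotation s j k *v z) $ a = z $ a"
proof -
  show "(plane_rotation s j k *v z) $ j = (z $ j + complex_of_real s * z $ k) / complex_of_real (sqrt (1 + s\<^sup>2))"
    unfolding matrix_vector_mult_def plane_rotation_def using assms
    by (simp only: vec_lambda_beta, subst sum_support_pair[OF assms]) (auto simp: add_divide_distrib)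
  assume a: "a \<noteq> j" "a \<noteq> k"
  have "(plane_rotation s j k *v z) $ a = (\<Sum>b\<in>UNIV. if b = a then z $ b else 0)"
    unfolding matrix_vector_mult_def plane_rotation_def vec_lambda_beta using a by (intro sum.cong) auto
  then show "(plane_rotation s j k *v z) $ a = z $ a" by simp
qed

lemma unitary_plane_rotation:
  fixes j k :: "'n::finite"
  assumes "j \<noteq> k"
  shows "unitary_matrix (plane_rotation s j k)"
proof (rule unitary_matrixI)
  fix a b :: 'n
  define \<rho> where "\<rho> = complex_of_real (sqrt (1 + s\<^sup>2))"
  have \<rho>: "\<rho> * \<rho> = 1 + (complex_of_real s)\<^sup>2"
    unfolding \<rho>_def of_real_mult[symmetric] by (simp add: add_nonneg_nonneg)
  have nz: "1 + (complex_of_real s)\<^sup>2 \<noteq> 0"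
  proof -
    have "1 + s\<^sup>2 \<noteq> 0" by (metis add_pos_nonneg less_irrefl zero_le_power2 zero_less_one)
    then show ?thesis by (metis of_real_1 of_real_add of_real_eq_0_iff of_real_power)
  qed
  have cnj: "cnj \<rho> = \<rho>" by (simp add: \<rho>_def)
  define U where "U = plane_rotation s j k"
  have U: "U $ a $ l = (if a = j then (if l = j then 1 else if l = k then complex_of_real s else 0) / \<rho>
     else if a = k then (if l = k then 1 else if l = j then - complex_of_real s else 0) / \<rho>
     else if a = l then 1 else 0)" for a l
    by (simp add: U_def plane_rotation_def \<rho>_def)
  have "(\<Sum>l\<in>UNIV. U $ a $ l * cnj (U $ b $ l)) = (if a = b then 1 else 0)"
  proof (cases "a = j \<or> a = k")
    case True
    then have "(\<Sum>l\<in>UNIV. U $ a $ l * cnj (U $ b $ l)) = U $ a $ j * cnj (U $ b $ j) + U $ a $ k * cnj (U $ b $ k)"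
      by (intro sum_support_pair[OF assms]) (auto simp: U)
    also have "\<dots> = (if a = b then 1 else 0)"
      using True assms nz \<rho> by (auto simp: U cnj power2_eq_square simp flip: add_divide_distrib)
    finally show ?thesis .
  next
    case False
    then have "(\<Sum>l\<in>UNIV. U $ a $ l * cnj (U $ b $ l)) = (\<Sum>l\<in>UNIV. if l = a then cnj (U $ b $ a) else 0)"
      by (intro sum.cong) (auto simp: U)
    also have "\<dots> = (if a = b then 1 else 0)"
      using False by (auto simp: U)
    finally show ?thesis .
  qed
  then show "(\<Sum>l\<in>UNIV. plane_rotation s j k $ a $ l * cnj (plane_rotation s j k $ b $ l)) = (if a = b then 1 else 0)"
    by (simp add: U_def)
qed

lemma monomial_plane_rotation:
  assumes "j \<noteq> k"
  shows "monomial (\<alpha>(j := N, k := 0)) (plane_rotation s j k *v z)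
    = (\<Sum>i\<le>N. complex_of_real (real (N choose i) * s ^ i / sqrt (1 + s\<^sup>2) ^ N) * monomial (\<alpha>(j := N - i, k := i)) z)"
proof -
  define \<rho> where "\<rho> = complex_of_real (sqrt (1 + s\<^sup>2))"
  define rest where "rest = (\<Prod>l\<in>UNIV - {j, k}. (z $ l) ^ \<alpha> l)"
  have mono: "monomial (\<alpha>(j := m, k := i)) z = (z $ j) ^ m * (z $ k) ^ i * rest" for m i
    unfolding monomial_def prod_split_pair[OF assms] rest_def using assms by (auto intro!: prod.cong)
  have "monomial (\<alpha>(j := N, k := 0)) (plane_rotation s j k *v z)
      = ((z $ j + complex_of_real s * z $ k) / \<rho>) ^ N * rest"
    unfolding monomial_def prod_split_pair[OF assms] rest_def \<rho>_def
    using assms by (auto intro!: prod.cong simp: plane_rotation_mult)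
  also have "\<dots> = (complex_of_real s * z $ k + z $ j) ^ N / \<rho> ^ N * rest"
    by (simp add: power_divide add.commute)
  also have "(complex_of_real s * z $ k + z $ j) ^ N
      = (\<Sum>i\<le>N. of_nat (N choose i) * (complex_of_real s * z $ k) ^ i * (z $ j) ^ (N - i))"
    by (rule binomial_ring)
  also have "\<dots> / \<rho> ^ N * rest = (\<Sum>i\<le>N. complex_of_real (real (N choose i) * s ^ i / sqrt (1 + s\<^sup>2) ^ N) * monomial (\<alpha>(j := N - i, k := i)) z)"
    unfolding mono \<rho>_def sum_divide_distrib sum_distrib_right
    by (intro sum.cong) (simp_all add: power_mult_distrib)
  finally show ?thesis .
qed

locale radial_measure =
  fixes M :: "(complex ^ 'n) measure"
  assumes sets_M: "sets M = sets borel"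
    and rotation_invariant: "rotation_invariant M"
    and integrable_norm_power: "\<And>d. integrable M (\<lambda>z. norm z ^ (2 * d))"
    and moment_pos: "\<And>d. 0 < moment M d"
begin

lemma measurable_continuous:
  fixes f :: "complex ^ 'n \<Rightarrow> 'a::topological_space"
  shows "continuous_on UNIV f \<Longrightarrow> f \<in> borel_measurable M"
  using borel_measurable_continuous_onI[of f] measurable_cong_sets[OF sets_M refl] by blast

lemma monomial_measurable [measurable]: "monomial \<alpha> \<in> borel_measurable M"
  by (intro measurable_continuous monomial_continuous)

lemma norm_measurable [measurable]: "(norm :: complex ^ 'n \<Rightarrow> real) \<in> borel_measurable M"
  by (intro measurable_continuous continuous_intros)

lemma integrable_monomial_norm:
  "integrable M (\<lambda>z. (cmod (monomial \<alpha> z))\<^sup>2 * norm z ^ (2 * m))"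
proof (rule Bochner_Integration.integrable_bound[OF integrable_norm_power[of "sum \<alpha> UNIV + m"]])
  have "(cmod (monomial \<alpha> z))\<^sup>2 * norm z ^ (2 * m) \<le> norm z ^ (2 * (sum \<alpha> UNIV + m))" for z
  proof -
    have "(cmod (monomial \<alpha> z))\<^sup>2 * norm z ^ (2 * m) \<le> (norm z ^ sum \<alpha> UNIV)\<^sup>2 * norm z ^ (2 * m)"
      by (intro mult_right_mono power_mono cmod_monomial_le) auto
    then show ?thesis by (simp add: power_add power_mult mult.commute flip: power_mult)
  qed
  then show "AE z in M. norm ((cmod (monomial \<alpha> z))\<^sup>2 * norm z ^ (2 * m)) \<le> norm (norm z ^ (2 * (sum \<alpha> UNIV + m)))"
    by simp
qed measurable

lemma finite_measure_M: "finite_measure M"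
proof (rule finite_measureI)
  have "integrable M (\<lambda>_. 1 :: real)"
    using integrable_norm_power[of 0] by simp
  then show "emeasure M (space M) \<noteq> \<infinity>"
    by (simp add: integrable_iff_bounded less_top[symmetric])
qed

sublocale monomials_L2 M
proof (intro monomials_L2.intro finite_measure_M monomials_L2_axioms.intro)
  show "monomial \<alpha> \<in> vecs (L2 M)" for \<alpha>
    using integrable_monomial_norm[of \<alpha> 0] by (simp add: mem_L2)
qed

lemma integral_unitary:
  fixes f :: "complex ^ 'n \<Rightarrow> 'a::{banach, second_countable_topology}"
  assumes "unitary_matrix U" and f: "f \<in> borel_measurable M"
  shows "(\<integral>z. f (U *v z) \<partial>M) = (\<integral>z. f z \<partial>M)"
proof -
  have "continuous_on UNIV (\<lambda>z. U *v z)"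
    unfolding matrix_vector_mult_def by (intro continuous_intros continuous_on_vec_lambda)
  then have "(\<lambda>z. U *v z) \<in> borel_measurable M"
    by (rule measurable_continuous)
  moreover have "f \<in> borel_measurable borel"
    using f measurable_cong_sets[OF sets_M refl] by blast
  ultimately have "integral\<^sup>L (distr M borel (\<lambda>z. U *v z)) f = (\<integral>z. f (U *v z) \<partial>M)"
    by (rule integral_distr)
  then show ?thesis
    using rotation_invariant assms(1) by (simp add: rotation_invariant_def)
qed

text \<open>
  A change of the phase of a coordinate in which the exponents differ multiplies the inner product by a
  nontrivial phase, although it leaves it invariant.
\<close>

lemma monomial_orthogonal:
  assumes "\<alpha> \<noteq> \<beta>"
  shows "ip (L2 M) (monomial \<alpha>) (monomial \<beta>) = 0"
proof -
  obtain k where k: "\<alpha> k \<noteq> \<beta> k" using assms by auto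
  \<comment> \<open>The angle is chosen such that the integrand changes its sign.\<close>
  define t where "t = pi / (real (\<alpha> k) - real (\<beta> k))"
  define I where "I = (\<integral>z. monomial \<alpha> z * cnj (monomial \<beta> z) \<partial>M)"
  have "cis t ^ \<alpha> k * cnj (cis t ^ \<beta> k) = cis (real (\<alpha> k) * t - real (\<beta> k) * t)"
    by (simp add: Complex.DeMoivre cis_cnj cis_mult flip: complex_cnj_power)
  also have "real (\<alpha> k) * t - real (\<beta> k) * t = pi"
    unfolding left_diff_distrib[symmetric] using k by (simp add: t_def)
  finally have phase: "cis t ^ \<alpha> k * cnj (cis t ^ \<beta> k) = - 1" by simp
  have "I = (\<integral>z. monomial \<alpha> (phase_matrix (cis t) k *v z) * cnj (monomial \<beta> (phase_matrix (cis t) k *v z)) \<partial>M)"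
    unfolding I_def by (rule integral_unitary[symmetric]) (auto simp: unitary_phase_matrix)
  also have "\<dots> = (\<integral>z. cis t ^ \<alpha> k * cnj (cis t ^ \<beta> k) * (monomial \<alpha> z * cnj (monomial \<beta> z)) \<partial>M)"
    by (intro Bochner_Integration.integral_cong) (simp_all add: monomial_phase mult_ac)
  also have "\<dots> = - I"
    unfolding phase by (simp add: I_def)
  finally show ?thesis by (simp add: I_def)
qed

definition mono_sq :: "('n \<Rightarrow> nat) \<Rightarrow> real" where
  "mono_sq \<alpha> = (\<integral>z. (cmod (monomial \<alpha> z))\<^sup>2 \<partial>M)"

lemma ip_monomial:
  "ip (L2 M) (monomial \<alpha>) (monomial \<beta>) = (if \<alpha> = \<beta> then complex_of_real (mono_sq \<alpha>) else 0)"
proof (cases "\<alpha> = \<beta>")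
  case True
  then show ?thesis
    using L.ip_self[OF monomial_L2, of \<beta>] by (simp add: mono_sq_def hnorm_L2_sq del: L2_simps)
qed (simp add: monomial_orthogonal del: L2_simps)

text \<open>
  The function \<open>monomial (\<alpha>(j := N, k := 0))\<close> keeps its norm when it is composed with the rotation by
  the angle with tangent \<open>sqrt r\<close>. By orthogonality, the squared norm of its binomial expansion is
  the sum of the squared norms of the terms.
\<close>

lemma mono_sq_plane_rotation:
  assumes "j \<noteq> k" "0 \<le> r"
  shows "(\<Sum>i\<le>N. (real (N choose i))\<^sup>2 * mono_sq (\<alpha>(j := N - i, k := i)) * r ^ i)
    = (1 + r) ^ N * mono_sq (\<alpha>(j := N, k := 0))"
proof -
  define s where "s = sqrt r"
  define \<rho> where "\<rho> = sqrt (1 + s\<^sup>2)"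
  have s2: "s\<^sup>2 = r" using assms by (simp add: s_def)
  have \<rho>: "\<rho>\<^sup>2 = 1 + r" "\<rho> \<noteq> 0" using assms by (simp_all add: \<rho>_def s2)
  define a where "a i = complex_of_real (real (N choose i) * s ^ i / \<rho> ^ N)" for i
  define h where "h = (\<Sum>i\<le>N. scl (L2 M) (a i) (monomial (\<alpha>(j := N - i, k := i))))"
  have h_mem: "h \<in> vecs (L2 M)"
    unfolding h_def by (intro L.sum_mem L.scl_mem) simp
  have h: "h z = monomial (\<alpha>(j := N, k := 0)) (plane_rotation s j k *v z)" for z
    unfolding monomial_plane_rotation[OF assms(1)] h_def a_def \<rho>_def by (simp add: sum_apply)
  have inj: "(\<alpha>(j := N - i, k := i) = \<alpha>(j := N - i', k := i')) = (i = i')" for i i'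
    by (metis fun_upd_same)
  have "ip (L2 M) h h = complex_of_real (\<Sum>i\<le>N. (cmod (a i))\<^sup>2 * mono_sq (\<alpha>(j := N - i, k := i)))"
    unfolding h_def by (rule L.ip_sum_orthogonal) (simp_all add: ip_monomial inj del: L2_simps)
  then have "(hnorm (L2 M) h)\<^sup>2 = (\<Sum>i\<le>N. (cmod (a i))\<^sup>2 * mono_sq (\<alpha>(j := N - i, k := i)))"
    using h_mem by (simp add: L.hnorm_sq del: L2_simps)
  also have "(hnorm (L2 M) h)\<^sup>2 = mono_sq (\<alpha>(j := N, k := 0))"
    unfolding hnorm_L2_sq h mono_sq_def by (rule integral_unitary[OF unitary_plane_rotation[OF assms(1)]]) simp
  also have "(\<Sum>i\<le>N. (cmod (a i))\<^sup>2 * mono_sq (\<alpha>(j := N - i, k := i)))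
      = (\<Sum>i\<le>N. (real (N choose i))\<^sup>2 * mono_sq (\<alpha>(j := N - i, k := i)) * r ^ i) / (1 + r) ^ N"
  proof -
    have "(cmod (a i))\<^sup>2 = (real (N choose i))\<^sup>2 * r ^ i / (1 + r) ^ N" for i
    proof -
      have "(s ^ i)\<^sup>2 = r ^ i" "(\<rho> ^ N)\<^sup>2 = (1 + r) ^ N"
        by (metis mult.commute power_mult s2) (metis mult.commute power_mult \<rho>(1))
      then show ?thesis
        unfolding a_def norm_of_real power2_abs power_divide power_mult_distrib by simp
    qed
    then show ?thesis by (simp add: sum_divide_distrib mult_ac)
  qed
  finally show ?thesis using assms by (simp add: field_simps)
qed

text \<open>
  Both sides of \<open>mono_sq_plane_rotation\<close> are polynomials in \<open>r\<close>, so their coefficients agree.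
\<close>

lemma mono_sq_binomial:
  assumes "j \<noteq> k" "i \<le> N"
  shows "real (N choose i) * mono_sq (\<alpha>(j := N - i, k := i)) = mono_sq (\<alpha>(j := N, k := 0))"
proof -
  define e where "e i = (real (N choose i))\<^sup>2 * mono_sq (\<alpha>(j := N - i, k := i))
      - real (N choose i) * mono_sq (\<alpha>(j := N, k := 0))" for i
  have "{0..} \<subseteq> {r. (\<Sum>i\<le>N. e i * r ^ i) = 0}"
  proof clarsimp
    fix r :: real assume r: "0 \<le> r"
    have "(1 + r) ^ N = (\<Sum>i\<le>N. real (N choose i) * r ^ i)"
      using binomial_ring[of r 1 N] by (simp add: add.commute)
    then show "(\<Sum>i\<le>N. e i * r ^ i) = 0"
      using mono_sq_plane_rotation[OF assms(1) r, of N \<alpha>]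
      by (simp add: e_def left_diff_distrib right_diff_distrib sum_subtractf sum_distrib_right sum_distrib_left mult_ac)
  qed
  moreover have "infinite {0 :: real..}" by (rule infinite_Ici)
  ultimately have "infinite {r. (\<Sum>i\<le>N. e i * r ^ i) = 0}" using finite_subset by blast
  then have "e i = 0" using polyfun_finite_roots[where c = e and n = N] assms(2) by blast
  then have "real (N choose i) * (real (N choose i) * mono_sq (\<alpha>(j := N - i, k := i)))
      = real (N choose i) * mono_sq (\<alpha>(j := N, k := 0))"
    by (simp add: e_def power2_eq_square mult.assoc)
  then show ?thesis using assms(2) by simp
qed

lemma mono_sq_merge:
  assumes "j \<noteq> k"
  shows "mono_sq \<alpha> / mfact \<alpha> = mono_sq (\<alpha>(j := \<alpha> j + \<alpha> k, k := 0)) / mfact (\<alpha>(j := \<alpha> j + \<alpha> k, k := 0))"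
proof -
  define N where "N = \<alpha> j + \<alpha> k"
  define rest where "rest = (\<Prod>l\<in>UNIV - {j, k}. fact (\<alpha> l) :: real)"
  have f1: "mfact \<alpha> = fact (N - \<alpha> k) * fact (\<alpha> k) * rest"
    unfolding mfact_def prod_split_pair[OF assms] rest_def N_def by simp
  have f2: "mfact (\<alpha>(j := N, k := 0)) = fact N * rest"
    unfolding mfact_def prod_split_pair[OF assms] rest_def using assms by (auto intro!: prod.cong)
  have \<alpha>: "\<alpha>(j := N - \<alpha> k, k := \<alpha> k) = \<alpha>" by (auto simp: N_def)
  have "real (N choose \<alpha> k) * mono_sq \<alpha> = mono_sq (\<alpha>(j := N, k := 0))"
    using mono_sq_binomial[OF assms, of "\<alpha> k" N \<alpha>] unfolding \<alpha> by (simp add: N_def)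
  moreover have "real (N choose \<alpha> k) = fact N / (fact (\<alpha> k) * fact (N - \<alpha> k))"
    by (rule binomial_fact) (simp add: N_def)
  moreover have "rest \<noteq> 0" by (simp add: rest_def)
  ultimately show ?thesis
    unfolding N_def[symmetric] f1 f2 by (simp add: field_simps)
qed

text \<open>
  Moving the components one after another to position \<open>j\<close> leaves the quotient unchanged, by
  \<open>mono_sq_merge\<close>. Hence it depends only on the degree.
\<close>

lemma mono_sq_concentrate:
  "mono_sq \<alpha> / mfact \<alpha> = mono_sq ((\<lambda>_. 0)(j := sum \<alpha> UNIV)) / mfact ((\<lambda>_. 0)(j := sum \<alpha> UNIV))"
proof -
  have "mono_sq \<alpha> / mfact \<alpha> = mono_sq ((\<lambda>_. 0)(j := sum \<alpha> UNIV)) / mfact ((\<lambda>_. 0)(j := sum \<alpha> UNIV))"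
    if "finite A" "j \<notin> A" "\<And>l. l \<notin> insert j A \<Longrightarrow> \<alpha> l = 0" for A and \<alpha> :: "'n \<Rightarrow> nat"
    using that
  proof (induction A arbitrary: \<alpha> rule: finite_induct)
    case empty
    then have "sum \<alpha> UNIV = sum \<alpha> {j}"
      by (intro sum.mono_neutral_right) auto
    then have "\<alpha> = (\<lambda>_. 0)(j := sum \<alpha> UNIV)"
      using empty by (auto simp: fun_eq_iff)
    then show ?case by metis
  next
    case (insert k A)
    define \<beta> where "\<beta> = \<alpha>(j := \<alpha> j + \<alpha> k, k := 0)"
    have jk: "j \<noteq> k" using insert by auto
    have "sum \<beta> UNIV = \<beta> j + (\<beta> k + sum \<beta> (UNIV - {j} - {k}))"
      using jk by (subst sum.remove[of _ j]) (auto intro!: arg_cong2[where f = plus] sum.remove)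
    also have "\<dots> = \<alpha> j + (\<alpha> k + sum \<alpha> (UNIV - {j} - {k}))"
      using jk by (auto simp: \<beta>_def intro!: sum.cong)
    also have "\<dots> = sum \<alpha> UNIV"
      using jk by (subst (2) sum.remove[of _ j]) (auto intro!: arg_cong2[where f = plus] sum.remove[symmetric])
    finally have "sum \<beta> UNIV = sum \<alpha> UNIV" .
    moreover have "mono_sq \<beta> / mfact \<beta> = mono_sq ((\<lambda>_. 0)(j := sum \<beta> UNIV)) / mfact ((\<lambda>_. 0)(j := sum \<beta> UNIV))"
      using insert by (intro insert.IH) (auto simp: \<beta>_def)
    ultimately show ?case
      using mono_sq_merge[OF jk, of \<alpha>] by (simp only: \<beta>_def)
  qed
  from this[of "UNIV - {j}" \<alpha>] show ?thesis by simp
qed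

text \<open>
  The coordinate \<open>undefined\<close> is an arbitrary one.
\<close>

definition kappa :: "nat \<Rightarrow> real" where
  "kappa d = mono_sq ((\<lambda>_. 0)(undefined := d)) / mfact ((\<lambda>_. 0)(undefined := d) :: 'n \<Rightarrow> nat)"

lemma mono_sq_eq: "mono_sq \<alpha> = kappa (sum \<alpha> UNIV) * mfact \<alpha>"
  using mono_sq_concentrate[of \<alpha> undefined] mfact_pos[of \<alpha>] by (simp add: kappa_def field_simps)

text \<open>
  Expanding one factor \<open>(norm z)\<^sup>2\<close> as the sum of the \<open>(cmod (z $ j))\<^sup>2\<close> raises the exponent of
  one coordinate by 1 in each term. For \<open>\<alpha> = 0\<close> this relates the moments to \<open>kappa\<close>.
\<close>

lemma integral_monomial_norm:
  "(\<integral>z. (cmod (monomial \<alpha> z))\<^sup>2 * norm z ^ (2 * m) \<partial>M)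
    = kappa (sum \<alpha> UNIV + m) * mfact \<alpha> * pochhammer (real (CARD('n) + sum \<alpha> UNIV)) m"
proof (induction m arbitrary: \<alpha>)
  case 0
  then show ?case using mono_sq_eq[of \<alpha>] by (simp add: mono_sq_def)
next
  case (Suc m)
  have "(cmod (monomial \<alpha> z))\<^sup>2 * norm z ^ (2 * Suc m)
      = (\<Sum>j\<in>UNIV. (cmod (monomial (up \<alpha> j) z))\<^sup>2 * norm z ^ (2 * m))" for z
  proof -
    have "norm z ^ (2 * Suc m) = (\<Sum>j\<in>UNIV. (cmod (z $ j))\<^sup>2) * norm z ^ (2 * m)"
      by (simp flip: norm_vec_sq) (simp add: power2_eq_square)
    then show ?thesis
      by (simp add: monomial_up norm_mult power_mult_distrib sum_distrib_left sum_distrib_right mult_ac)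
  qed
  then have "(\<integral>z. (cmod (monomial \<alpha> z))\<^sup>2 * norm z ^ (2 * Suc m) \<partial>M)
      = (\<Sum>j\<in>UNIV. \<integral>z. (cmod (monomial (up \<alpha> j) z))\<^sup>2 * norm z ^ (2 * m) \<partial>M)"
    by (simp only: Bochner_Integration.integral_sum[OF integrable_monomial_norm])
  also have "\<dots> = (\<Sum>j\<in>UNIV. kappa (sum (up \<alpha> j) UNIV + m) * mfact (up \<alpha> j)
      * pochhammer (real (CARD('n) + sum (up \<alpha> j) UNIV)) m)"
    by (simp only: Suc.IH)
  also have "\<dots> = kappa (sum \<alpha> UNIV + Suc m) * mfact \<alpha> * (\<Sum>j\<in>UNIV. real (\<alpha> j) + 1)
      * pochhammer (real (CARD('n) + sum \<alpha> UNIV) + 1) m"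
    by (simp only: sum_up mfact_up sum_distrib_left sum_distrib_right add_Suc_shift add_Suc_right of_nat_Suc)
      (simp add: mult_ac add_ac)
  also have "(\<Sum>j\<in>UNIV. real (\<alpha> j) + 1) = real (CARD('n) + sum \<alpha> UNIV)"
    by (simp add: sum.distrib)
  finally show ?case by (simp add: pochhammer_rec mult.assoc)
qed

lemma moment_eq: "moment M d = kappa d * pochhammer (real CARD('n)) d"
  using integral_monomial_norm[of "\<lambda>_. 0" d] by (simp add: moment_def monomial_def mfact_def)

lemma kappa_pos: "0 < kappa d"
proof -
  have "0 < pochhammer (real CARD('n)) d"
    by (intro pochhammer_pos) simp
  then show ?thesis using moment_pos[of d] by (simp add: moment_eq zero_less_mult_iff)
qed

lemma kappa_Suc_divide: "kappa (Suc d) / kappa d = moment M (Suc d) / (real (CARD('n) + d) * moment M d)"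
proof -
  have "0 < pochhammer (real CARD('n)) d"
    by (intro pochhammer_pos) simp
  moreover have "pochhammer (real CARD('n)) (Suc d) = pochhammer (real CARD('n)) d * real (CARD('n) + d)"
    by (simp add: pochhammer_Suc)
  moreover have "0 < real (CARD('n) + d)" by (simp only: of_nat_0_less_iff) simp
  ultimately show ?thesis
    using kappa_pos[of d] by (simp only: moment_eq) (simp only: field_simps, simp add: mult_ac)
qed

end

section \<open>Summation over multi-indices\<close>

text \<open>
  An enumeration of the coordinates reduces this to counting lists with given sum.
\<close>

lemma card_multi_indices:
  "card {\<gamma> :: 'n::finite \<Rightarrow> nat. sum \<gamma> UNIV = m} = (CARD('n) + m - 1) choose (CARD('n) - 1)"
proof -
  obtain h :: "nat \<Rightarrow> 'n" where h: "bij_betw h {0..<CARD('n)} UNIV"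
    using ex_bij_betw_nat_finite[OF finite_class.finite_UNIV] by blast
  define to_list where "to_list \<gamma> = map (\<lambda>i. \<gamma> (h i)) [0..<CARD('n)]" for \<gamma> :: "'n \<Rightarrow> nat"
  define of_list where "of_list l x = l ! (inv_into {0..<CARD('n)} h x)" for l :: "nat list" and x
  have sum_list: "sum_list (to_list \<gamma>) = sum \<gamma> UNIV" for \<gamma>
    using sum.reindex_bij_betw[OF h, of \<gamma>] by (simp add: to_list_def interv_sum_list_conv_sum_set_nat)
  have of_to: "of_list (to_list \<gamma>) = \<gamma>" for \<gamma>
  proof
    fix x
    have "inv_into {0..<CARD('n)} h x \<in> {0..<CARD('n)}"
      using h by (intro inv_into_into) (simp add: bij_betw_def)
    then show "of_list (to_list \<gamma>) x = \<gamma> x"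
      using h by (simp add: of_list_def to_list_def f_inv_into_f bij_betw_def)
  qed
  have to_of: "to_list (of_list l) = l" if "length l = CARD('n)" for l
    using that h by (intro nth_equalityI) (simp_all add: of_list_def to_list_def bij_betw_def inv_into_f_f)
  have "bij_betw to_list {\<gamma>. sum \<gamma> UNIV = m} {l. length l = CARD('n) \<and> sum_list l = m}"
  proof (rule bij_betw_byWitness[where f' = of_list])
    show "to_list ` {\<gamma>. sum \<gamma> UNIV = m} \<subseteq> {l. length l = CARD('n) \<and> sum_list l = m}"
      by (auto simp: sum_list) (simp add: to_list_def)
    show "of_list ` {l. length l = CARD('n) \<and> sum_list l = m} \<subseteq> {\<gamma>. sum \<gamma> UNIV = m}"
      by (auto simp: sum_list[symmetric] to_of)
  qed (auto simp: of_to to_of)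
  then have "card {\<gamma> :: 'n \<Rightarrow> nat. sum \<gamma> UNIV = m} = (m + CARD('n) - 1) choose m"
    by (simp add: bij_betw_same_card card_length_sum_list)
  also have "\<dots> = (m + CARD('n) - 1) choose (CARD('n) - 1)"
    by (subst binomial_symmetric) (simp_all add: Suc_leI)
  finally show ?thesis by (simp add: add.commute)
qed

lemma card_multi_indices_pos_component:
  assumes "1 \<le> d"
  shows "card {\<alpha> :: 'n::finite \<Rightarrow> nat. sum \<alpha> UNIV = d \<and> 1 \<le> \<alpha> k} = (CARD('n) + d - 2) choose (CARD('n) - 1)"
proof -
  have "bij_betw (\<lambda>\<gamma>. up \<gamma> k) {\<gamma>. sum \<gamma> UNIV = d - 1} {\<alpha> :: 'n \<Rightarrow> nat. sum \<alpha> UNIV = d \<and> 1 \<le> \<alpha> k}"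
  proof (rule bij_betw_byWitness[where f' = "\<lambda>\<alpha>. \<alpha>(k := \<alpha> k - 1)"])
    show "(\<lambda>\<gamma>. up \<gamma> k) ` {\<gamma>. sum \<gamma> UNIV = d - 1} \<subseteq> {\<alpha>. sum \<alpha> UNIV = d \<and> 1 \<le> \<alpha> k}"
      using assms by (auto simp: sum_up simp del: fun_upd_apply) simp
    show "(\<lambda>\<alpha>. \<alpha>(k := \<alpha> k - 1)) ` {\<alpha>. sum \<alpha> UNIV = d \<and> 1 \<le> \<alpha> k} \<subseteq> {\<gamma>. sum \<gamma> UNIV = d - 1}"
    proof clarify
      fix \<alpha> :: "'n \<Rightarrow> nat" assume \<alpha>: "1 \<le> \<alpha> k" "d = sum \<alpha> UNIV"
      then have "up (\<alpha>(k := \<alpha> k - 1)) k = \<alpha>" by auto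
      then show "sum (\<alpha>(k := \<alpha> k - 1)) UNIV = sum \<alpha> UNIV - 1"
        using sum_up[of "\<alpha>(k := \<alpha> k - 1)" k] by simp
    qed
  qed auto
  then have "card {\<alpha> :: 'n \<Rightarrow> nat. sum \<alpha> UNIV = d \<and> 1 \<le> \<alpha> k} = card {\<gamma> :: 'n \<Rightarrow> nat. sum \<gamma> UNIV = d - 1}"
    by (simp add: bij_betw_same_card)
  also have "\<dots> = (CARD('n) + d - 2) choose (CARD('n) - 1)"
    using assms by (simp add: card_multi_indices numeral_2_eq_2)
  finally show ?thesis .
qed

lemma finite_multi_indices: "finite {\<alpha> :: 'n::finite \<Rightarrow> nat. sum \<alpha> UNIV = d \<and> P \<alpha>}"
proof (rule finite_subset)
  show "{\<alpha>. sum \<alpha> UNIV = d \<and> P \<alpha>} \<subseteq> PiE UNIV (\<lambda>_::'n. {..d})"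
    by (auto intro: member_le_sum)
qed (auto intro: finite_PiE)

text \<open>
  The summand is constant on the finite fibres of the degree; by symmetry their size does not depend on
  \<open>k\<close>.
\<close>

lemma summable_on_multi_indices_iff:
  fixes g :: "nat \<Rightarrow> real" and k :: "'n::finite"
  assumes g: "\<And>d. 0 \<le> g d"
  shows "(\<lambda>\<alpha>. g (sum \<alpha> UNIV)) summable_on {\<alpha> :: 'n \<Rightarrow> nat. 1 \<le> \<alpha> k}
    \<longleftrightarrow> (\<lambda>d. real ((CARD('n) + d - 2) choose (CARD('n) - 1)) * g d) summable_on {1..}"
proof -
  define B where "B d = {\<alpha> :: 'n \<Rightarrow> nat. sum \<alpha> UNIV = d \<and> 1 \<le> \<alpha> k}" for d
  have fin: "finite (B d)" for d unfolding B_def by (rule finite_multi_indices)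
  have bij: "bij_betw (\<lambda>\<alpha>. (sum \<alpha> UNIV, \<alpha>)) {\<alpha>. 1 \<le> \<alpha> k} (Sigma {1..} B)"
  proof (rule bij_betw_byWitness[where f' = snd])
    have "1 \<le> sum \<alpha> UNIV" if "1 \<le> \<alpha> k" for \<alpha> :: "'n \<Rightarrow> nat"
      using member_le_sum[of k UNIV \<alpha>] that by simp
    then show "(\<lambda>\<alpha>. (sum \<alpha> UNIV, \<alpha>)) ` {\<alpha>. 1 \<le> \<alpha> k} \<subseteq> Sigma {1..} B"
      by (force simp: B_def)
  qed (auto simp: B_def)
  have "(\<lambda>\<alpha>. g (sum \<alpha> UNIV)) summable_on {\<alpha> :: 'n \<Rightarrow> nat. 1 \<le> \<alpha> k} \<longleftrightarrow> (\<lambda>x. g (fst x)) summable_on Sigma {1..} B"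
    using summable_on_reindex_bij_betw[OF bij, of "\<lambda>x. g (fst x)"] by simp
  also have "\<dots> \<longleftrightarrow> (\<lambda>x. norm (g (fst x))) summable_on Sigma {1..} B"
    using g by simp
  also have "\<dots> \<longleftrightarrow> (\<lambda>d. norm (infsum (\<lambda>\<alpha>. norm (g d)) (B d))) summable_on {1..}"
    by (subst Infinite_Sum.abs_summable_on_Sigma_iff) (simp add: fin)
  also have "\<dots> \<longleftrightarrow> (\<lambda>d. real ((CARD('n) + d - 2) choose (CARD('n) - 1)) * g d) summable_on {1..}"
    using g by (intro summable_on_cong) (simp_all add: fin card_multi_indices_pos_component B_def del: One_nat_def)
  finally show ?thesis .
qed

lemma summable_on_finite_UN:
  fixes f :: "'a \<Rightarrow> real"
  shows "finite I \<Longrightarrow> (\<And>i. i \<in> I \<Longrightarrow> f summable_on S i) \<Longrightarrow> f summable_on (\<Union>i\<in>I. S i)"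
  by (induction I rule: finite_induct) (auto intro: summable_on_union)

text \<open>
  The pair \<open>(\<alpha>, j)\<close> with \<open>\<alpha> j \<noteq> 0\<close> stands for the eigenvector number \<open>j\<close> of the block \<open>\<gamma>\<close> with
  \<open>\<alpha> = up \<gamma> j\<close>. The eigenvector number \<open>k0\<close> is the exceptional one. If \<open>\<alpha> j = 0\<close>, the pair is a
  block of its own.
\<close>

definition split_eigenvalue :: "(nat \<Rightarrow> real) \<Rightarrow> (nat \<Rightarrow> real) \<Rightarrow> 'n \<Rightarrow> ('n \<Rightarrow> nat) \<times> 'n::finite \<Rightarrow> real" where
  "split_eigenvalue a b k0 = (\<lambda>(\<alpha>, j). if \<alpha> j = 0 \<or> j \<noteq> k0 then a (sum \<alpha> UNIV) else b (sum \<alpha> UNIV))"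

lemma split_eigenvalue_simps:
  "\<alpha> k0 = 0 \<Longrightarrow> split_eigenvalue a b k0 (\<alpha>, k0) = a (sum \<alpha> UNIV)"
  "j \<noteq> k0 \<Longrightarrow> split_eigenvalue a b k0 (\<alpha>, j) = a (sum \<alpha> UNIV)"
  "1 \<le> \<alpha> k0 \<Longrightarrow> split_eigenvalue a b k0 (\<alpha>, k0) = b (sum \<alpha> UNIV)"
  by (auto simp: split_eigenvalue_def)

lemma powr_sum_le:
  fixes x y c q :: real
  assumes "0 \<le> x" "0 \<le> y" "0 \<le> c" "0 < q"
  shows "(c * x + y) powr q \<le> (2 * c) powr q * x powr q + 2 powr q * y powr q"
proof (cases "c * x \<le> y")
  case True
  then have "(c * x + y) powr q \<le> (2 * y) powr q"
    using assms by (intro powr_mono2) auto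
  also have "\<dots> = 2 powr q * y powr q"
    using assms by (simp add: powr_mult)
  finally show ?thesis by (simp add: add_increasing)
next
  case False
  then have "(c * x + y) powr q \<le> (2 * c * x) powr q"
    using assms by (intro powr_mono2) auto
  also have "\<dots> = (2 * c) powr q * x powr q"
    using assms by (simp add: powr_mult)
  finally show ?thesis by (simp add: add_increasing2)
qed

text \<open>
  The series on the right collects the blocks by degree, with the trace of a block in place of its
  eigenvalues. In dimension 1, the only pair that is a block of its own has \<open>\<alpha> = 0\<close>. Otherwise the
  trace dominates \<open>a\<close>, and such pairs are covered by the symmetry of
  \<open>summable_on_multi_indices_iff\<close> in \<open>k\<close>: every nonzero multi-index has a positive component.
\<close>

theorem summable_on_split_eigenvalue_iff:
  fixes a b :: "nat \<Rightarrow> real" and k0 :: "'n::finite"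
  assumes a: "\<And>d. 0 \<le> a d" and b: "\<And>d. 1 \<le> d \<Longrightarrow> 0 \<le> b d" and q: "0 < q"
  shows "(\<lambda>x. split_eigenvalue a b k0 x powr q) summable_on UNIV \<longleftrightarrow>
    (\<lambda>d. real ((CARD('n) + d - 2) choose (CARD('n) - 1)) * (real (CARD('n) - 1) * a d + b d) powr q) summable_on {1..}"
    (is "?E summable_on UNIV \<longleftrightarrow> ?R summable_on {1..}")
proof -
  define t where "t d = real (CARD('n) - 1) * a d + b d" for d
  define S where "S k = {\<alpha> :: 'n \<Rightarrow> nat. 1 \<le> \<alpha> k}" for k
  have pos: "1 \<le> sum \<alpha> UNIV" if "\<alpha> \<in> S k" for \<alpha> k
    using member_le_sum[of k UNIV \<alpha>] that by (simp add: S_def)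
  have R_iff: "?R summable_on {1..} \<longleftrightarrow> (\<lambda>\<alpha>. t (sum \<alpha> UNIV) powr q) summable_on S k" for k
    unfolding S_def t_def[symmetric] by (rule summable_on_multi_indices_iff[symmetric]) simp
  have column: "?E summable_on ((\<lambda>\<alpha>. (\<alpha>, j)) ` V) \<longleftrightarrow> (\<lambda>\<alpha>. ?E (\<alpha>, j)) summable_on V" for j V
    by (subst summable_on_reindex) (auto simp: inj_on_def o_def)
  show ?thesis
  proof
    assume E: "?E summable_on UNIV"
    then have E_sub: "(\<lambda>\<alpha>. ?E (\<alpha>, j)) summable_on S k0" for j
      unfolding column[symmetric] by (rule summable_on_subset) simp
    have B: "(\<lambda>\<alpha>. b (sum \<alpha> UNIV) powr q) summable_on S k0"
      using E_sub[of k0] by (rule summable_on_cong[THEN iffD1, rotated]) (simp add: split_eigenvalue_simps S_def)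
    have "(\<lambda>\<alpha>. t (sum \<alpha> UNIV) powr q) summable_on S k0"
    proof (cases "CARD('n) = 1")
      case True
      then show ?thesis using B by (simp add: t_def)
    next
      case False
      then have "UNIV \<noteq> {k0}" by (metis card_1_singleton_iff One_nat_def)
      then obtain j where j: "j \<noteq> k0" by auto
      have A: "(\<lambda>\<alpha>. a (sum \<alpha> UNIV) powr q) summable_on S k0"
        using E_sub[of j] j by (simp add: split_eigenvalue_simps)
      have "(\<lambda>\<alpha>. (2 * real (CARD('n) - 1)) powr q * a (sum \<alpha> UNIV) powr q + 2 powr q * b (sum \<alpha> UNIV) powr q) summable_on S k0"
        using A B by (intro summable_on_add summable_on_cmult_right)
      then show ?thesis
      proof (rule summable_on_comparison_test)
        fix \<alpha> assume "\<alpha> \<in> S k0"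
        then show "t (sum \<alpha> UNIV) powr q
            \<le> (2 * real (CARD('n) - 1)) powr q * a (sum \<alpha> UNIV) powr q + 2 powr q * b (sum \<alpha> UNIV) powr q"
          unfolding t_def using a b q pos by (intro powr_sum_le) auto
      qed simp
    qed
    then show "?R summable_on {1..}" using R_iff by blast
  next
    assume "?R summable_on {1..}"
    then have T: "(\<lambda>\<alpha>. t (sum \<alpha> UNIV) powr q) summable_on S k" for k using R_iff by blast
    have B: "(\<lambda>\<alpha>. b (sum \<alpha> UNIV) powr q) summable_on S k0"
      by (rule summable_on_comparison_test[OF T])
        (use a b q pos in \<open>auto intro!: powr_mono2 simp: t_def\<close>)
    \<comment> \<open>In dimension at least 2 the trace dominates \<open>a\<close>, whose power is thus summable over each set
        \<open>S k\<close>; together with the origin these sets exhaust all multi-indices.\<close>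
    have A: "(\<lambda>\<alpha>. a (sum \<alpha> UNIV) powr q) summable_on (UNIV :: ('n \<Rightarrow> nat) set)" if "CARD('n) \<noteq> 1"
    proof -
      have "1 \<le> real (CARD('n) - 1)"
        using that zero_less_card_finite[where 'a = 'n] by linarith
      then have "a d \<le> t d" if "1 \<le> d" for d
        using mult_right_mono[of 1 "real (CARD('n) - 1)" "a d"] a[of d] b[OF that] by (simp add: t_def)
      then have "(\<lambda>\<alpha>. a (sum \<alpha> UNIV) powr q) summable_on S k" for k
        by (intro summable_on_comparison_test[OF T]) (use a q pos in \<open>auto intro!: powr_mono2\<close>)
      then have "(\<lambda>\<alpha>. a (sum \<alpha> UNIV) powr q) summable_on (\<Union>k\<in>UNIV. S k)"
        by (intro summable_on_finite_UN) auto
      then have "(\<lambda>\<alpha>. a (sum \<alpha> UNIV) powr q) summable_on ((\<Union>k\<in>UNIV. S k) \<union> {\<lambda>_. 0})"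
        by (rule summable_on_union) simp
      also have "(\<Union>k\<in>UNIV. S k) \<union> {\<lambda>_. 0} = UNIV"
        by (auto simp: S_def fun_eq_iff Suc_le_eq)
      finally show ?thesis .
    qed
    have "(\<lambda>\<alpha>. ?E (\<alpha>, j)) summable_on UNIV" for j
    proof (cases "j = k0")
      case True
      have 1: "(\<lambda>\<alpha>. ?E (\<alpha>, k0)) summable_on S k0"
        using B by (rule summable_on_cong[THEN iffD1, rotated]) (simp add: split_eigenvalue_simps S_def)
      have 2: "(\<lambda>\<alpha>. ?E (\<alpha>, k0)) summable_on {\<alpha>. \<alpha> k0 = 0}"
      proof (cases "CARD('n) = 1")
        case True
        then obtain k :: 'n where "UNIV = {k}" by (metis card_1_singletonE)
        then have all_k0: "x = k0" for x by (metis UNIV_I singletonD)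
        have "\<alpha> = (\<lambda>_. 0)" if "\<alpha> k0 = 0" for \<alpha> :: "'n \<Rightarrow> nat"
        proof
          fix x show "\<alpha> x = 0" using all_k0[of x] that by simp
        qed
        then have "{\<alpha> :: 'n \<Rightarrow> nat. \<alpha> k0 = 0} \<subseteq> {\<lambda>_. 0}" by blast
        then show ?thesis using finite_subset by (intro summable_on_finite) blast
      next
        case False
        have "(\<lambda>\<alpha>. a (sum \<alpha> UNIV) powr q) summable_on {\<alpha> :: 'n \<Rightarrow> nat. \<alpha> k0 = 0}"
          by (rule summable_on_subset[OF A[OF False]]) simp
        then show ?thesis
          by (rule summable_on_cong[THEN iffD1, rotated]) (simp add: split_eigenvalue_simps)
      qed
      have "S k0 \<union> {\<alpha>. \<alpha> k0 = 0} = UNIV" by (auto simp: S_def)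
      with summable_on_union[OF 1 2] True show ?thesis by simp
    next
      case False
      then have "UNIV \<noteq> {k0}" by auto
      then have "CARD('n) \<noteq> 1" by (metis UNIV_I card_1_singletonE singletonD)
      then show ?thesis using A False by (simp add: split_eigenvalue_simps)
    qed
    then have "?E summable_on (\<Union>j\<in>UNIV. (\<lambda>\<alpha>. (\<alpha>, j)) ` UNIV)"
      by (intro summable_on_finite_UN) (simp_all add: column)
    also have "(\<Union>j\<in>UNIV. (\<lambda>\<alpha>. (\<alpha>, j)) ` UNIV) = (UNIV :: (('n \<Rightarrow> nat) \<times> 'n) set)" by auto
    finally show "?E summable_on UNIV" .
  qed
qed

section \<open>Diagonalizing rank-one perturbations blockwise\<close>

lemma linear_op_ip_sum:
  assumes "semi_inner H" "semi_inner K" and T: "linear_op H K T"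
    and "finite F" and f: "\<And>i. i \<in> F \<Longrightarrow> f i \<in> vecs H" and v: "v \<in> vecs K"
  shows "ip K (T (\<Sum>i\<in>F. scl H (c i) (f i))) v = (\<Sum>i\<in>F. c i * ip K (T (f i)) v)"
proof -
  interpret H: semi_inner H by fact
  interpret K: semi_inner K by fact
  have mem: "T x \<in> vecs K" if "x \<in> vecs H" for x
    using T that by (simp add: linear_op_def)
  have add: "ip K (T (x + y)) v = ip K (T x) v + ip K (T y) v" if "x \<in> vecs H" "y \<in> vecs H" for x y
  proof -
    have "heq K (T (x + y)) (T x + T y)"
      using T that by (simp add: linear_op_def)
    then have "ip K (T (x + y)) v = ip K (T x + T y) v"
      using v that by (subst (asm) K.heq_iff_ip) (auto simp: mem)
    then show ?thesis using that v by (simp add: K.ip_add_left mem)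
  qed
  have scale: "ip K (T (scl H c x)) v = c * ip K (T x) v" if "x \<in> vecs H" for c x
  proof -
    have "heq K (T (scl H c x)) (scl K c (T x))"
      using T that by (simp add: linear_op_def)
    then have "ip K (T (scl H c x)) v = ip K (scl K c (T x)) v"
      using v that by (subst (asm) K.heq_iff_ip) (auto simp: mem)
    then show ?thesis using that v by (simp add: mem)
  qed
  have zero: "ip K (T 0) v = 0"
    using add[of 0 0] by simp
  show ?thesis
    using \<open>finite F\<close> f by (induction F rule: finite_induct) (simp_all add: zero add scale)
qed

text \<open>
  The vector that spans the rank-one part of the Gram matrix of the block \<open>\<gamma>\<close>.
\<close>

definition weight :: "('n::finite \<Rightarrow> nat) \<Rightarrow> real ^ 'n" where
  "weight \<gamma> = (\<chi> k. sqrt (real (\<gamma> k) + 1))"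

text \<open>
  A choice of an orthonormal eigenbasis of the block \<open>\<gamma>\<close>: the column \<open>k0\<close> is the normalized
  \<open>weight\<close>, the other columns are orthogonal to it.
\<close>

definition rotation :: "'n::finite \<Rightarrow> ('n \<Rightarrow> nat) \<Rightarrow> real ^ 'n ^ 'n" where
  "rotation k0 \<gamma> = (SOME Q. orthogonal_matrix Q \<and> Q *v axis k0 1 = weight \<gamma> /\<^sub>R norm (weight \<gamma>))"

lemma norm_weight_sq: "(norm (weight \<gamma>))\<^sup>2 = real (sum \<gamma> UNIV + CARD('n))" for \<gamma> :: "'n::finite \<Rightarrow> nat"
  by (simp add: norm_vec_def L2_set_def weight_def sum_nonneg sum.distrib add_nonneg_nonneg)

lemma norm_weight_pos: "0 < norm (weight \<gamma>)" for \<gamma> :: "'n::finite \<Rightarrow> nat"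
proof -
  have "0 < (norm (weight \<gamma>))\<^sup>2"
    unfolding norm_weight_sq by (simp only: of_nat_0_less_iff) simp
  then show ?thesis by simp
qed

lemma rotation:
  shows "orthogonal_matrix (rotation k0 \<gamma>)"
    and "rotation k0 \<gamma> *v axis k0 1 = weight \<gamma> /\<^sub>R norm (weight \<gamma>)"
proof -
  have "norm (weight \<gamma> /\<^sub>R norm (weight \<gamma>)) = 1"
    using norm_weight_pos[of \<gamma>] by simp
  then obtain Q where "orthogonal_matrix Q" "Q *v axis k0 1 = weight \<gamma> /\<^sub>R norm (weight \<gamma>)"
    using orthogonal_matrix_exists_basis by blast
  then have "\<exists>Q. orthogonal_matrix Q \<and> Q *v axis k0 1 = weight \<gamma> /\<^sub>R norm (weight \<gamma>)" by blast
  from someI_ex[OF this] show "orthogonal_matrix (rotation k0 \<gamma>)"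
    and "rotation k0 \<gamma> *v axis k0 1 = weight \<gamma> /\<^sub>R norm (weight \<gamma>)"
    unfolding rotation_def by auto
qed

lemma rotation_columns:
  "(\<Sum>l\<in>UNIV. rotation k0 \<gamma> $ l $ j * rotation k0 \<gamma> $ l $ k) = (if j = k then 1 else 0)"
proof -
  have "(transpose (rotation k0 \<gamma>) ** rotation k0 \<gamma>) $ j $ k = mat 1 $ j $ k"
    using rotation(1)[of k0 \<gamma>] by (simp add: orthogonal_matrix_def)
  then show ?thesis
    by (simp add: matrix_matrix_mult_def transpose_def mat_def)
qed

lemma rotation_rows:
  "(\<Sum>j\<in>UNIV. rotation k0 \<gamma> $ k $ j * rotation k0 \<gamma> $ l $ j) = (if k = l then 1 else 0)"
proof -
  have "(rotation k0 \<gamma> ** transpose (rotation k0 \<gamma>)) $ k $ l = mat 1 $ k $ l"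
    using rotation(1)[of k0 \<gamma>] by (simp add: orthogonal_matrix_def)
  then show ?thesis
    by (simp add: matrix_matrix_mult_def transpose_def mat_def)
qed

lemma rotation_weight:
  "(\<Sum>l\<in>UNIV. rotation k0 \<gamma> $ l $ j * weight \<gamma> $ l) = (if j = k0 then norm (weight \<gamma>) else 0)"
proof -
  have col: "weight \<gamma> $ l = norm (weight \<gamma>) * rotation k0 \<gamma> $ l $ k0" for l
  proof -
    have "(rotation k0 \<gamma> *v axis k0 1) $ l = rotation k0 \<gamma> $ l $ k0"
      by (simp add: matrix_vector_mult_basis column_def)
    then show ?thesis
      using norm_weight_pos[of \<gamma>] by (simp add: rotation(2) field_simps)
  qed
  have "(\<Sum>l\<in>UNIV. rotation k0 \<gamma> $ l $ j * weight \<gamma> $ l)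
      = norm (weight \<gamma>) * (\<Sum>l\<in>UNIV. rotation k0 \<gamma> $ l $ j * rotation k0 \<gamma> $ l $ k0)"
    by (subst col) (simp add: sum_distrib_left mult_ac)
  then show ?thesis by (simp add: rotation_columns)
qed

text \<open>
  Invertibility of the transposed matrix, applied to complex coefficients.
\<close>

lemma rotation_cancel:
  fixes c :: "'n::finite \<Rightarrow> complex"
  assumes "\<And>j. (\<Sum>k\<in>UNIV. complex_of_real (rotation k0 \<gamma> $ k $ j) * c k) = 0"
  shows "c l = 0"
proof -
  have "0 = (\<Sum>j\<in>UNIV. complex_of_real (rotation k0 \<gamma> $ l $ j) * (\<Sum>k\<in>UNIV. complex_of_real (rotation k0 \<gamma> $ k $ j) * c k))"
    by (simp add: assms)
  also have "\<dots> = (\<Sum>j\<in>UNIV. \<Sum>k\<in>UNIV. complex_of_real (rotation k0 \<gamma> $ l $ j * rotation k0 \<gamma> $ k $ j) * c k)"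
    by (simp add: sum_distrib_left mult.assoc)
  also have "\<dots> = (\<Sum>k\<in>UNIV. complex_of_real (\<Sum>j\<in>UNIV. rotation k0 \<gamma> $ l $ j * rotation k0 \<gamma> $ k $ j) * c k)"
    by (subst sum.swap) (simp add: sum_distrib_right)
  also have "\<dots> = c l"
    by (simp add: rotation_rows if_distrib[of complex_of_real] if_distrib[of "\<lambda>x. x * _"] cong: if_cong)
  finally show ?thesis by simp
qed

text \<open>
  The family \<open>f\<close> expressed in the eigenbases of the blocks. Indexing the new family by pairs as the old
  one requires to recover the block of \<open>(\<alpha>, j)\<close> by lowering \<open>\<alpha>\<close> at \<open>j\<close>.
\<close>

definition block_rotate :: "'n::finite \<Rightarrow> 'v::ab_group_add hspace \<Rightarrow> (('n \<Rightarrow> nat) \<Rightarrow> 'n \<Rightarrow> 'v) \<Rightarrow> ('n \<Rightarrow> nat) \<times> 'n \<Rightarrow> 'v" where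
  "block_rotate k0 H f = (\<lambda>(\<alpha>, j). if \<alpha> j = 0 then f \<alpha> j
     else \<Sum>k\<in>UNIV. scl H (complex_of_real (rotation k0 (\<alpha>(j := \<alpha> j - 1)) $ k $ j)) (f (up (\<alpha>(j := \<alpha> j - 1)) k) k))"

lemma block_rotate_single: "\<alpha> j = 0 \<Longrightarrow> block_rotate k0 H f (\<alpha>, j) = f \<alpha> j"
  by (simp add: block_rotate_def)

lemma block_rotate_up:
  "block_rotate k0 H f (up \<gamma> j, j) = (\<Sum>k\<in>UNIV. scl H (complex_of_real (rotation k0 \<gamma> $ k $ j)) (f (up \<gamma> k) k))"
proof -
  have "(up \<gamma> j)(j := (up \<gamma> j) j - 1) = \<gamma>" by auto
  then show ?thesis by (simp add: block_rotate_def)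
qed

lemma multi_index_cases:
  obtains (single) "\<alpha> j = 0" | (up) \<gamma> where "\<alpha> = up \<gamma> j"
proof (cases "\<alpha> j")
  case (Suc m)
  then have "\<alpha> = up (\<alpha>(j := m)) j" by auto
  then show ?thesis by (rule up)
qed

context semi_inner
begin

lemma block_rotate_mem:
  assumes "\<And>\<alpha> j. f \<alpha> j \<in> vecs H"
  shows "block_rotate k0 H f x \<in> vecs H"
  using assms by (auto simp: block_rotate_def split: prod.split)

text \<open>
  Within a block, the columns of the orthogonal matrix are eigenvectors of \<open>a I + s v v\<^sup>T\<close> with
  \<open>v\<close> the \<open>weight\<close>: the column \<open>k0\<close> is parallel to \<open>v\<close> and has the eigenvalue \<open>a + s \<parallel>v\<parallel>\<^sup>2\<close>. With
  \<open>a = 1\<close> and \<open>s = 0\<close> this covers orthonormal families.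
\<close>

lemma ip_block_rotate:
  fixes f :: "('n::finite \<Rightarrow> nat) \<Rightarrow> 'n \<Rightarrow> 'v"
  assumes f: "\<And>\<alpha> j. f \<alpha> j \<in> vecs H"
    and other: "\<And>\<alpha> \<beta> j k. up \<alpha> k \<noteq> up \<beta> j \<Longrightarrow> ip H (f \<alpha> j) (f \<beta> k) = 0"
    and single: "\<And>\<alpha> j. \<alpha> j = 0 \<Longrightarrow> ip H (f \<alpha> j) (f \<alpha> j) = complex_of_real (a (sum \<alpha> UNIV))"
    and block: "\<And>\<gamma> j k. ip H (f (up \<gamma> j) j) (f (up \<gamma> k) k)
      = complex_of_real ((if j = k then a (Suc (sum \<gamma> UNIV)) else 0) + s (Suc (sum \<gamma> UNIV)) * weight \<gamma> $ j * weight \<gamma> $ k)"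
  shows "ip H (block_rotate k0 H f x) (block_rotate k0 H f y) = (if x = y then complex_of_real
    (split_eigenvalue a (\<lambda>d. a d + s d * real (d - 1 + CARD('n))) k0 x) else 0)"
proof -
  let ?r = "block_rotate k0 H f" and ?Q = "rotation k0"
  have single_up: "ip H (?r (\<alpha>, j)) (?r (up \<gamma> k, k)) = 0" if "\<alpha> j = 0" for \<alpha> \<gamma> j k
  proof -
    have "up \<alpha> l \<noteq> up (up \<gamma> l) j" for l
    proof
      assume "up \<alpha> l = up (up \<gamma> l) j"
      then have "up \<alpha> l j = up (up \<gamma> l) j j" by simp
      then show False using that by (auto split: if_splits)
    qed
    then have "ip H (f \<alpha> j) (f (up \<gamma> l) l) = 0" for l by (rule other)
    then show ?thesis
      using that f by (simp add: block_rotate_single block_rotate_up ip_sum_right)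
  qed
  obtain \<alpha> j \<beta> k where xy: "x = (\<alpha>, j)" "y = (\<beta>, k)" by (cases x, cases y)
  show ?thesis
  proof (cases \<alpha> j rule: multi_index_cases)
    case single_x: single
    show ?thesis
    proof (cases \<beta> k rule: multi_index_cases)
      case single_y: single
      show ?thesis
      proof (cases "x = y")
        case True
        then show ?thesis
          using single_x xy single by (simp add: block_rotate_single split_eigenvalue_def)
      next
        case False
        have "up \<alpha> k \<noteq> up \<beta> j"
        proof
          assume eq: "up \<alpha> k = up \<beta> j"
          then have "up \<alpha> k j = up \<beta> j j" by simp
          then have "j = k" using single_x by (auto split: if_splits)
          with eq single_x single_y have "\<alpha> = \<beta>"
            by (metis fun_upd_triv fun_upd_upd)
          with \<open>j = k\<close> False xy show False by simp
        qed
        then show ?thesis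
          using False single_x single_y xy by (auto simp: block_rotate_single other)
      qed
    next
      case (up \<gamma>)
      then have "x \<noteq> y" using xy single_x by auto
      then show ?thesis
        using single_up[of \<alpha> j \<gamma> k] single_x up xy by auto
    qed
  next
    case up_x: (up \<gamma>)
    show ?thesis
    proof (cases \<beta> k rule: multi_index_cases)
      case single_y: single
      then have "x \<noteq> y" using xy up_x by auto
      moreover have "ip H (?r (up \<gamma> j, j)) (?r (\<beta>, k)) = cnj (ip H (?r (\<beta>, k)) (?r (up \<gamma> j, j)))"
        using f by (simp add: ip_cnj block_rotate_mem)
      ultimately show ?thesis
        using single_up[of \<beta> k \<gamma> j] single_y up_x xy by auto
    next
      case up_y: (up \<delta>)
      have expand: "ip H (?r x) (?r y) = (\<Sum>l\<in>UNIV. complex_of_real (?Q \<gamma> $ l $ j) *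
          (\<Sum>m\<in>UNIV. complex_of_real (?Q \<delta> $ m $ k) * ip H (f (up \<gamma> l) l) (f (up \<delta> m) m)))"
        unfolding xy up_x up_y block_rotate_up using f by (subst ip_sum_left) (simp_all add: ip_sum_right sum_distrib_left mult_ac)
      show ?thesis
      proof (cases "\<gamma> = \<delta>")
        case False
        have "up (up \<gamma> l) m \<noteq> up (up \<delta> m) l" for l m
        proof
          assume eq: "up (up \<gamma> l) m = up (up \<delta> m) l"
          have "\<gamma> i = \<delta> i" for i
            using fun_cong[OF eq, of i] by (auto split: if_splits)
          with False show False by auto
        qed
        then have "ip H (f (up \<gamma> l) l) (f (up \<delta> m) m) = 0" for l m by (rule other)
        moreover have "x \<noteq> y"
          using False xy up_x up_y by (metis Pair_inject diff_Suc_1 fun_upd_same fun_upd_triv fun_upd_upd)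
        ultimately show ?thesis by (simp add: expand)
      next
        case True
        define d where "d = Suc (sum \<gamma> UNIV)"
        let ?w = "\<lambda>l. weight \<gamma> $ l"
        have "ip H (?r x) (?r y) = complex_of_real (\<Sum>l\<in>UNIV. ?Q \<gamma> $ l $ j *
            (\<Sum>m\<in>UNIV. ?Q \<gamma> $ m $ k * ((if l = m then a d else 0) + s d * ?w l * ?w m)))"
          unfolding expand True[symmetric] block d_def by simp
        also have "(\<Sum>l\<in>UNIV. ?Q \<gamma> $ l $ j *
            (\<Sum>m\<in>UNIV. ?Q \<gamma> $ m $ k * ((if l = m then a d else 0) + s d * ?w l * ?w m)))
          = (\<Sum>l\<in>UNIV. ?Q \<gamma> $ l $ j * (\<Sum>m\<in>UNIV. if l = m then ?Q \<gamma> $ m $ k * a d else 0))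
            + (\<Sum>l\<in>UNIV. ?Q \<gamma> $ l $ j * (\<Sum>m\<in>UNIV. ?Q \<gamma> $ m $ k * (s d * ?w l * ?w m)))"
          by (simp add: distrib_left sum.distrib if_distrib[of "\<lambda>x. _ * x"] cong: if_cong)
        also have "(\<Sum>l\<in>UNIV. ?Q \<gamma> $ l $ j * (\<Sum>m\<in>UNIV. if l = m then ?Q \<gamma> $ m $ k * a d else 0))
          = a d * (\<Sum>l\<in>UNIV. ?Q \<gamma> $ l $ j * ?Q \<gamma> $ l $ k)"
          by (simp add: sum_distrib_left mult_ac)
        also have "(\<Sum>l\<in>UNIV. ?Q \<gamma> $ l $ j * (\<Sum>m\<in>UNIV. ?Q \<gamma> $ m $ k * (s d * ?w l * ?w m)))
          = s d * ((\<Sum>l\<in>UNIV. ?Q \<gamma> $ l $ j * ?w l) * (\<Sum>m\<in>UNIV. ?Q \<gamma> $ m $ k * ?w m))"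
          unfolding sum_product by (simp add: sum_distrib_left mult_ac)
        also have "a d * (\<Sum>l\<in>UNIV. ?Q \<gamma> $ l $ j * ?Q \<gamma> $ l $ k) + \<dots>
          = (if j = k then a d + (if j = k0 then s d * (norm (weight \<gamma>))\<^sup>2 else 0) else 0)"
          unfolding rotation_columns rotation_weight by (simp add: power2_eq_square)
        finally have "ip H (?r x) (?r y)
          = complex_of_real (if j = k then a d + (if j = k0 then s d * (norm (weight \<gamma>))\<^sup>2 else 0) else 0)" .
        moreover have "x = y \<longleftrightarrow> j = k"
          using True xy up_x up_y by (metis Pair_inject fun_upd_same fun_upd_triv n_not_Suc_n fun_upd_other)
        moreover have "split_eigenvalue a (\<lambda>d. a d + s d * real (d - 1 + CARD('n))) k0 x
            = a d + (if j = k0 then s d * (norm (weight \<gamma>))\<^sup>2 else 0)"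
        proof -
          have "(up \<gamma> j) j \<noteq> 0" "d - 1 = sum \<gamma> UNIV" by (simp_all add: d_def)
          then show ?thesis
            unfolding xy up_x split_eigenvalue_def prod.case sum_up d_def[symmetric] norm_weight_sq by simp
        qed
        ultimately show ?thesis by simp
      qed
    qed
  qed
qed

lemma block_rotate_total:
  assumes f: "\<And>\<alpha> j. f \<alpha> j \<in> vecs H" and x: "x \<in> vecs H"
    and orth: "\<And>y. ip H x (block_rotate k0 H f y) = 0"
  shows "ip H x (f \<alpha> j) = 0"
proof (cases \<alpha> j rule: multi_index_cases)
  case single
  then show ?thesis using orth[of "(\<alpha>, j)"] by (simp add: block_rotate_single)
next
  case (up \<gamma>)
  have "ip H x (f (up \<gamma> j) j) = 0"
  proof (rule rotation_cancel)
    show "(\<Sum>k\<in>UNIV. complex_of_real (rotation k0 \<gamma> $ k $ i) * ip H x (f (up \<gamma> k) k)) = 0" for i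
      using orth[of "(up \<gamma> i, i)"] f x by (simp add: block_rotate_up ip_sum_right)
  qed
  then show ?thesis using up by simp
qed

end

text \<open>
  A linear operator commutes with the change of basis, and the change of basis is invertible.
\<close>

lemma block_rotate_image_iff:
  fixes f :: "('n::finite \<Rightarrow> nat) \<Rightarrow> 'n \<Rightarrow> 'v::ab_group_add" and g :: "('n \<Rightarrow> nat) \<Rightarrow> 'n \<Rightarrow> 'w::ab_group_add"
  assumes H: "semi_inner H" and K: "semi_inner K" and T: "linear_op H K T"
    and f: "\<And>\<alpha> j. f \<alpha> j \<in> vecs H" and g: "\<And>\<alpha> j. g \<alpha> j \<in> vecs K"
  shows "(\<forall>x. heq K (T (block_rotate k0 H f x)) (block_rotate k0 K g x)) \<longleftrightarrow> (\<forall>\<alpha> j. heq K (T (f \<alpha> j)) (g \<alpha> j))"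
proof -
  interpret H: semi_inner H by fact
  interpret K: semi_inner K by fact
  have T_mem: "T x \<in> vecs K" if "x \<in> vecs H" for x
    using T that by (simp add: linear_op_def)
  have up_diff: "ip K (T (block_rotate k0 H f (up \<gamma> i, i))) v - ip K (block_rotate k0 K g (up \<gamma> i, i)) v
      = (\<Sum>k\<in>UNIV. complex_of_real (rotation k0 \<gamma> $ k $ i) * (ip K (T (f (up \<gamma> k) k)) v - ip K (g (up \<gamma> k) k) v))"
    if v: "v \<in> vecs K" for v \<gamma> i
    unfolding block_rotate_up using f g v
    by (simp add: linear_op_ip_sum[OF H K T] K.ip_sum_left right_diff_distrib sum_subtractf)
  have iff_diff: "heq K x y \<longleftrightarrow> (\<forall>v\<in>vecs K. ip K x v - ip K y v = 0)" if "x \<in> vecs K" "y \<in> vecs K" for x y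
    using that by (simp add: K.heq_iff_ip)
  show ?thesis
  proof
    assume L: "\<forall>x. heq K (T (block_rotate k0 H f x)) (block_rotate k0 K g x)"
    have "heq K (T (f \<alpha> j)) (g \<alpha> j)" for \<alpha> j
    proof (cases \<alpha> j rule: multi_index_cases)
      case single
      then show ?thesis using L[rule_format, of "(\<alpha>, j)"] by (simp add: block_rotate_single)
    next
      case (up \<gamma>)
      have "ip K (T (f (up \<gamma> j) j)) v - ip K (g (up \<gamma> j) j) v = 0" if v: "v \<in> vecs K" for v
      proof (rule rotation_cancel)
        show "(\<Sum>k\<in>UNIV. complex_of_real (rotation k0 \<gamma> $ k $ i) * (ip K (T (f (up \<gamma> k) k)) v - ip K (g (up \<gamma> k) k) v)) = 0" for i
          unfolding up_diff[OF v, symmetric]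
          using L[rule_format, of "(up \<gamma> i, i)"] v f g
          by (subst (asm) iff_diff) (auto simp: T_mem H.block_rotate_mem K.block_rotate_mem)
      qed
      then show ?thesis unfolding up using f g by (subst iff_diff) (auto simp: T_mem)
    qed
    then show "\<forall>\<alpha> j. heq K (T (f \<alpha> j)) (g \<alpha> j)" by blast
  next
    assume R: "\<forall>\<alpha> j. heq K (T (f \<alpha> j)) (g \<alpha> j)"
    then have R': "ip K (T (f \<alpha> j)) v - ip K (g \<alpha> j) v = 0" if "v \<in> vecs K" for \<alpha> j v
      using that f g by (metis T_mem iff_diff)
    have "heq K (T (block_rotate k0 H f (\<alpha>, j))) (block_rotate k0 K g (\<alpha>, j))" for \<alpha> j
    proof (cases \<alpha> j rule: multi_index_cases)
      case single
      then show ?thesis using R by (simp add: block_rotate_single)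
    next
      case (up \<gamma>)
      have "\<forall>v\<in>vecs K. ip K (T (block_rotate k0 H f (up \<gamma> j, j))) v - ip K (block_rotate k0 K g (up \<gamma> j, j)) v = 0"
        using R' by (simp add: up_diff)
      then show ?thesis
        unfolding up using f g by (subst iff_diff) (auto simp: T_mem H.block_rotate_mem K.block_rotate_mem)
    qed
    then show "\<forall>x. heq K (T (block_rotate k0 H f x)) (block_rotate k0 K g x)" by auto
  qed
qed

section \<open>The canonical solutions of the monomial forms\<close>

context radial_measure
begin

definition raw_solution :: "('n \<Rightarrow> nat) \<Rightarrow> 'n \<Rightarrow> complex ^ 'n \<Rightarrow> complex" where
  "raw_solution \<alpha> j = (\<lambda>z. cnj (z $ j) * monomial \<alpha> z)"

text \<open>
  The orthogonal projection of \<open>raw_solution \<alpha> j\<close> to \<open>A2 M\<close>: among the monomials, only the one with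
  the exponent \<open>\<alpha>\<close> lowered at \<open>j\<close> is not orthogonal to \<open>raw_solution \<alpha> j\<close>.
\<close>

definition raw_projection :: "('n \<Rightarrow> nat) \<Rightarrow> 'n \<Rightarrow> complex ^ 'n \<Rightarrow> complex" where
  "raw_projection \<alpha> j = (if \<alpha> j = 0 then 0 else
     scl (L2 M) (complex_of_real (mono_sq \<alpha> / mono_sq (\<alpha>(j := \<alpha> j - 1)))) (monomial (\<alpha>(j := \<alpha> j - 1))))"

definition solution :: "('n \<Rightarrow> nat) \<Rightarrow> 'n \<Rightarrow> complex ^ 'n \<Rightarrow> complex" where
  "solution \<alpha> j = raw_solution \<alpha> j - raw_projection \<alpha> j"

lemma raw_projection_single: "\<alpha> j = 0 \<Longrightarrow> raw_projection \<alpha> j = 0"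
  by (simp add: raw_projection_def)

lemma raw_projection_up:
  "raw_projection (up \<gamma> j) j = scl (L2 M) (complex_of_real (mono_sq (up \<gamma> j) / mono_sq \<gamma>)) (monomial \<gamma>)"
proof -
  have "(up \<gamma> j)(j := (up \<gamma> j) j - 1) = \<gamma>" by auto
  then show ?thesis by (simp add: raw_projection_def)
qed

lemma mono_sq_pos: "0 < mono_sq \<alpha>"
  by (simp add: mono_sq_eq kappa_pos mfact_pos)

lemma raw_solution_L2 [simp]: "raw_solution \<alpha> j \<in> vecs (L2 M)"
proof -
  have "(cmod (raw_solution \<alpha> j z))\<^sup>2 = (cmod (monomial (up \<alpha> j) z))\<^sup>2" for z
    by (simp add: raw_solution_def monomial_up norm_mult)
  moreover have "raw_solution \<alpha> j \<in> borel_measurable M"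
    unfolding raw_solution_def monomial_def by (intro measurable_continuous continuous_intros)
  ultimately show ?thesis
    using monomial_L2[of "up \<alpha> j"] by (simp add: mem_L2)
qed

lemma raw_projection_A2 [simp]: "raw_projection \<alpha> j \<in> A2 M"
proof (cases "\<alpha> j = 0")
  case True
  then show ?thesis
    using zero_polynomials polynomials_A2 by (auto simp: raw_projection_single)
next
  case False
  then show ?thesis
    unfolding raw_projection_def L2_simps if_not_P[OF False] by (intro A2_scale monomial_A2)
qed

lemma raw_projection_L2 [simp]: "raw_projection \<alpha> j \<in> vecs (L2 M)"
  by (intro A2_L2 raw_projection_A2)

lemma solution_L2 [simp]: "solution \<alpha> j \<in> vecs (L2 M)"
  unfolding solution_def by (intro L.diff_mem) simp_all

lemma ip_raw_solution_monomial:
  "ip (L2 M) (raw_solution \<alpha> j) (monomial \<beta>) = (if \<alpha> = up \<beta> j then complex_of_real (mono_sq \<alpha>) else 0)"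
proof -
  have "ip (L2 M) (raw_solution \<alpha> j) (monomial \<beta>) = ip (L2 M) (monomial \<alpha>) (monomial (up \<beta> j))"
    by (simp add: raw_solution_def monomial_up mult_ac)
  then show ?thesis by (simp only: ip_monomial)
qed

lemma ip_raw_solutions:
  "ip (L2 M) (raw_solution \<alpha> j) (raw_solution \<beta> k)
    = (if up \<alpha> k = up \<beta> j then complex_of_real (mono_sq (up \<alpha> k)) else 0)"
proof -
  have "ip (L2 M) (raw_solution \<alpha> j) (raw_solution \<beta> k) = ip (L2 M) (monomial (up \<alpha> k)) (monomial (up \<beta> j))"
    by (simp add: raw_solution_def monomial_up mult_ac)
  then show ?thesis by (simp only: ip_monomial)
qed

lemma ip_projection_raw_solution:
  "ip (L2 M) (raw_projection \<alpha> j) (raw_solution \<beta> k)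
    = (if \<alpha> j \<noteq> 0 \<and> \<beta> = up (\<alpha>(j := \<alpha> j - 1)) k
       then complex_of_real (mono_sq \<alpha> * mono_sq \<beta> / mono_sq (\<alpha>(j := \<alpha> j - 1))) else 0)"
proof -
  have "ip (L2 M) (monomial \<gamma>) (raw_solution \<beta> k) = cnj (ip (L2 M) (raw_solution \<beta> k) (monomial \<gamma>))" for \<gamma>
    by (rule L.ip_cnj[symmetric]) simp_all
  then have "ip (L2 M) (monomial \<gamma>) (raw_solution \<beta> k) = (if \<beta> = up \<gamma> k then complex_of_real (mono_sq \<beta>) else 0)" for \<gamma>
    by (simp add: ip_raw_solution_monomial del: L2_simps)
  note monomial = this
  show ?thesis
  proof (cases "\<alpha> j = 0")
    case True
    then show ?thesis by (simp add: raw_projection_single del: L2_simps)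
  next
    case False
    define \<gamma> where "\<gamma> = \<alpha>(j := \<alpha> j - 1)"
    have "raw_projection \<alpha> j = scl (L2 M) (complex_of_real (mono_sq \<alpha> / mono_sq \<gamma>)) (monomial \<gamma>)"
      unfolding raw_projection_def \<gamma>_def using False by (rule if_not_P)
    then have "ip (L2 M) (raw_projection \<alpha> j) (raw_solution \<beta> k)
        = complex_of_real (mono_sq \<alpha> / mono_sq \<gamma>) * (if \<beta> = up \<gamma> k then complex_of_real (mono_sq \<beta>) else 0)"
      by (simp only: L.ip_scl_left monomial_L2 raw_solution_L2 monomial)
    also have "\<dots> = (if \<alpha> j \<noteq> 0 \<and> \<beta> = up \<gamma> k then complex_of_real (mono_sq \<alpha> * mono_sq \<beta> / mono_sq \<gamma>) else 0)"
      using False by (cases "\<beta> = up \<gamma> k") (simp_all only: simp_thms if_True if_False mult_zero_right, simp)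
    finally show ?thesis unfolding \<gamma>_def .
  qed
qed

lemma solution_orthogonal_A2:
  assumes "g \<in> A2 M"
  shows "ip (L2 M) (solution \<alpha> j) g = 0"
proof (rule orthogonal_A2[OF solution_L2 _ assms])
  fix \<beta>
  have "ip (L2 M) (solution \<alpha> j) (monomial \<beta>)
      = ip (L2 M) (raw_solution \<alpha> j) (monomial \<beta>) - ip (L2 M) (raw_projection \<alpha> j) (monomial \<beta>)"
    unfolding solution_def by (rule L.ip_diff_left) simp_all
  also have "\<dots> = 0"
  proof (cases \<alpha> j rule: multi_index_cases)
    case single
    then have "\<alpha> \<noteq> up \<beta> j" by auto
    then show ?thesis
      using single by (simp add: ip_raw_solution_monomial raw_projection_single del: L2_simps)
  next
    case (up \<gamma>)
    have "up \<gamma> j = up \<beta> j \<longleftrightarrow> \<gamma> = \<beta>"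
      by (auto simp: fun_eq_iff split: if_splits)
    moreover have "mono_sq \<beta> \<noteq> 0" using mono_sq_pos[of \<beta>] by simp
    ultimately show ?thesis
      by (simp add: up ip_raw_solution_monomial raw_projection_up ip_monomial del: L2_simps)
  qed
  finally show "ip (L2 M) (solution \<alpha> j) (monomial \<beta>) = 0" .
qed

text \<open>
  The solution on the right may be replaced by \<open>raw_solution \<beta> k\<close>, as the difference lies in \<open>A2 M\<close>.
\<close>

lemma ip_solutions:
  "ip (L2 M) (solution \<alpha> j) (solution \<beta> k)
    = ip (L2 M) (raw_solution \<alpha> j) (raw_solution \<beta> k) - ip (L2 M) (raw_projection \<alpha> j) (raw_solution \<beta> k)"
proof -
  have "ip (L2 M) (solution \<alpha> j) (solution \<beta> k)
      = ip (L2 M) (solution \<alpha> j) (raw_solution \<beta> k) - ip (L2 M) (solution \<alpha> j) (raw_projection \<beta> k)"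
    unfolding solution_def[of \<beta> k] by (rule L.ip_diff_right) simp_all
  also have "\<dots> = ip (L2 M) (solution \<alpha> j) (raw_solution \<beta> k)"
    by (simp add: solution_orthogonal_A2 del: L2_simps)
  also have "\<dots> = ip (L2 M) (raw_solution \<alpha> j) (raw_solution \<beta> k) - ip (L2 M) (raw_projection \<alpha> j) (raw_solution \<beta> k)"
    unfolding solution_def by (rule L.ip_diff_left) simp_all
  finally show ?thesis .
qed

definition unit_form :: "('n \<Rightarrow> nat) \<Rightarrow> 'n \<Rightarrow> 'n \<Rightarrow> complex ^ 'n \<Rightarrow> complex" where
  "unit_form \<alpha> j = scl (A2_01 M) (complex_of_real (1 / sqrt (mono_sq \<alpha>))) (monomial_form \<alpha> j)"

definition unit_solution :: "('n \<Rightarrow> nat) \<Rightarrow> 'n \<Rightarrow> complex ^ 'n \<Rightarrow> complex" where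
  "unit_solution \<alpha> j = scl (L2 M) (complex_of_real (1 / sqrt (mono_sq \<alpha>))) (solution \<alpha> j)"

lemma monomial_form_mem [simp]: "monomial_form \<alpha> j \<in> vecs (A2_01 M)"
  using zero_polynomials polynomials_A2 by (auto simp: monomial_form_def)

lemma unit_form_mem [simp]: "unit_form \<alpha> j \<in> vecs (A2_01 M)"
  unfolding unit_form_def by (intro F.scl_mem monomial_form_mem)

lemma unit_solution_mem [simp]: "unit_solution \<alpha> j \<in> vecs (L2 M)"
  unfolding unit_solution_def by (intro L.scl_mem solution_L2)

lemma ip_monomial_form:
  assumes "\<And>j. \<omega> j \<in> A2 M"
  shows "ip (A2_01 M) \<omega> (monomial_form \<alpha> j) = ip (L2 M) (\<omega> j) (monomial \<alpha>)"
proof -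
  have "ip (A2_01 M) \<omega> (monomial_form \<alpha> j) = (\<Sum>k\<in>UNIV. if k = j then ip (L2 M) (\<omega> k) (monomial \<alpha>) else 0)"
    unfolding A2_01_simps by (intro sum.cong) (auto simp: monomial_form_def)
  then show ?thesis by simp
qed

lemma ip_unit_forms:
  "ip (A2_01 M) (unit_form \<alpha> j) (unit_form \<beta> k) = (if \<alpha> = \<beta> \<and> j = k then 1 else 0)"
proof -
  have mem: "monomial_form \<alpha> j i \<in> A2 M" for i using monomial_form_mem[of \<alpha> j] by simp
  have "ip (A2_01 M) (monomial_form \<alpha> j) (monomial_form \<beta> k) = (if \<alpha> = \<beta> \<and> j = k then complex_of_real (mono_sq \<alpha>) else 0)"
    unfolding ip_monomial_form[OF mem]
    by (cases "j = k") (simp_all add: monomial_form_def ip_monomial del: L2_simps)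
  moreover have "complex_of_real (sqrt (mono_sq \<beta>)) * complex_of_real (sqrt (mono_sq \<beta>)) = complex_of_real (mono_sq \<beta>)"
    using mono_sq_pos[of \<beta>] by (simp flip: of_real_mult)
  ultimately show ?thesis
    using mono_sq_pos[of \<beta>] by (auto simp: unit_form_def simp del: A2_01_simps)
qed

definition kappa_ratio :: "nat \<Rightarrow> real" where
  "kappa_ratio d = kappa (Suc d) / kappa d"

lemma ip_unit_solutions:
  "ip (L2 M) (unit_solution \<alpha> j) (unit_solution \<beta> k)
    = complex_of_real (1 / sqrt (mono_sq \<alpha> * mono_sq \<beta>)) * ip (L2 M) (solution \<alpha> j) (solution \<beta> k)"
  unfolding unit_solution_def
  by (simp add: real_sqrt_mult del: L2_simps)

lemma unit_solutions_other_block: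
  assumes "up \<alpha> k \<noteq> up \<beta> j"
  shows "ip (L2 M) (unit_solution \<alpha> j) (unit_solution \<beta> k) = 0"
proof -
  have no_projection: "\<not> (\<alpha> j \<noteq> 0 \<and> \<beta> = up (\<alpha>(j := \<alpha> j - 1)) k)"
  proof
    assume *: "\<alpha> j \<noteq> 0 \<and> \<beta> = up (\<alpha>(j := \<alpha> j - 1)) k"
    then have "up \<alpha> k = up \<beta> j" by (auto simp: fun_eq_iff)
    with assms show False by simp
  qed
  have "ip (L2 M) (solution \<alpha> j) (solution \<beta> k) = 0"
    unfolding ip_solutions ip_raw_solutions ip_projection_raw_solution if_not_P[OF assms] if_not_P[OF no_projection]
    by simp
  then show ?thesis by (simp add: ip_unit_solutions del: L2_simps)
qed

lemma unit_solutions_single: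
  assumes "\<alpha> j = 0"
  shows "ip (L2 M) (unit_solution \<alpha> j) (unit_solution \<alpha> j) = complex_of_real (kappa_ratio (sum \<alpha> UNIV))"
proof -
  have "ip (L2 M) (solution \<alpha> j) (solution \<alpha> j) = complex_of_real (mono_sq (up \<alpha> j))"
    unfolding ip_solutions ip_raw_solutions ip_projection_raw_solution using assms by simp
  moreover have "mono_sq (up \<alpha> j) = kappa_ratio (sum \<alpha> UNIV) * mono_sq \<alpha>"
    using kappa_pos[of "sum \<alpha> UNIV"] by (simp only: mono_sq_eq sum_up mfact_up kappa_ratio_def) (simp add: assms)
  ultimately show ?thesis
    using mono_sq_pos[of \<alpha>] by (simp add: ip_unit_solutions del: L2_simps)
qed

text \<open>
  With \<open>d = |\<gamma>|\<close> and \<open>mono_sq \<alpha> = kappa |\<alpha>| mfact \<alpha>\<close>, all norms are multiples of \<open>mfact \<gamma>\<close>. The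
  diagonal part comes from the second increment of the same component, which gives \<open>\<gamma> j + 2\<close> in
  place of \<open>\<gamma> j + 1\<close>.
\<close>

lemma unit_solutions_block:
  "ip (L2 M) (unit_solution (up \<gamma> j) j) (unit_solution (up \<gamma> k) k)
    = complex_of_real ((if j = k then kappa_ratio (Suc (sum \<gamma> UNIV)) else 0)
        + (kappa_ratio (Suc (sum \<gamma> UNIV)) - kappa_ratio (Suc (sum \<gamma> UNIV) - 1)) * weight \<gamma> $ j * weight \<gamma> $ k)"
proof -
  define d where "d = sum \<gamma> UNIV"
  define F where "F = mfact \<gamma>"
  define x where "x = real (\<gamma> j) + 1"
  define y where "y = real (\<gamma> k) + 1"
  have pos: "0 < F" "0 < x" "0 < y" "0 < kappa d" "0 < kappa (Suc d)"
    by (simp_all add: F_def mfact_pos x_def y_def kappa_pos)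
  have low: "(up \<gamma> j)(j := (up \<gamma> j) j - 1) = \<gamma>" by auto
  have comm: "up (up \<gamma> j) k = up (up \<gamma> k) j" by (auto simp: fun_eq_iff)
  have sq1: "mono_sq (up \<gamma> j) = kappa (Suc d) * (x * F)" "mono_sq (up \<gamma> k) = kappa (Suc d) * (y * F)"
    and sq0: "mono_sq \<gamma> = kappa d * F"
    by (simp_all only: mono_sq_eq sum_up mfact_up d_def F_def x_def y_def)
  have sq2: "mono_sq (up (up \<gamma> j) k) = kappa (Suc (Suc d)) * ((y + (if j = k then 1 else 0)) * (x * F))"
  proof -
    have "real ((up \<gamma> j) k) + 1 = y + (if j = k then 1 else 0)"
      by (auto simp: y_def)
    then show ?thesis by (simp only: mono_sq_eq sum_up mfact_up d_def F_def x_def)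
  qed
  have sol: "ip (L2 M) (solution (up \<gamma> j) j) (solution (up \<gamma> k) k)
      = complex_of_real (mono_sq (up (up \<gamma> j) k) - mono_sq (up \<gamma> j) * mono_sq (up \<gamma> k) / mono_sq \<gamma>)"
    unfolding ip_solutions ip_raw_solutions ip_projection_raw_solution low comm by simp
  have ratio: "(mono_sq (up (up \<gamma> j) k) - mono_sq (up \<gamma> j) * mono_sq (up \<gamma> k) / mono_sq \<gamma>)
        / sqrt (mono_sq (up \<gamma> j) * mono_sq (up \<gamma> k))
      = (if j = k then kappa_ratio (Suc d) else 0) + (kappa_ratio (Suc d) - kappa_ratio d) * weight \<gamma> $ j * weight \<gamma> $ k"
  proof -
    have root: "sqrt (mono_sq (up \<gamma> j) * mono_sq (up \<gamma> k)) = kappa (Suc d) * F * (sqrt x * sqrt y)"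
    proof -
      have "mono_sq (up \<gamma> j) * mono_sq (up \<gamma> k) = (kappa (Suc d) * F)\<^sup>2 * (x * y)"
        unfolding sq1 by (simp add: power2_eq_square mult_ac)
      then show ?thesis using pos by (simp add: real_sqrt_mult)
    qed
    have w: "weight \<gamma> $ j = sqrt x" "weight \<gamma> $ k = sqrt y"
      by (simp_all add: weight_def x_def y_def)
    have xy: "x * y = (sqrt x * sqrt y) * (sqrt x * sqrt y)"
      using pos by (simp add: mult_ac)
    have nz: "sqrt x * sqrt y \<noteq> 0" using pos by simp
    have eq_case: "x = sqrt x * sqrt y" if "j = k"
      using that pos by (simp add: x_def y_def)
    have "mono_sq (up (up \<gamma> j) k) - mono_sq (up \<gamma> j) * mono_sq (up \<gamma> k) / mono_sq \<gamma>
        = kappa (Suc d) * F * (kappa_ratio (Suc d) * ((if j = k then x else 0) + x * y) - kappa_ratio d * (x * y))"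
      unfolding sq0 sq1 sq2 kappa_ratio_def using pos by (simp add: field_simps)
    also have "(if j = k then x else 0) = (if j = k then sqrt x * sqrt y else 0)"
      using eq_case by simp
    finally have num: "mono_sq (up (up \<gamma> j) k) - mono_sq (up \<gamma> j) * mono_sq (up \<gamma> k) / mono_sq \<gamma>
        = kappa (Suc d) * F * (kappa_ratio (Suc d) * ((if j = k then sqrt x * sqrt y else 0) + x * y) - kappa_ratio d * (x * y))" .
    have "c * f * (A * ((if j = k then r else 0) + r * r) - B * (r * r)) / (c * f * r)
        = (if j = k then A else 0) + (A - B) * r" if "c \<noteq> 0" "f \<noteq> 0" "r \<noteq> 0" for c f A B r :: real
      using that by (simp add: field_simps)
    from this[OF _ _ nz, of "kappa (Suc d)" F] show ?thesis
      unfolding num root w xy using pos by (simp add: mult.assoc)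
  qed
  have "ip (L2 M) (unit_solution (up \<gamma> j) j) (unit_solution (up \<gamma> k) k)
      = complex_of_real ((mono_sq (up (up \<gamma> j) k) - mono_sq (up \<gamma> j) * mono_sq (up \<gamma> k) / mono_sq \<gamma>)
        / sqrt (mono_sq (up \<gamma> j) * mono_sq (up \<gamma> k)))"
    by (simp only: ip_unit_solutions sol of_real_mult[symmetric] times_divide_eq_left mult_1_left)
  then show ?thesis by (simp only: ratio d_def diff_Suc_1)
qed

definition eigenvalue :: "('n \<Rightarrow> nat) \<times> 'n \<Rightarrow> real" where
  "eigenvalue = split_eigenvalue kappa_ratio
     (\<lambda>d. kappa_ratio d + (kappa_ratio d - kappa_ratio (d - 1)) * real (d - 1 + CARD('n))) undefined"

abbreviation eigenform :: "('n \<Rightarrow> nat) \<times> 'n \<Rightarrow> 'n \<Rightarrow> complex ^ 'n \<Rightarrow> complex" where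
  "eigenform \<equiv> block_rotate undefined (A2_01 M) unit_form"

abbreviation eigensolution :: "('n \<Rightarrow> nat) \<times> 'n \<Rightarrow> complex ^ 'n \<Rightarrow> complex" where
  "eigensolution \<equiv> block_rotate undefined (L2 M) unit_solution"

lemma ip_eigenforms: "ip (A2_01 M) (eigenform x) (eigenform y) = (if x = y then 1 else 0)"
proof -
  have "ip (A2_01 M) (eigenform x) (eigenform y) = (if x = y then complex_of_real
      (split_eigenvalue (\<lambda>_. 1) (\<lambda>d. 1 + 0 * real (d - 1 + CARD('n))) undefined x) else 0)"
  proof (rule F.ip_block_rotate[OF unit_form_mem])
    fix \<alpha> \<beta> :: "'n \<Rightarrow> nat" and j k assume "up \<alpha> k \<noteq> up \<beta> j"
    then have "\<not> (\<alpha> = \<beta> \<and> j = k)" by blast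
    then show "ip (A2_01 M) (unit_form \<alpha> j) (unit_form \<beta> k) = 0"
      unfolding ip_unit_forms by (rule if_not_P)
  next
    fix \<gamma> :: "'n \<Rightarrow> nat" and j k
    have "(up \<gamma> j = up \<gamma> k \<and> j = k) = (j = k)" by blast
    then show "ip (A2_01 M) (unit_form (up \<gamma> j) j) (unit_form (up \<gamma> k) k)
        = complex_of_real ((if j = k then 1 else 0) + 0 * weight \<gamma> $ j * weight \<gamma> $ k)"
      unfolding ip_unit_forms by simp
  qed (simp add: ip_unit_forms del: A2_01_simps)
  then show ?thesis by (cases x) (simp add: split_eigenvalue_def)
qed

lemma ip_eigensolutions:
  "ip (L2 M) (eigensolution x) (eigensolution y) = (if x = y then complex_of_real (eigenvalue x) else 0)"
  unfolding eigenvalue_def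
  by (intro L.ip_block_rotate unit_solution_mem unit_solutions_other_block unit_solutions_single unit_solutions_block)

text \<open>
  A form orthogonal to the eigenforms is orthogonal to all monomial forms, hence its coefficients are
  orthogonal to \<open>A2 M\<close>, which contains them.
\<close>

lemma eigenforms_total:
  assumes \<omega>: "\<omega> \<in> vecs (A2_01 M)" and orth: "\<And>x. ip (A2_01 M) \<omega> (eigenform x) = 0"
  shows "hnorm (A2_01 M) \<omega> = 0"
proof -
  have \<omega>': "\<omega> j \<in> A2 M" for j using \<omega> by simp
  have "ip (L2 M) (\<omega> j) (monomial \<alpha>) = 0" for j \<alpha>
  proof -
    have "ip (A2_01 M) \<omega> (unit_form \<alpha> j) = 0"
      by (rule F.block_rotate_total[OF unit_form_mem \<omega> orth])
    then have "ip (A2_01 M) \<omega> (monomial_form \<alpha> j) = 0"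
      using mono_sq_pos[of \<alpha>] F.ip_scl_right[OF monomial_form_mem \<omega>] by (simp add: unit_form_def del: A2_01_simps)
    then show ?thesis by (simp only: ip_monomial_form[OF \<omega>'])
  qed
  then have "ip (L2 M) (\<omega> j) (\<omega> j) = 0" for j
    by (rule orthogonal_A2[OF A2_L2[OF \<omega>'] _ \<omega>'])
  then have "ip (A2_01 M) \<omega> \<omega> = 0" by (simp only: A2_01_simps sum.neutral_const)
  then show ?thesis by (simp add: hnorm_def del: A2_01_simps)
qed

definition index :: "nat \<Rightarrow> ('n \<Rightarrow> nat) \<times> 'n" where
  "index = from_nat_into UNIV"

lemma bij_index: "bij index"
proof -
  have "inj (\<lambda>d :: nat. ((\<lambda>_ :: 'n. d), undefined :: 'n))"
    by (auto simp: inj_def fun_eq_iff)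
  then have "infinite (UNIV :: (('n \<Rightarrow> nat) \<times> 'n) set)"
    using finite_subset infinite_UNIV_nat range_inj_infinite by (metis subset_UNIV)
  then show ?thesis
    unfolding index_def by (intro bij_betw_from_nat_into) auto
qed

sublocale diagonal_system "A2_01 M" "L2 M" "\<lambda>i. eigenform (index i)" "\<lambda>i. eigensolution (index i)"
  "\<lambda>i. eigenvalue (index i)"
proof
  show "eigenform (index i) \<in> vecs (A2_01 M)" for i
    by (intro F.block_rotate_mem unit_form_mem)
  show "eigensolution (index i) \<in> vecs (L2 M)" for i
    by (intro L.block_rotate_mem unit_solution_mem)
  have inj: "index i = index k \<longleftrightarrow> i = k" for i k
    using bij_index by (auto simp: bij_def inj_def)
  show "ip (A2_01 M) (eigenform (index i)) (eigenform (index k)) = (if i = k then complex_of_real 1 else 0)" for i k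
    by (simp only: ip_eigenforms inj of_real_1)
  show "ip (L2 M) (eigensolution (index i)) (eigensolution (index k))
      = (if i = k then complex_of_real (eigenvalue (index i)) else 0)" for i k
    by (simp only: ip_eigensolutions inj)
  show "hnorm (A2_01 M) \<omega> = 0"
    if "\<omega> \<in> vecs (A2_01 M)" "\<And>i. ip (A2_01 M) \<omega> (eigenform (index i)) = 0" for \<omega>
  proof (rule eigenforms_total[OF that(1)])
    show "ip (A2_01 M) \<omega> (eigenform x) = 0" for x
      using bij_index that(2) by (metis bij_pointE)
  qed
qed

text \<open>
  The element of \<open>raw_solution \<alpha> j + A2 M\<close> that is orthogonal to \<open>A2 M\<close> is unique up to a function of
  norm 0.
\<close>

lemma is_canonical_solution_op_iff:
  assumes T: "linear_op (A2_01 M) (L2 M) T"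
  shows "is_canonical_solution_op M T \<longleftrightarrow> (\<forall>\<alpha> j. heq (L2 M) (T (monomial_form \<alpha> j)) (solution \<alpha> j))"
proof -
  have T_mem: "T (monomial_form \<alpha> j) \<in> vecs (L2 M)" for \<alpha> j
    using T monomial_form_mem unfolding linear_op_def by blast
  have restrict: "linear_op ((A2_01 M)\<lparr>vecs := {\<omega>. \<forall>j. \<omega> j \<in> polynomials}\<rparr>) (L2 M) T"
    using T polynomials_A2 unfolding linear_op_def by (simp add: subset_iff)
  have "(T (monomial_form \<alpha> j) - raw_solution \<alpha> j \<in> A2 M \<and> (\<forall>g\<in>A2 M. ip (L2 M) (T (monomial_form \<alpha> j)) g = 0))
      \<longleftrightarrow> heq (L2 M) (T (monomial_form \<alpha> j)) (solution \<alpha> j)" for \<alpha> j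
  proof
    let ?h = "T (monomial_form \<alpha> j) - solution \<alpha> j"
    have h: "?h = (T (monomial_form \<alpha> j) - raw_solution \<alpha> j) + raw_projection \<alpha> j"
      by (simp add: solution_def)
    assume L: "T (monomial_form \<alpha> j) - raw_solution \<alpha> j \<in> A2 M \<and> (\<forall>g\<in>A2 M. ip (L2 M) (T (monomial_form \<alpha> j)) g = 0)"
    then have "?h \<in> A2 M" unfolding h by (intro A2_add) auto
    then have "ip (L2 M) ?h ?h = 0"
      using L solution_orthogonal_A2[of ?h \<alpha> j] L.ip_diff_left[OF T_mem solution_L2 A2_L2, of ?h \<alpha> j \<alpha> j]
      by (simp del: L2_simps)
    then show "heq (L2 M) (T (monomial_form \<alpha> j)) (solution \<alpha> j)"
      by (simp add: heq_def hnorm_def del: L2_simps)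
  next
    let ?h = "T (monomial_form \<alpha> j) - solution \<alpha> j"
    assume R: "heq (L2 M) (T (monomial_form \<alpha> j)) (solution \<alpha> j)"
    have "heq (L2 M) ?h 0" using R by (simp add: heq_def)
    moreover have "0 \<in> A2 M" using zero_polynomials polynomials_A2 by blast
    ultimately have "?h \<in> A2 M"
      using A2_heq L.diff_mem[OF T_mem solution_L2] by blast
    then have "?h - raw_projection \<alpha> j \<in> A2 M"
      by (rule A2_diff[OF _ raw_projection_A2])
    also have "?h - raw_projection \<alpha> j = T (monomial_form \<alpha> j) - raw_solution \<alpha> j"
      by (simp add: solution_def)
    finally have "T (monomial_form \<alpha> j) - raw_solution \<alpha> j \<in> A2 M" .
    moreover have "ip (L2 M) (T (monomial_form \<alpha> j)) g = 0" if "g \<in> A2 M" for g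
      using R that solution_orthogonal_A2[OF that] A2_L2[OF that]
      by (subst (asm) L.heq_iff_ip[OF T_mem solution_L2]) (simp del: L2_simps)
    ultimately show "T (monomial_form \<alpha> j) - raw_solution \<alpha> j \<in> A2 M
        \<and> (\<forall>g\<in>A2 M. ip (L2 M) (T (monomial_form \<alpha> j)) g = 0)" by blast
  qed
  then show ?thesis
    using restrict unfolding is_canonical_solution_op_def raw_solution_def by blast
qed

lemma heq_unit_solution_iff:
  assumes T: "linear_op (A2_01 M) (L2 M) T"
  shows "heq (L2 M) (T (unit_form \<alpha> j)) (unit_solution \<alpha> j) \<longleftrightarrow> heq (L2 M) (T (monomial_form \<alpha> j)) (solution \<alpha> j)"
proof -
  have T_mem: "T x \<in> vecs (L2 M)" if "x \<in> vecs (A2_01 M)" for x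
    using T that unfolding linear_op_def by blast
  have "ip (L2 M) (T (unit_form \<alpha> j)) v = complex_of_real (1 / sqrt (mono_sq \<alpha>)) * ip (L2 M) (T (monomial_form \<alpha> j)) v"
    if v: "v \<in> vecs (L2 M)" for v
    using linear_op_ip_sum[OF F.semi_inner_axioms L.semi_inner_axioms T, of "{()}" "\<lambda>_. monomial_form \<alpha> j" v
        "\<lambda>_. complex_of_real (1 / sqrt (mono_sq \<alpha>))"] v
    by (simp add: unit_form_def del: L2_simps A2_01_simps)
  moreover have "ip (L2 M) (unit_solution \<alpha> j) v = complex_of_real (1 / sqrt (mono_sq \<alpha>)) * ip (L2 M) (solution \<alpha> j) v"
    if "v \<in> vecs (L2 M)" for v
    using that by (simp add: unit_solution_def del: L2_simps)
  moreover have "complex_of_real (1 / sqrt (mono_sq \<alpha>)) \<noteq> 0"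
    using mono_sq_pos[of \<alpha>] by simp
  ultimately show ?thesis
    by (simp add: L.heq_iff_ip T_mem del: L2_simps A2_01_simps)
qed

lemma is_canonical_solution_op_iff_eigensolution:
  assumes T: "linear_op (A2_01 M) (L2 M) T"
  shows "is_canonical_solution_op M T \<longleftrightarrow> (\<forall>i. heq (L2 M) (T (eigenform (index i))) (eigensolution (index i)))"
proof -
  have "is_canonical_solution_op M T \<longleftrightarrow> (\<forall>\<alpha> j. heq (L2 M) (T (unit_form \<alpha> j)) (unit_solution \<alpha> j))"
    using T by (simp add: is_canonical_solution_op_iff heq_unit_solution_iff)
  also have "\<dots> \<longleftrightarrow> (\<forall>x. heq (L2 M) (T (eigenform x)) (eigensolution x))"
    by (rule block_rotate_image_iff[OF F.semi_inner_axioms L.semi_inner_axioms T unit_form_mem unit_solution_mem, symmetric])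
  also have "\<dots> \<longleftrightarrow> (\<forall>i. heq (L2 M) (T (eigenform (index i))) (eigensolution (index i)))"
    using bij_index by (metis bij_pointE)
  finally show ?thesis .
qed

theorem canonical_solution_schatten_iff_eigenvalues:
  assumes "0 < p"
  shows "(\<exists>T\<in>schatten_class p (A2_01 M) (L2 M). is_canonical_solution_op M T)
    \<longleftrightarrow> (\<lambda>x. eigenvalue x powr (p / 2)) summable_on UNIV"
proof -
  have lin: "linear_op (A2_01 M) (L2 M) T" if "T \<in> schatten_class p (A2_01 M) (L2 M)" for T
    using that by (simp add: schatten_class_def compact_op_def bounded_op_def)
  have "(\<exists>T\<in>schatten_class p (A2_01 M) (L2 M). is_canonical_solution_op M T)
    \<longleftrightarrow> (\<lambda>i. eigenvalue (index i) powr (p / 2)) summable_on UNIV"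
    using schatten_class_imp_summable summable_imp_schatten_class[OF _ assms]
      is_canonical_solution_op_iff_eigensolution lin by blast
  also have "\<dots> \<longleftrightarrow> (\<lambda>x. eigenvalue x powr (p / 2)) summable_on UNIV"
    using summable_on_reindex_bij_betw[OF bij_index, of "\<lambda>x. eigenvalue x powr (p / 2)"] by simp
  finally show ?thesis .
qed

lemma eigenvalue_nonneg: "0 \<le> eigenvalue x"
  using l_nonneg bij_index by (metis bij_pointE)

lemma kappa_ratio_eq: "kappa_ratio d = moment M (d + 1) / (real (CARD('n) + d) * moment M d)"
  by (simp add: kappa_ratio_def kappa_Suc_divide)

text \<open>
  The trace \<open>(n - 1) a + b\<close> of a block of degree \<open>d\<close> is
  \<open>(2 n + d - 1) kappa_ratio d - (n + d - 1) kappa_ratio (d - 1)\<close>, which is the expression in the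
  moments.
\<close>

theorem canonical_solution_schatten_iff:
  assumes "0 < p"
  shows "(\<exists>T\<in>schatten_class p (A2_01 M) (L2 M). is_canonical_solution_op M T) \<longleftrightarrow>
    (\<lambda>d. real ((CARD('n) + d - 2) choose (CARD('n) - 1)) *
          (real (2 * CARD('n) + d - 1) * moment M (d + 1) / (real (CARD('n) + d) * moment M d)
             - moment M d / moment M (d - 1)) powr (p / 2)) summable_on {1..}"
proof -
  define b where "b d = kappa_ratio d + (kappa_ratio d - kappa_ratio (d - 1)) * real (d - 1 + CARD('n))" for d
  have n: "1 \<le> CARD('n)" by (simp add: Suc_leI)
  have "0 \<le> b d" if "1 \<le> d" for d
    using eigenvalue_nonneg[of "((\<lambda>_. 0)(undefined := d), undefined)"] that
    by (simp add: eigenvalue_def split_eigenvalue_def b_def algebra_simps)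
  moreover have "0 \<le> kappa_ratio d" for d
    using kappa_pos[of d] kappa_pos[of "Suc d"] by (simp add: kappa_ratio_def)
  ultimately have "(\<lambda>x. eigenvalue x powr (p / 2)) summable_on UNIV \<longleftrightarrow>
    (\<lambda>d. real ((CARD('n) + d - 2) choose (CARD('n) - 1)) * (real (CARD('n) - 1) * kappa_ratio d + b d) powr (p / 2)) summable_on {1..}"
    unfolding eigenvalue_def b_def[symmetric] using assms by (intro summable_on_split_eigenvalue_iff) auto
  also have "\<dots> \<longleftrightarrow> (\<lambda>d. real ((CARD('n) + d - 2) choose (CARD('n) - 1)) *
          (real (2 * CARD('n) + d - 1) * moment M (d + 1) / (real (CARD('n) + d) * moment M d)
             - moment M d / moment M (d - 1)) powr (p / 2)) summable_on {1..}"
  proof (intro summable_on_cong)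
    fix d :: nat assume "d \<in> {1..}"
    then obtain e where d: "d = Suc e" by (cases d) auto
    have trace: "real (CARD('n) - 1) * kappa_ratio d + b d
        = real (2 * CARD('n) + d - 1) * kappa_ratio d - real (CARD('n) + e) * kappa_ratio e"
      using n by (simp add: b_def d of_nat_diff algebra_simps)
    have "real (CARD('n) + e) * kappa_ratio e = moment M d / moment M e"
    proof -
      have "0 < real (CARD('n) + e)" by (simp only: of_nat_0_less_iff) simp
      then show ?thesis by (simp only: kappa_ratio_eq d) simp
    qed
    then have "real (CARD('n) - 1) * kappa_ratio d + b d
        = real (2 * CARD('n) + d - 1) * kappa_ratio d - moment M d / moment M e"
      by (simp only: trace)
    also have "\<dots> = real (2 * CARD('n) + d - 1) * moment M (d + 1) / (real (CARD('n) + d) * moment M d) - moment M d / moment M (d - 1)"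
      unfolding kappa_ratio_eq[of d] by (simp add: d)
    finally show "real ((CARD('n) + d - 2) choose (CARD('n) - 1)) * (real (CARD('n) - 1) * kappa_ratio d + b d) powr (p / 2)
      = real ((CARD('n) + d - 2) choose (CARD('n) - 1)) *
          (real (2 * CARD('n) + d - 1) * moment M (d + 1) / (real (CARD('n) + d) * moment M d)
             - moment M d / moment M (d - 1)) powr (p / 2)"
      by simp
  qed
  finally show ?thesis
    unfolding canonical_solution_schatten_iff_eigenvalues[OF assms] .
qed

end

theorem corollary9:
  fixes M :: "(complex ^ 'n) measure" and p :: real
  assumes "sets M = sets borel"
    and "rotation_invariant M"
    and "\<And>d. integrable M (\<lambda>z. norm z ^ (2 * d))"
    and "\<And>d. 0 < moment M d"
    and "0 < p"
  shows "(\<exists>T \<in> schatten_class p (A2_01 M) (L2 M). is_canonical_solution_op M T) \<longleftrightarrow>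
    (\<lambda>d. real ((CARD('n) + d - 2) choose (CARD('n) - 1)) *
          (real (2 * CARD('n) + d - 1) * moment M (d + 1) / (real (CARD('n) + d) * moment M d)
             - moment M d / moment M (d - 1)) powr (p / 2)) summable_on {1..}"
proof -
  interpret radial_measure M
    by (rule radial_measure.intro) (fact assms)+
  show ?thesis
    by (rule canonical_solution_schatten_iff) fact
qed

end
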